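(* Let $2\le n,m<\infty$ be integers and let $\Theta=(q_{ij})_{1\le i\le n,\,1\le j\le m}$ be a matrix of complex numbers with $|q_{ij}|=1$. Then $\mathcal O_n\otimes_\Theta\mathcal O_m$ is purely infinite.
   Context: For $2\le n,m<\infty$ and a matrix $\Theta=(q_{ij})$ of complex scalars of absolute value one ($i=1,\dots,n$, $j=1,\dots,m$), $\mathcal O_n\otimes_\Theta\mathcal O_m$ is the universal unital $C^*$-algebra generated by isometries $s_1,\dots,s_n$ and $t_1,\dots,t_m$ with $\sum_{i=1}^n s_is_i^*=\sum_{j=1}^m t_jt_j^*=1$ and $s_it_j=q_{ij}t_js_i$ for all $i$ and $j$. A unital $C^*$-algebra $A$ is called purely infinite if for every nonzero $x\in A$ there are $a,b\in A$ such that $axb=1$ (in particular, $A$ is then simple). *)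

theory Defs
  imports "HOL-Analysis.Analysis" "HOL-Algebra.Ring" "HOL-Library.Poly_Mapping"
begin

section \<open>Unital C*-algebras\<close>

record 'a cstar_alg = "'a ring" +
  cscale :: "complex \<Rightarrow> 'a \<Rightarrow> 'a"
  adj :: "'a \<Rightarrow> 'a"
  cnorm :: "'a \<Rightarrow> real"

text \<open>The zero algebra is not excluded.\<close>

locale unital_cstar_algebra = ring A for A :: "('a, 'm) cstar_alg_scheme" (structure) +
  assumes scale_closed: "x \<in> carrier A \<Longrightarrow> cscale A c x \<in> carrier A"
    and scale_add_right: "x \<in> carrier A \<Longrightarrow> y \<in> carrier A \<Longrightarrow>
          cscale A c (x \<oplus> y) = cscale A c x \<oplus> cscale A c y"
    and scale_add_left: "x \<in> carrier A \<Longrightarrow> cscale A (c + d) x = cscale A c x \<oplus> cscale A d x"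
    and scale_scale: "x \<in> carrier A \<Longrightarrow> cscale A c (cscale A d x) = cscale A (c * d) x"
    and scale_one: "x \<in> carrier A \<Longrightarrow> cscale A 1 x = x"
    and scale_mult_left: "x \<in> carrier A \<Longrightarrow> y \<in> carrier A \<Longrightarrow>
          cscale A c x \<otimes> y = cscale A c (x \<otimes> y)"
    and scale_mult_right: "x \<in> carrier A \<Longrightarrow> y \<in> carrier A \<Longrightarrow>
          x \<otimes> cscale A c y = cscale A c (x \<otimes> y)"
    and adj_closed: "x \<in> carrier A \<Longrightarrow> adj A x \<in> carrier A"
    and adj_adj: "x \<in> carrier A \<Longrightarrow> adj A (adj A x) = x"
    and adj_add: "x \<in> carrier A \<Longrightarrow> y \<in> carrier A \<Longrightarrow> adj A (x \<oplus> y) = adj A x \<oplus> adj A y"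
    and adj_scale: "x \<in> carrier A \<Longrightarrow> adj A (cscale A c x) = cscale A (cnj c) (adj A x)"
    and adj_mult: "x \<in> carrier A \<Longrightarrow> y \<in> carrier A \<Longrightarrow> adj A (x \<otimes> y) = adj A y \<otimes> adj A x"
    and norm_eq_0: "x \<in> carrier A \<Longrightarrow> cnorm A x = 0 \<longleftrightarrow> x = \<zero>"
    and norm_add: "x \<in> carrier A \<Longrightarrow> y \<in> carrier A \<Longrightarrow> cnorm A (x \<oplus> y) \<le> cnorm A x + cnorm A y"
    and norm_scale: "x \<in> carrier A \<Longrightarrow> cnorm A (cscale A c x) = norm c * cnorm A x"
    and norm_mult_le: "x \<in> carrier A \<Longrightarrow> y \<in> carrier A \<Longrightarrow> cnorm A (x \<otimes> y) \<le> cnorm A x * cnorm A y"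
    and cstar_identity: "x \<in> carrier A \<Longrightarrow> cnorm A (adj A x \<otimes> x) = (cnorm A x)\<^sup>2"
    and complete: "(\<And>k. u k \<in> carrier A) \<Longrightarrow>
          (\<And>e. e > 0 \<Longrightarrow> \<exists>N. \<forall>j\<ge>N. \<forall>k\<ge>N. cnorm A (u j \<ominus> u k) < e) \<Longrightarrow>
          \<exists>l\<in>carrier A. (\<lambda>k. cnorm A (u k \<ominus> l)) \<longlonglongrightarrow> 0"


context unital_cstar_algebra
begin

lemma a_inv_eq_scale: "x \<in> carrier A \<Longrightarrow> \<ominus> x = cscale A (-1) x"
proof (rule minus_equality)
  assume x: "x \<in> carrier A"
  have "cscale A 0 x \<oplus> cscale A 0 x = cscale A 0 x" using x scale_add_left[of x 0 0] by simp
  then have "cscale A 0 x = \<zero>" using x scale_closed by (metis add.r_cancel_one')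
  then show "cscale A (-1) x \<oplus> x = \<zero>" using x scale_add_left[of x "-1" 1] scale_one by simp
qed (simp_all add: scale_closed)

lemma cnorm_zero [simp]: "cnorm A \<zero> = 0"
  by (simp add: norm_eq_0)

lemma cnorm_minus: "x \<in> carrier A \<Longrightarrow> cnorm A (\<ominus> x) = cnorm A x"
  by (simp add: a_inv_eq_scale norm_scale)

lemma cnorm_nonneg: "x \<in> carrier A \<Longrightarrow> 0 \<le> cnorm A x"
  using norm_add[of x "\<ominus> x"] by (simp add: cnorm_minus r_neg)

lemma cnorm_adj_le: assumes "x \<in> carrier A" shows "cnorm A x \<le> cnorm A (adj A x)"
proof (cases "cnorm A x = 0")
  case False
  have "cnorm A x * cnorm A x \<le> cnorm A (adj A x) * cnorm A x"
    using assms cstar_identity[of x] norm_mult_le[of "adj A x" x] adj_closed by (simp add: power2_eq_square)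
  with False cnorm_nonneg[OF assms] show ?thesis by (metis mult_le_cancel_right_pos order_le_less)
qed (simp add: assms adj_closed cnorm_nonneg)

lemma cnorm_adj: "x \<in> carrier A \<Longrightarrow> cnorm A (adj A x) = cnorm A x"
  using cnorm_adj_le[of x] cnorm_adj_le[of "adj A x"] by (simp add: adj_closed adj_adj)

lemma scale_zero: "cscale A c \<zero> = \<zero>"
  using norm_scale[of \<zero> c] norm_eq_0 scale_closed by simp

lemma adj_zero: "adj A \<zero> = \<zero>"
  using cnorm_adj[of \<zero>] norm_eq_0 adj_closed by simp

lemma adj_one: "adj A \<one> = \<one>"
  by (metis adj_adj adj_closed adj_mult l_one one_closed r_one)

lemma scale_zero_left: "x \<in> carrier A \<Longrightarrow> cscale A 0 x = \<zero>"
  using norm_scale[of x 0] norm_eq_0 scale_closed by simp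

lemma minus_eq_add_minus:
  "x \<in> carrier A \<Longrightarrow> y \<in> carrier A \<Longrightarrow> z \<in> carrier A \<Longrightarrow> x \<ominus> z = (x \<ominus> y) \<oplus> (y \<ominus> z)"
  by (simp add: a_minus_def a_assoc r_neg1)

definition converges :: "(nat \<Rightarrow> 'a) \<Rightarrow> 'a \<Rightarrow> bool"
  where "converges u l \<longleftrightarrow> range u \<subseteq> carrier A \<and> l \<in> carrier A \<and> (\<lambda>k. cnorm A (u k \<ominus> l)) \<longlonglongrightarrow> 0"

lemma converges_le:
  assumes "range u \<subseteq> carrier A" "l \<in> carrier A" "f \<longlonglongrightarrow> 0" "\<And>k. cnorm A (u k \<ominus> l) \<le> f k"
  shows "converges u l"
proof -
  have "0 \<le> cnorm A (u k \<ominus> l)" for k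
    using assms(1,2) by (intro cnorm_nonneg minus_closed) auto
  then have "(\<lambda>k. cnorm A (u k \<ominus> l)) \<longlonglongrightarrow> 0"
    using assms(3,4) by (intro tendsto_sandwich[OF _ _ tendsto_const assms(3)]) simp_all
  with assms(1,2) show ?thesis by (simp add: converges_def)
qed

lemma converges_const: "l \<in> carrier A \<Longrightarrow> converges (\<lambda>_. l) l"
  by (auto simp: converges_def a_minus_def r_neg)

lemma converges_unique:
  assumes "converges u l" "converges u m" shows "l = m"
proof -
  have c: "\<And>k. u k \<in> carrier A" "l \<in> carrier A" "m \<in> carrier A" using assms by (auto simp: converges_def)
  have le: "cnorm A (l \<ominus> m) \<le> cnorm A (u k \<ominus> l) + cnorm A (u k \<ominus> m)" for k
  proof -
    have "l \<ominus> m = (l \<ominus> u k) \<oplus> (u k \<ominus> m)" using c by (intro minus_eq_add_minus)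
    moreover have "l \<ominus> u k = \<ominus> (u k \<ominus> l)"
      using c(1)[of k] c(2) by (simp add: a_minus_def minus_add a_comm)
    ultimately show ?thesis using norm_add[of "\<ominus> (u k \<ominus> l)" "u k \<ominus> m"] c cnorm_minus[of "u k \<ominus> l"] by simp
  qed
  have "(\<lambda>k. cnorm A (u k \<ominus> l) + cnorm A (u k \<ominus> m)) \<longlonglongrightarrow> 0"
    using assms by (intro tendsto_add_zero) (auto simp: converges_def)
  then have "cnorm A (l \<ominus> m) \<le> 0" by (rule LIMSEQ_le_const) (use le in blast)
  then have "l \<ominus> m = \<zero>" using c cnorm_nonneg[of "l \<ominus> m"] norm_eq_0[of "l \<ominus> m"] by simp
  then show ?thesis using c by (metis a_minus_def a_inv_closed minus_minus minus_equality)
qed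

lemma converges_add:
  assumes "converges u l" "converges v m" shows "converges (\<lambda>k. u k \<oplus> v k) (l \<oplus> m)"
proof (rule converges_le)
  have c: "\<And>k. u k \<in> carrier A" "l \<in> carrier A" "\<And>k. v k \<in> carrier A" "m \<in> carrier A"
    using assms by (auto simp: converges_def)
  show "range (\<lambda>k. u k \<oplus> v k) \<subseteq> carrier A" "l \<oplus> m \<in> carrier A" using c by auto
  show "(\<lambda>k. cnorm A (u k \<ominus> l) + cnorm A (v k \<ominus> m)) \<longlonglongrightarrow> 0"
    using assms by (intro tendsto_add_zero) (auto simp: converges_def)
  fix k
  have "(u k \<oplus> v k) \<ominus> (l \<oplus> m) = (u k \<ominus> l) \<oplus> (v k \<ominus> m)" using c(1)[of k] c(3)[of k] c(2,4) by algebra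
  then show "cnorm A ((u k \<oplus> v k) \<ominus> (l \<oplus> m)) \<le> cnorm A (u k \<ominus> l) + cnorm A (v k \<ominus> m)"
    using norm_add c by simp
qed

lemma converges_mult:
  assumes "converges u l" "converges v m" shows "converges (\<lambda>k. u k \<otimes> v k) (l \<otimes> m)"
proof (rule converges_le)
  have c: "\<And>k. u k \<in> carrier A" "l \<in> carrier A" "\<And>k. v k \<in> carrier A" "m \<in> carrier A"
    using assms by (auto simp: converges_def)
  show "range (\<lambda>k. u k \<otimes> v k) \<subseteq> carrier A" "l \<otimes> m \<in> carrier A" using c by auto
  let ?f = "\<lambda>k. cnorm A (u k \<ominus> l) * (cnorm A (v k \<ominus> m) + cnorm A m) + cnorm A l * cnorm A (v k \<ominus> m)"
  have "?f \<longlonglongrightarrow> 0 * (0 + cnorm A m) + cnorm A l * 0"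
    using assms unfolding converges_def by (intro tendsto_add tendsto_mult tendsto_const) simp_all
  then show "?f \<longlonglongrightarrow> 0" by simp
  fix k
  note ck = c(1)[of k] c(3)[of k] c(2,4)
  have "(u k \<otimes> v k) \<ominus> (l \<otimes> m) = (u k \<otimes> v k \<ominus> l \<otimes> v k) \<oplus> (l \<otimes> v k \<ominus> l \<otimes> m)"
    using ck by (intro minus_eq_add_minus) auto
  also have "\<dots> = (u k \<ominus> l) \<otimes> v k \<oplus> l \<otimes> (v k \<ominus> m)"
    using ck by (simp add: a_minus_def l_distr r_distr l_minus r_minus)
  finally have "cnorm A ((u k \<otimes> v k) \<ominus> (l \<otimes> m)) \<le> cnorm A ((u k \<ominus> l) \<otimes> v k) + cnorm A (l \<otimes> (v k \<ominus> m))"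
    using norm_add ck by simp
  also have "\<dots> \<le> cnorm A (u k \<ominus> l) * cnorm A (v k) + cnorm A l * cnorm A (v k \<ominus> m)"
    using ck by (intro add_mono norm_mult_le) auto
  also have "\<dots> \<le> ?f k"
  proof -
    have "v k = (v k \<ominus> m) \<oplus> m" using ck by (simp add: a_minus_def a_assoc l_neg)
    then have "cnorm A (v k) \<le> cnorm A (v k \<ominus> m) + cnorm A m" using norm_add[of "v k \<ominus> m" m] ck by simp
    then show ?thesis using ck by (intro add_right_mono mult_left_mono) (auto simp: cnorm_nonneg)
  qed
  finally show "cnorm A ((u k \<otimes> v k) \<ominus> (l \<otimes> m)) \<le> ?f k" .
qed

lemma converges_scale:
  assumes "converges u l" shows "converges (\<lambda>k. cscale A c (u k)) (cscale A c l)"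
proof -
  have c: "\<And>k. u k \<in> carrier A" "l \<in> carrier A" using assms by (auto simp: converges_def)
  have "converges (\<lambda>k. cscale A c \<one> \<otimes> u k) (cscale A c \<one> \<otimes> l)"
    by (intro converges_mult converges_const assms) (simp add: scale_closed)
  then show ?thesis using c by (simp add: scale_mult_left)
qed

lemma adj_minus: "x \<in> carrier A \<Longrightarrow> y \<in> carrier A \<Longrightarrow> adj A (x \<ominus> y) = adj A x \<ominus> adj A y"
  by (simp add: a_minus_def adj_add a_inv_eq_scale adj_scale adj_closed scale_closed)

lemma converges_adj:
  assumes "converges u l" shows "converges (\<lambda>k. adj A (u k)) (adj A l)"
proof -
  have c: "\<And>k. u k \<in> carrier A" "l \<in> carrier A" using assms by (auto simp: converges_def)
  have "cnorm A (adj A (u k) \<ominus> adj A l) = cnorm A (u k \<ominus> l)" for k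
    using c by (simp add: cnorm_adj flip: adj_minus)
  then show ?thesis using assms c adj_closed by (auto simp: converges_def)
qed

end

definition star_hom :: "('a, 'm) cstar_alg_scheme \<Rightarrow> ('b, 'k) cstar_alg_scheme \<Rightarrow> ('a \<Rightarrow> 'b) \<Rightarrow> bool"
  where "star_hom A B \<phi> \<longleftrightarrow> \<phi> \<in> ring_hom A B \<and>
    (\<forall>c. \<forall>x\<in>carrier A. \<phi> (cscale A c x) = cscale B c (\<phi> x)) \<and>
    (\<forall>x\<in>carrier A. \<phi> (adj A x) = adj B (\<phi> x))"

definition purely_infinite :: "('a, 'm) cstar_alg_scheme \<Rightarrow> bool"
  where "purely_infinite A \<longleftrightarrow> unital_cstar_algebra A \<and>
    (\<forall>x\<in>carrier A. x \<noteq> \<zero>\<^bsub>A\<^esub> \<longrightarrow>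
      (\<exists>a\<in>carrier A. \<exists>b\<in>carrier A. a \<otimes>\<^bsub>A\<^esub> x \<otimes>\<^bsub>A\<^esub> b = \<one>\<^bsub>A\<^esub>))"


section \<open>The free unital *-algebra\<close>

datatype 'g letter = Gen 'g | Adj 'g

datatype 'g star_word = Word (letters: "'g letter list")

instantiation star_word :: (type) monoid_add
begin
definition zero_star_word :: "'a star_word" where "0 = Word []"
definition plus_star_word :: "'a star_word \<Rightarrow> 'a star_word \<Rightarrow> 'a star_word"
  where "u + v = Word (letters u @ letters v)"
instance by standard (auto simp: zero_star_word_def plus_star_word_def)
end

text \<open>Words form a monoid under concatenation, written additively, so the convolution product on
  finitely supported functions is that of the free unital algebra on the letters.\<close>

type_synonym 'g free_star_alg = "'g star_word \<Rightarrow>\<^sub>0 complex"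

primrec letter_adj :: "'g letter \<Rightarrow> 'g letter" where
  "letter_adj (Gen g) = Adj g"
| "letter_adj (Adj g) = Gen g"

definition word_adj :: "'g star_word \<Rightarrow> 'g star_word"
  where "word_adj w = Word (rev (map letter_adj (letters w)))"

definition gen :: "'g \<Rightarrow> 'g free_star_alg"
  where "gen g = Poly_Mapping.single (Word [Gen g]) 1"

definition free_scale :: "complex \<Rightarrow> 'g free_star_alg \<Rightarrow> 'g free_star_alg"
  where "free_scale c x = Poly_Mapping.map ((*) c) x"

definition free_adj :: "'g free_star_alg \<Rightarrow> 'g free_star_alg"
  where "free_adj x = (\<Sum>w\<in>Poly_Mapping.keys x.
           Poly_Mapping.single (word_adj w) (cnj (Poly_Mapping.lookup x w)))"

lemma free_scale_eq: "free_scale c x = Poly_Mapping.single 0 c * x"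
  by (simp add: free_scale_def mult_map_scale_conv_mult)

lemma letter_adj_letter_adj [simp]: "letter_adj (letter_adj l) = l"
  by (cases l) auto

lemma word_adj_word_adj [simp]: "word_adj (word_adj w) = w"
  by (simp add: word_adj_def rev_map[symmetric] o_def)

lemma word_adj_eq_iff: "word_adj v = w \<longleftrightarrow> v = word_adj w"
  by auto

lemma word_adj_add: "word_adj (u + v) = word_adj v + word_adj u"
  by (simp add: word_adj_def plus_star_word_def)

lemma word_adj_0 [simp]: "word_adj 0 = 0"
  by (simp add: word_adj_def zero_star_word_def)

lemma lookup_free_adj: "Poly_Mapping.lookup (free_adj x) w = cnj (Poly_Mapping.lookup x (word_adj w))"
proof -
  have "Poly_Mapping.lookup (free_adj x) w =
      (\<Sum>v\<in>Poly_Mapping.keys x. if v = word_adj w then cnj (Poly_Mapping.lookup x v) else 0)"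
    unfolding free_adj_def lookup_sum lookup_single
    by (intro sum.cong) (auto simp: when_def word_adj_eq_iff)
  also have "\<dots> = cnj (Poly_Mapping.lookup x (word_adj w))"
    by (simp add: sum.delta not_in_keys_iff_lookup_eq_zero)
  finally show ?thesis .
qed

lemma free_adj_0 [simp]: "free_adj 0 = 0"
  by (intro poly_mapping_eqI) (simp add: lookup_free_adj)

lemma free_adj_add: "free_adj (x + y) = free_adj x + free_adj y"
  by (intro poly_mapping_eqI) (simp add: lookup_free_adj lookup_add)

lemma free_adj_diff: "free_adj (x - y) = free_adj x - free_adj y"
  by (intro poly_mapping_eqI) (simp add: lookup_free_adj lookup_minus)

lemma free_adj_adj [simp]: "free_adj (free_adj x) = x"
  by (intro poly_mapping_eqI) (simp add: lookup_free_adj)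

lemma free_adj_single:
  "free_adj (Poly_Mapping.single w c) = Poly_Mapping.single (word_adj w) (cnj c)"
  by (intro poly_mapping_eqI) (auto simp: lookup_free_adj lookup_single when_def word_adj_eq_iff)

lemma free_induct [case_names single add]:
  assumes "\<And>w c. P (Poly_Mapping.single w c)" and "\<And>x y. P x \<Longrightarrow> P y \<Longrightarrow> P (x + y)"
  shows "P (x :: 'g free_star_alg)"
proof (induction x rule: update_induct)
  case const
  then show ?case using assms(1)[of undefined 0] by simp
next
  case (update f a b)
  have "Poly_Mapping.update a b f = f + Poly_Mapping.single a b"
    using update by (intro poly_mapping_eqI)
      (auto simp: lookup_update lookup_add lookup_single when_def not_in_keys_iff_lookup_eq_zero)
  then show ?case using update assms by simp
qed

lemma free_adj_mult: "free_adj (x * y) = free_adj y * free_adj x"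
proof (induction x rule: free_induct)
  case (single w c)
  show ?case
    by (induction y rule: free_induct)
      (simp_all add: free_adj_single mult_single word_adj_add mult.commute
        distrib_left distrib_right free_adj_add)
qed (simp add: free_adj_add distrib_left distrib_right)

lemma free_adj_scale: "free_adj (free_scale c x) = free_scale (cnj c) (free_adj x)"
  by (intro poly_mapping_eqI)
    (simp add: free_scale_def lookup_free_adj Poly_Mapping.map.rep_eq when_def)

lemma free_scale_mult_right: "x * free_scale c y = free_scale c (x * y)"
proof -
  have "x * Poly_Mapping.single 0 c = Poly_Mapping.single 0 c * x"
    by (induction x rule: free_induct) (simp_all add: mult_single distrib_left distrib_right mult.commute)
  then show ?thesis by (metis free_scale_eq mult.assoc)
qed

lemma free_scale_minus_one: "free_scale (-1) x = - x"
  by (simp add: free_scale_eq single_uminus)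


section \<open>Completion with respect to a C*-seminorm\<close>

locale cstar_seminorm =
  fixes p :: "'g free_star_alg \<Rightarrow> real"
  assumes p_add: "p (x + y) \<le> p x + p y"
    and p_scale: "p (free_scale c x) = norm c * p x"
    and p_mult: "p (x * y) \<le> p x * p y"
    and p_cstar: "p (free_adj x * x) = (p x)\<^sup>2"

definition Cauchy_wrt :: "('g free_star_alg \<Rightarrow> real) \<Rightarrow> (nat \<Rightarrow> 'g free_star_alg) \<Rightarrow> bool"
  where "Cauchy_wrt p x \<longleftrightarrow> (\<forall>e>0. \<exists>N. \<forall>j\<ge>N. \<forall>k\<ge>N. p (x j - x k) < e)"

definition Cauchy_class :: "('g free_star_alg \<Rightarrow> real) \<Rightarrow> (nat \<Rightarrow> 'g free_star_alg) \<Rightarrow>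
    (nat \<Rightarrow> 'g free_star_alg) set"
  where "Cauchy_class p x = {y. Cauchy_wrt p y \<and> (\<lambda>k. p (y k - x k)) \<longlonglongrightarrow> 0}"

definition cstar_completion :: "('g free_star_alg \<Rightarrow> real) \<Rightarrow> (nat \<Rightarrow> 'g free_star_alg) set cstar_alg"
  where "cstar_completion p =
    \<lparr> carrier = Cauchy_class p ` {x. Cauchy_wrt p x},
      monoid.mult = (\<lambda>X Y. \<Union>x\<in>X. \<Union>y\<in>Y. Cauchy_class p (\<lambda>k. x k * y k)),
      one = Cauchy_class p (\<lambda>k. 1),
      zero = Cauchy_class p (\<lambda>k. 0),
      add = (\<lambda>X Y. \<Union>x\<in>X. \<Union>y\<in>Y. Cauchy_class p (\<lambda>k. x k + y k)),
      cscale = (\<lambda>c X. \<Union>x\<in>X. Cauchy_class p (\<lambda>k. free_scale c (x k))),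
      adj = (\<lambda>X. \<Union>x\<in>X. Cauchy_class p (\<lambda>k. free_adj (x k))),
      cnorm = (\<lambda>X. lim (\<lambda>k. p ((SOME x. x \<in> X) k))) \<rparr>"

context cstar_seminorm
begin

lemma p_0 [simp]: "p 0 = 0"
  using p_scale[of 0 0] by (simp add: free_scale_eq)

lemma p_minus [simp]: "p (- x) = p x"
  using p_scale[of "-1" x] by (simp add: free_scale_minus_one)

lemma p_nonneg [simp]: "0 \<le> p x"
  using p_add[of x "- x"] by simp

lemma p_minus_commute: "p (x - y) = p (y - x)"
  using p_minus[of "x - y"] by simp

lemma p_triangle: "p (x - z) \<le> p (x - y) + p (y - z)"
  using p_add[of "x - y" "y - z"] by simp

lemma p_adj_le: "p x \<le> p (free_adj x)"
proof (cases "p x = 0")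
  case False
  have "p x * p x \<le> p (free_adj x) * p x"
    using p_cstar[of x] p_mult[of "free_adj x" x] by (simp add: power2_eq_square)
  with False p_nonneg[of x] show ?thesis by (metis mult_le_cancel_right_pos order_le_less)
qed simp

lemma p_adj [simp]: "p (free_adj x) = p x"
  using p_adj_le[of x] p_adj_le[of "free_adj x"] by simp

lemma p_abs_diff: "\<bar>p x - p y\<bar> \<le> p (x - y)"
  using p_add[of "x - y" y] p_add[of "y - x" x] p_minus_commute[of x y] by simp

abbreviation "Cau \<equiv> Cauchy_wrt p"
abbreviation "cls \<equiv> Cauchy_class p"
abbreviation "null x \<equiv> (\<lambda>k. p (x k)) \<longlonglongrightarrow> 0"

lemma null_le: "null x \<Longrightarrow> (\<And>k. p (y k) \<le> p (x k)) \<Longrightarrow> null y"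
  by (rule tendsto_sandwich[where f = "\<lambda>_. 0" and h = "\<lambda>k. p (x k)"]) auto

lemma null_le': "f \<longlonglongrightarrow> 0 \<Longrightarrow> (\<And>k. p (y k) \<le> f k) \<Longrightarrow> null y"
  by (rule tendsto_sandwich[where f = "\<lambda>_. 0" and h = f]) auto

lemma Cau_const [simp]: "Cau (\<lambda>k. a)"
  by (auto simp: Cauchy_wrt_def)

lemma Cau_add: assumes "Cau x" "Cau y" shows "Cau (\<lambda>k. x k + y k)"
  unfolding Cauchy_wrt_def
proof (intro allI impI)
  fix e :: real assume "e > 0"
  then obtain M N where M: "\<forall>j\<ge>M. \<forall>k\<ge>M. p (x j - x k) < e/2" and N: "\<forall>j\<ge>N. \<forall>k\<ge>N. p (y j - y k) < e/2"
    using assms unfolding Cauchy_wrt_def by (meson half_gt_zero)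
  have "p (x j + y j - (x k + y k)) < e" if "j \<ge> max M N" "k \<ge> max M N" for j k
  proof -
    have "p (x j + y j - (x k + y k)) \<le> p (x j - x k) + p (y j - y k)"
      using p_add[of "x j - x k" "y j - y k"] by (simp add: algebra_simps)
    moreover have "p (x j - x k) < e/2" "p (y j - y k) < e/2" using M N that by auto
    ultimately show ?thesis by simp
  qed
  then show "\<exists>N. \<forall>j\<ge>N. \<forall>k\<ge>N. p (x j + y j - (x k + y k)) < e" by blast
qed

lemma Cau_bounded: assumes "Cau x" obtains K where "K > 0" "\<And>k. p (x k) \<le> K"
proof -
  obtain N where N: "\<forall>j\<ge>N. \<forall>k\<ge>N. p (x j - x k) < 1"
    using assms unfolding Cauchy_wrt_def by (meson zero_less_one)
  define K where "K = 1 + p (x N) + (\<Sum>k\<le>N. p (x k))"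
  have S: "0 \<le> (\<Sum>k\<le>N. p (x k))" by (simp add: sum_nonneg)
  have "p (x k) \<le> K" for k
  proof (cases "k \<le> N")
    case True
    then have "p (x k) \<le> (\<Sum>k\<le>N. p (x k))" by (intro member_le_sum) auto
    then show ?thesis using p_nonneg[of "x N"] unfolding K_def by linarith
  next
    case False
    then have "p (x k - x N) < 1" using N by auto
    then show ?thesis using p_abs_diff[of "x k" "x N"] S unfolding K_def by linarith
  qed
  moreover have "K > 0" using S p_nonneg[of "x N"] unfolding K_def by linarith
  ultimately show ?thesis using that by blast
qed

lemma p_mult_diff: "p (a * b - c * d) \<le> p (a - c) * p b + p c * p (b - d)"
proof -
  have "a * b - c * d = (a - c) * b + c * (b - d)" by (simp add: algebra_simps)
  then have "p (a * b - c * d) \<le> p ((a - c) * b) + p (c * (b - d))" by (metis p_add)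
  also have "\<dots> \<le> p (a - c) * p b + p c * p (b - d)" by (intro add_mono p_mult)
  finally show ?thesis .
qed

lemma Cau_mult: assumes "Cau x" "Cau y" shows "Cau (\<lambda>k. x k * y k)"
proof -
  obtain K L where K: "K > 0" "\<And>k. p (x k) \<le> K" and L: "L > 0" "\<And>k. p (y k) \<le> L"
    using Cau_bounded assms by metis
  show ?thesis unfolding Cauchy_wrt_def
  proof (intro allI impI)
    fix e :: real assume e: "e > 0"
    have "e / (2 * L) > 0" "e / (2 * K) > 0" using e K L by auto
    then obtain M N where M: "\<forall>j\<ge>M. \<forall>k\<ge>M. p (x j - x k) < e / (2 * L)"
      and N: "\<forall>j\<ge>N. \<forall>k\<ge>N. p (y j - y k) < e / (2 * K)"
      using assms unfolding Cauchy_wrt_def by meson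
    have "p (x j * y j - x k * y k) < e" if "j \<ge> max M N" "k \<ge> max M N" for j k
    proof -
      have "p (x j - x k) * p (y j) \<le> p (x j - x k) * L"
        by (intro mult_left_mono L) auto
      also have "\<dots> < e / (2 * L) * L" using M that L by (intro mult_strict_right_mono) auto
      finally have 1: "p (x j - x k) * p (y j) < e / 2" using L by simp
      have "p (x k) * p (y j - y k) \<le> K * p (y j - y k)"
        by (intro mult_right_mono K) auto
      also have "\<dots> < K * (e / (2 * K))" using N that K by (intro mult_strict_left_mono) auto
      finally have 2: "p (x k) * p (y j - y k) < e / 2" using K by simp
      show ?thesis using p_mult_diff[of "x j" "y j" "x k" "y k"] 1 2 by linarith
    qed
    then show "\<exists>N. \<forall>j\<ge>N. \<forall>k\<ge>N. p (x j * y j - x k * y k) < e" by blast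
  qed
qed

lemma free_scale_diff: "free_scale c x - free_scale c y = free_scale c (x - y)"
  by (simp add: free_scale_eq right_diff_distrib)

lemma Cau_scale: assumes "Cau x" shows "Cau (\<lambda>k. free_scale c (x k))"
  using Cau_mult[OF Cau_const[of "Poly_Mapping.single 0 c"] assms] by (simp add: free_scale_eq)

lemma Cau_adj: "Cau x \<Longrightarrow> Cau (\<lambda>k. free_adj (x k))"
  unfolding Cauchy_wrt_def by (simp flip: free_adj_diff)

lemma Cau_uminus: "Cau x \<Longrightarrow> Cau (\<lambda>k. - x k)"
  using Cau_scale[of x "-1"] by (simp add: free_scale_minus_one)

lemma mem_cls: "Cau x \<Longrightarrow> x \<in> cls x"
  by (simp add: Cauchy_class_def)

lemma mem_clsD: "y \<in> cls x \<Longrightarrow> Cau y \<and> null (\<lambda>k. y k - x k)"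
  by (simp add: Cauchy_class_def)

lemma null_sym: "null (\<lambda>k. y k - x k) \<Longrightarrow> null (\<lambda>k. x k - y k)"
  by (erule null_le) (simp add: p_minus_commute)

lemma null_trans: "null (\<lambda>k. x k - y k) \<Longrightarrow> null (\<lambda>k. y k - z k) \<Longrightarrow> null (\<lambda>k. x k - z k)"
  by (rule null_le'[OF tendsto_add_zero[of "\<lambda>k. p (x k - y k)" _ "\<lambda>k. p (y k - z k)"]])
    (auto intro: p_triangle)

lemma cls_eqI: "null (\<lambda>k. x k - y k) \<Longrightarrow> cls x = cls y"
  unfolding Cauchy_class_def using null_trans null_sym by blast

lemma cls_eq_iff: "Cau x \<Longrightarrow> cls x = cls y \<longleftrightarrow> null (\<lambda>k. x k - y k)"
  using cls_eqI mem_cls mem_clsD by metis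

lemma UN_cls:
  assumes "Cau x" and "\<And>y. y \<in> cls x \<Longrightarrow> null (\<lambda>k. F y k - F x k)"
  shows "(\<Union>y\<in>cls x. cls (F y)) = cls (F x)"
proof -
  have "cls (F y) = cls (F x)" if "y \<in> cls x" for y using assms(2)[OF that] by (rule cls_eqI)
  then show ?thesis using mem_cls[OF assms(1)] by blast
qed

lemma null_mult:
  assumes "Cau y" "Cau x'" "null (\<lambda>k. x k - x' k)" "null (\<lambda>k. y k - y' k)"
  shows "null (\<lambda>k. x k * y k - x' k * y' k)"
proof -
  obtain K L where K: "\<And>k. p (x' k) \<le> K" and L: "\<And>k. p (y k) \<le> L"
    using Cau_bounded assms by metis
  have "(\<lambda>k. p (x k - x' k) * L + K * p (y k - y' k)) \<longlonglongrightarrow> 0 * L + K * 0"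
    using assms by (intro tendsto_intros)
  then show ?thesis
  proof (rule null_le'[OF tendsto_eq_rhs])
    fix k
    have "p (x k - x' k) * p (y k) \<le> p (x k - x' k) * L" "p (x' k) * p (y k - y' k) \<le> K * p (y k - y' k)"
      by (auto intro!: mult_left_mono mult_right_mono K L)
    then show "p (x k * y k - x' k * y' k) \<le> p (x k - x' k) * L + K * p (y k - y' k)"
      using p_mult_diff[of "x k" "y k" "x' k" "y' k"] by linarith
  qed simp
qed

lemma null_add:
  assumes "null (\<lambda>k. x k - x' k)" "null (\<lambda>k. y k - y' k)"
  shows "null (\<lambda>k. (x k + y k) - (x' k + y' k))"
proof (rule null_le'[OF tendsto_add_zero[OF assms]])
  fix k show "p ((x k + y k) - (x' k + y' k)) \<le> p (x k - x' k) + p (y k - y' k)"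
    using p_add[of "x k - x' k" "y k - y' k"] by (simp add: algebra_simps)
qed

abbreviation "C \<equiv> cstar_completion p"

lemma carrier_C: "carrier C = cls ` {x. Cau x}"
  by (simp add: cstar_completion_def)

lemma one_C: "\<one>\<^bsub>C\<^esub> = cls (\<lambda>k. 1)"
  by (simp add: cstar_completion_def)

lemma zero_C: "\<zero>\<^bsub>C\<^esub> = cls (\<lambda>k. 0)"
  by (simp add: cstar_completion_def)

lemma mult_C: assumes "Cau x" "Cau y" shows "cls x \<otimes>\<^bsub>C\<^esub> cls y = cls (\<lambda>k. x k * y k)"
proof -
  have "cls x \<otimes>\<^bsub>C\<^esub> cls y = (\<Union>x'\<in>cls x. \<Union>y'\<in>cls y. cls (\<lambda>k. x' k * y' k))"
    by (simp add: cstar_completion_def)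
  also have "\<dots> = (\<Union>x'\<in>cls x. cls (\<lambda>k. x' k * y k))"
  proof (intro SUP_cong refl UN_cls assms)
    fix x' y' assume "x' \<in> cls x" "y' \<in> cls y"
    then show "null (\<lambda>k. x' k * y' k - x' k * y k)"
      by (intro null_mult) (auto dest: mem_clsD)
  qed
  also have "\<dots> = cls (\<lambda>k. x k * y k)"
  proof (intro UN_cls assms)
    fix x' assume "x' \<in> cls x"
    then show "null (\<lambda>k. x' k * y k - x k * y k)"
      using assms by (intro null_mult) (auto dest: mem_clsD)
  qed
  finally show ?thesis .
qed

lemma add_C: assumes "Cau x" "Cau y" shows "cls x \<oplus>\<^bsub>C\<^esub> cls y = cls (\<lambda>k. x k + y k)"
proof -
  have "cls x \<oplus>\<^bsub>C\<^esub> cls y = (\<Union>x'\<in>cls x. \<Union>y'\<in>cls y. cls (\<lambda>k. x' k + y' k))"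
    by (simp add: cstar_completion_def)
  also have "\<dots> = (\<Union>x'\<in>cls x. cls (\<lambda>k. x' k + y k))"
  proof (intro SUP_cong refl UN_cls assms)
    fix x' y' assume "x' \<in> cls x" "y' \<in> cls y"
    then show "null (\<lambda>k. x' k + y' k - (x' k + y k))"
      by (intro null_add) (auto dest: mem_clsD)
  qed
  also have "\<dots> = cls (\<lambda>k. x k + y k)"
  proof (intro UN_cls assms)
    fix x' assume "x' \<in> cls x"
    then show "null (\<lambda>k. x' k + y k - (x k + y k))"
      by (intro null_add) (auto dest: mem_clsD)
  qed
  finally show ?thesis .
qed

lemma scale_C: assumes "Cau x" shows "cscale C c (cls x) = cls (\<lambda>k. free_scale c (x k))"
proof -
  have "cscale C c (cls x) = (\<Union>x'\<in>cls x. cls (\<lambda>k. free_scale c (x' k)))"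
    by (simp add: cstar_completion_def)
  also have "\<dots> = cls (\<lambda>k. free_scale c (x k))"
  proof (intro UN_cls assms)
    fix x' assume "x' \<in> cls x"
    then have "null (\<lambda>k. x' k - x k)" by (auto dest: mem_clsD)
    then show "null (\<lambda>k. free_scale c (x' k) - free_scale c (x k))"
      by (simp add: free_scale_diff p_scale tendsto_mult_right_zero)
  qed
  finally show ?thesis .
qed

lemma adj_C: assumes "Cau x" shows "adj C (cls x) = cls (\<lambda>k. free_adj (x k))"
proof -
  have "adj C (cls x) = (\<Union>x'\<in>cls x. cls (\<lambda>k. free_adj (x' k)))"
    by (simp add: cstar_completion_def)
  also have "\<dots> = cls (\<lambda>k. free_adj (x k))"
    by (intro UN_cls assms) (auto dest!: mem_clsD simp flip: free_adj_diff)
  finally show ?thesis .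
qed

lemma norm_C: assumes "Cau x" shows "(\<lambda>k. p (x k)) \<longlonglongrightarrow> cnorm C (cls x)"
proof -
  define y where "y = (SOME y. y \<in> cls x)"
  have "y \<in> cls x" unfolding y_def using mem_cls[OF assms] by (rule someI[of "\<lambda>y. y \<in> cls x"])
  then have y: "Cau y" "null (\<lambda>k. y k - x k)" by (auto dest: mem_clsD)
  have "Cauchy (\<lambda>k. p (y k))"
    unfolding Cauchy_def dist_real_def
  proof (intro allI impI)
    fix e :: real assume "e > 0"
    then obtain N where "\<forall>j\<ge>N. \<forall>k\<ge>N. p (y j - y k) < e" using y(1) unfolding Cauchy_wrt_def by blast
    then show "\<exists>N. \<forall>j\<ge>N. \<forall>k\<ge>N. \<bar>p (y j) - p (y k)\<bar> < e"
      using p_abs_diff by (meson order_le_less_trans)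
  qed
  then have "(\<lambda>k. p (y k)) \<longlonglongrightarrow> lim (\<lambda>k. p (y k))"
    by (simp add: Cauchy_convergent_iff convergent_LIMSEQ_iff)
  moreover have "(\<lambda>k. p (x k) - p (y k)) \<longlonglongrightarrow> 0"
    by (rule Lim_null_comparison[OF _ null_sym[OF y(2)]]) (auto simp: p_abs_diff)
  ultimately have "(\<lambda>k. p (x k)) \<longlonglongrightarrow> lim (\<lambda>k. p (y k))"
    using tendsto_add[of "\<lambda>k. p (x k) - p (y k)" 0 _ "\<lambda>k. p (y k)"] by simp
  moreover have "cnorm C (cls x) = lim (\<lambda>k. p (y k))"
    by (simp add: cstar_completion_def y_def)
  ultimately show ?thesis by simp
qed

lemma norm_C_const [simp]: "cnorm C (cls (\<lambda>k. a)) = p a"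
  using norm_C[OF Cau_const[of a]] LIMSEQ_unique tendsto_const by metis

lemma ring_C: "ring C"
proof (rule ringI)
  show "abelian_group C"
  proof (rule abelian_groupI)
    fix X assume "X \<in> carrier C"
    then obtain x where x: "Cau x" "X = cls x" by (auto simp: carrier_C)
    have "cls (\<lambda>k. - x k) \<in> carrier C" "cls (\<lambda>k. - x k) \<oplus>\<^bsub>C\<^esub> X = \<zero>\<^bsub>C\<^esub>"
      using x by (auto simp: carrier_C Cau_uminus add_C zero_C)
    then show "\<exists>Y\<in>carrier C. Y \<oplus>\<^bsub>C\<^esub> X = \<zero>\<^bsub>C\<^esub>" by blast
  qed (auto simp: carrier_C zero_C add_C Cau_add ac_simps)
  show "monoid C"
    by (rule monoidI) (auto simp: carrier_C one_C mult_C Cau_mult mult.assoc)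
qed (auto simp: carrier_C mult_C add_C Cau_add Cau_mult distrib_left distrib_right)

lemma minus_C: assumes "Cau x" "Cau y" shows "cls x \<ominus>\<^bsub>C\<^esub> cls y = cls (\<lambda>k. x k - y k)"
proof -
  interpret ring C by (rule ring_C)
  have "\<ominus>\<^bsub>C\<^esub> cls y = cls (\<lambda>k. - y k)"
    by (rule minus_equality) (use assms in \<open>auto simp: carrier_C Cau_uminus add_C zero_C\<close>)
  then show ?thesis using assms by (simp add: a_minus_def add_C Cau_uminus)
qed

lemma Cau_diff: "Cau x \<Longrightarrow> Cau y \<Longrightarrow> Cau (\<lambda>k. x k - y k)"
  using Cau_add[OF _ Cau_uminus] by simp

lemma norm_C_le:
  assumes "Cau x" "\<And>k. k \<ge> N \<Longrightarrow> p (x k) \<le> e"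
  shows "cnorm C (cls x) \<le> e"
  by (rule LIMSEQ_le_const2[OF norm_C[OF assms(1)]]) (use assms(2) in blast)

lemma dense_C:
  assumes "X \<in> carrier C" "e > 0"
  shows "\<exists>a. cnorm C (X \<ominus>\<^bsub>C\<^esub> cls (\<lambda>k. a)) < e"
proof -
  obtain x where x: "Cau x" "X = cls x" using assms by (auto simp: carrier_C)
  obtain N where N: "\<forall>j\<ge>N. \<forall>k\<ge>N. p (x j - x k) < e/2"
    using x(1) assms(2) unfolding Cauchy_wrt_def by (meson half_gt_zero)
  have "cnorm C (cls (\<lambda>k. x k - x N)) \<le> e/2"
    using N x by (intro norm_C_le[where N = N] Cau_diff) (auto intro: less_imp_le)
  then show ?thesis using x assms(2) minus_C[of x "\<lambda>k. x N"] by (intro exI[of _ "x N"]) simp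
qed

lemma norm_triangle_C:
  assumes "X \<in> carrier C" "Y \<in> carrier C" shows "cnorm C (X \<oplus>\<^bsub>C\<^esub> Y) \<le> cnorm C X + cnorm C Y"
proof -
  obtain x y where xy: "Cau x" "X = cls x" "Cau y" "Y = cls y" using assms by (auto simp: carrier_C)
  have "(\<lambda>k. p (x k) + p (y k)) \<longlonglongrightarrow> cnorm C X + cnorm C Y" using xy norm_C by (intro tendsto_add) auto
  moreover have "(\<lambda>k. p (x k + y k)) \<longlonglongrightarrow> cnorm C (X \<oplus>\<^bsub>C\<^esub> Y)"
    using xy norm_C[OF Cau_add] by (simp add: add_C)
  ultimately show ?thesis using p_add by (meson LIMSEQ_le)
qed

lemma norm_minus_triangle_C:
  assumes "X \<in> carrier C" "Y \<in> carrier C" "Z \<in> carrier C"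
  shows "cnorm C (X \<ominus>\<^bsub>C\<^esub> Z) \<le> cnorm C (X \<ominus>\<^bsub>C\<^esub> Y) + cnorm C (Y \<ominus>\<^bsub>C\<^esub> Z)"
proof -
  interpret ring C by (rule ring_C)
  have "X \<ominus>\<^bsub>C\<^esub> Z = (X \<ominus>\<^bsub>C\<^esub> Y) \<oplus>\<^bsub>C\<^esub> (Y \<ominus>\<^bsub>C\<^esub> Z)"
    using assms unfolding a_minus_def by (metis a_assoc a_inv_closed l_neg l_zero add.m_closed)
  then show ?thesis using norm_triangle_C[of "X \<ominus>\<^bsub>C\<^esub> Y" "Y \<ominus>\<^bsub>C\<^esub> Z"] assms by simp
qed

lemma norm_minus_commute_C:
  assumes "X \<in> carrier C" "Y \<in> carrier C" shows "cnorm C (X \<ominus>\<^bsub>C\<^esub> Y) = cnorm C (Y \<ominus>\<^bsub>C\<^esub> X)"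
proof -
  obtain x y where xy: "Cau x" "X = cls x" "Cau y" "Y = cls y" using assms by (auto simp: carrier_C)
  show ?thesis
    using norm_C[OF Cau_diff[of x y]] norm_C[OF Cau_diff[of y x]] xy LIMSEQ_unique
    by (simp add: minus_C p_minus_commute)
qed

lemma complete_C:
  assumes u: "\<And>k. u k \<in> carrier C"
    and cau: "\<And>e. e > 0 \<Longrightarrow> \<exists>N. \<forall>j\<ge>N. \<forall>k\<ge>N. cnorm C (u j \<ominus>\<^bsub>C\<^esub> u k) < e"
  shows "\<exists>l\<in>carrier C. (\<lambda>k. cnorm C (u k \<ominus>\<^bsub>C\<^esub> l)) \<longlonglongrightarrow> 0"
proof -
  interpret ring C by (rule ring_C)
  have "\<exists>a. cnorm C (u k \<ominus>\<^bsub>C\<^esub> cls (\<lambda>k. a)) < inverse (real (Suc k))" for k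
    using u by (intro dense_C) auto
  then obtain a where a: "\<And>k. cnorm C (u k \<ominus>\<^bsub>C\<^esub> cls (\<lambda>i. a k)) < inverse (real (Suc k))" by metis
  have ca: "cls (\<lambda>i. b) \<in> carrier C" for b by (auto simp: carrier_C)
  have small: "\<exists>N. \<forall>k\<ge>N. cnorm C (u k \<ominus>\<^bsub>C\<^esub> cls (\<lambda>i. a k)) < e" if e: "e > 0" for e
  proof -
    have "\<forall>\<^sub>F k in sequentially. inverse (real (Suc k)) < e"
      using LIMSEQ_inverse_real_of_nat e by (rule order_tendstoD)
    then show ?thesis using a unfolding eventually_sequentially by (meson less_trans)
  qed
  have Ca: "Cau a" unfolding Cauchy_wrt_def
  proof (intro allI impI)
    fix e :: real assume e: "e > 0"
    then obtain M N where M: "\<forall>j\<ge>M. \<forall>k\<ge>M. cnorm C (u j \<ominus>\<^bsub>C\<^esub> u k) < e/3"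
      and N: "\<forall>k\<ge>N. cnorm C (u k \<ominus>\<^bsub>C\<^esub> cls (\<lambda>i. a k)) < e/3"
      using cau[of "e/3"] small[of "e/3"] by auto
    have "p (a j - a k) < e" if jk: "j \<ge> max M N" "k \<ge> max M N" for j k
    proof -
      have "p (a j - a k) = cnorm C (cls (\<lambda>i. a j) \<ominus>\<^bsub>C\<^esub> cls (\<lambda>i. a k))" by (simp add: minus_C)
      also have "\<dots> \<le> cnorm C (cls (\<lambda>i. a j) \<ominus>\<^bsub>C\<^esub> u j) + cnorm C (u j \<ominus>\<^bsub>C\<^esub> cls (\<lambda>i. a k))"
        using ca u by (intro norm_minus_triangle_C)
      also have "\<dots> \<le> cnorm C (u j \<ominus>\<^bsub>C\<^esub> cls (\<lambda>i. a j)) +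
          (cnorm C (u j \<ominus>\<^bsub>C\<^esub> u k) + cnorm C (u k \<ominus>\<^bsub>C\<^esub> cls (\<lambda>i. a k)))"
        using ca u norm_minus_triangle_C[of "u j" "u k" "cls (\<lambda>i. a k)"]
          norm_minus_commute_C[of "u j" "cls (\<lambda>i. a j)"] by simp
      also have "\<dots> < e/3 + (e/3 + e/3)" using M N jk by (intro add_strict_mono) auto
      finally show ?thesis by simp
    qed
    then show "\<exists>N. \<forall>j\<ge>N. \<forall>k\<ge>N. p (a j - a k) < e" by blast
  qed
  have l: "cls a \<in> carrier C" using Ca by (auto simp: carrier_C)
  have "(\<lambda>k. cnorm C (u k \<ominus>\<^bsub>C\<^esub> cls a)) \<longlonglongrightarrow> 0"
  proof (rule LIMSEQ_I)
    fix e :: real assume e: "e > 0"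
    obtain M N where M: "\<forall>j\<ge>M. \<forall>k\<ge>M. p (a j - a k) < e/3"
      and N: "\<forall>k\<ge>N. cnorm C (u k \<ominus>\<^bsub>C\<^esub> cls (\<lambda>i. a k)) < e/3"
      using Ca e small[of "e/3"] unfolding Cauchy_wrt_def by (metis divide_pos_pos zero_less_numeral)
    have "norm (cnorm C (u k \<ominus>\<^bsub>C\<^esub> cls a) - 0) < e" if k: "k \<ge> max M N" for k
    proof -
      have "cnorm C (cls (\<lambda>i. a k) \<ominus>\<^bsub>C\<^esub> cls a) = cnorm C (cls (\<lambda>i. a k - a i))"
        using Ca by (simp add: minus_C)
      also have "\<dots> \<le> e/3"
        using Ca M k by (intro norm_C_le[where N = M] Cau_diff) (auto intro: less_imp_le)
      finally have "cnorm C (u k \<ominus>\<^bsub>C\<^esub> cls a) \<le> e/3 + e/3"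
        using norm_minus_triangle_C[OF u ca l, of k "a k"] N k by fastforce
      moreover have "0 \<le> cnorm C (u k \<ominus>\<^bsub>C\<^esub> cls a)"
      proof -
        obtain x where "Cau x" "u k \<ominus>\<^bsub>C\<^esub> cls a = cls x" using u l by (auto simp: carrier_C minus_C)
            (metis (mono_tags, lifting) carrier_C imageE l mem_Collect_eq minus_closed u)
        then show ?thesis using norm_C[of x] p_nonneg by (metis LIMSEQ_le_const)
      qed
      ultimately show ?thesis using e by simp
    qed
    then show "\<exists>N. \<forall>k\<ge>N. norm (cnorm C (u k \<ominus>\<^bsub>C\<^esub> cls a) - 0) < e" by blast
  qed
  with l show ?thesis by blast
qed

theorem unital_cstar_algebra_completion: "unital_cstar_algebra C"
proof (intro unital_cstar_algebra.intro ring_C unital_cstar_algebra_axioms.intro)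
  fix X Y c d assume "X \<in> carrier C" "Y \<in> carrier C"
  then obtain x y where xy: "Cau x" "X = cls x" "Cau y" "Y = cls y" by (auto simp: carrier_C)
  note [simp] = Cau_scale Cau_add Cau_mult Cau_adj scale_C add_C mult_C adj_C
  show "cscale C c (X \<oplus>\<^bsub>C\<^esub> Y) = cscale C c X \<oplus>\<^bsub>C\<^esub> cscale C c Y"
    using xy by (simp add: free_scale_eq distrib_left)
  show "cscale C c X \<otimes>\<^bsub>C\<^esub> Y = cscale C c (X \<otimes>\<^bsub>C\<^esub> Y)"
    using xy by (simp add: free_scale_eq mult.assoc)
  show "X \<otimes>\<^bsub>C\<^esub> cscale C c Y = cscale C c (X \<otimes>\<^bsub>C\<^esub> Y)"
    using xy by (simp add: free_scale_mult_right)
  show "adj C (X \<oplus>\<^bsub>C\<^esub> Y) = adj C X \<oplus>\<^bsub>C\<^esub> adj C Y"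
    using xy by (simp add: free_adj_add)
  show "adj C (X \<otimes>\<^bsub>C\<^esub> Y) = adj C Y \<otimes>\<^bsub>C\<^esub> adj C X"
    using xy by (simp add: free_adj_mult)
  show "cnorm C (X \<oplus>\<^bsub>C\<^esub> Y) \<le> cnorm C X + cnorm C Y"
    using xy by (intro norm_triangle_C) (auto simp: carrier_C)
  have "(\<lambda>k. p (x k) * p (y k)) \<longlonglongrightarrow> cnorm C X * cnorm C Y" using xy norm_C by (intro tendsto_mult) auto
  moreover have "(\<lambda>k. p (x k * y k)) \<longlonglongrightarrow> cnorm C (X \<otimes>\<^bsub>C\<^esub> Y)" using xy norm_C[OF Cau_mult] by simp
  ultimately show "cnorm C (X \<otimes>\<^bsub>C\<^esub> Y) \<le> cnorm C X * cnorm C Y" using p_mult by (meson LIMSEQ_le)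
next
  fix X c d assume "X \<in> carrier C"
  then obtain x where x: "Cau x" "X = cls x" by (auto simp: carrier_C)
  note [simp] = Cau_scale Cau_add Cau_mult Cau_adj scale_C add_C mult_C adj_C
  show "cscale C c X \<in> carrier C" "adj C X \<in> carrier C" using x by (auto simp: carrier_C)
  show "cscale C (c + d) X = cscale C c X \<oplus>\<^bsub>C\<^esub> cscale C d X"
    using x by (simp add: free_scale_eq single_add distrib_right)
  show "cscale C c (cscale C d X) = cscale C (c * d) X"
    using x by (simp add: free_scale_eq mult_single flip: mult.assoc)
  show "cscale C 1 X = X" using x by (simp add: free_scale_eq)
  show "adj C (adj C X) = X" using x by simp
  show "adj C (cscale C c X) = cscale C (cnj c) (adj C X)" using x by (simp add: free_adj_scale)
  show "cnorm C X = 0 \<longleftrightarrow> X = \<zero>\<^bsub>C\<^esub>"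
    using x norm_C[of x] LIMSEQ_unique[of "\<lambda>k. p (x k)"] by (auto simp: zero_C cls_eq_iff)
  have "(\<lambda>k. norm c * p (x k)) \<longlonglongrightarrow> norm c * cnorm C X" using x norm_C by (intro tendsto_mult) auto
  moreover have "(\<lambda>k. p (free_scale c (x k))) \<longlonglongrightarrow> cnorm C (cscale C c X)"
    using x norm_C[OF Cau_scale] by simp
  ultimately show "cnorm C (cscale C c X) = norm c * cnorm C X"
    by (simp add: p_scale LIMSEQ_unique)
  have "(\<lambda>k. (p (x k))\<^sup>2) \<longlonglongrightarrow> (cnorm C X)\<^sup>2" using x norm_C by (intro tendsto_power) auto
  moreover have "(\<lambda>k. p (free_adj (x k) * x k)) \<longlonglongrightarrow> cnorm C (adj C X \<otimes>\<^bsub>C\<^esub> X)"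
    using x norm_C[OF Cau_mult[OF Cau_adj]] by simp
  ultimately show "cnorm C (adj C X \<otimes>\<^bsub>C\<^esub> X) = (cnorm C X)\<^sup>2"
    by (simp add: p_cstar LIMSEQ_unique)
qed (rule complete_C)

end


section \<open>The universal unital C*-algebra on generators and relations\<close>

text \<open>Elements of \<open>R\<close> are the relators, imposed to be \<open>0\<close>. The supremum below is only meaningful if
  \<open>R\<close> bounds the generators; see \<open>bounded_relators\<close>.\<close>

definition admissible_seminorms :: "'g free_star_alg set \<Rightarrow> ('g free_star_alg \<Rightarrow> real) set"
  where "admissible_seminorms R = {p. cstar_seminorm p \<and> (\<forall>r\<in>R. p r = 0)}"

definition bounded_relators :: "'g free_star_alg set \<Rightarrow> bool"
  where "bounded_relators R \<longleftrightarrow> (\<forall>x. bdd_above ((\<lambda>p. p x) ` admissible_seminorms R))"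

definition universal_seminorm :: "'g free_star_alg set \<Rightarrow> 'g free_star_alg \<Rightarrow> real"
  where "universal_seminorm R x = (SUP p\<in>admissible_seminorms R. p x)"

definition universal_cstar_algebra ::
    "'g free_star_alg set \<Rightarrow> (nat \<Rightarrow> 'g free_star_alg) set cstar_alg"
  where "universal_cstar_algebra R = cstar_completion (universal_seminorm R)"

definition universal_gen :: "'g free_star_alg set \<Rightarrow> 'g \<Rightarrow> (nat \<Rightarrow> 'g free_star_alg) set"
  where "universal_gen R g = Cauchy_class (universal_seminorm R) (\<lambda>k. gen g)"

lemma zero_admissible: "(\<lambda>_. 0) \<in> admissible_seminorms R"
  by (simp add: admissible_seminorms_def cstar_seminorm_def)

lemma le_universal_seminorm:
  "bounded_relators R \<Longrightarrow> p \<in> admissible_seminorms R \<Longrightarrow> p x \<le> universal_seminorm R x"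
  unfolding universal_seminorm_def by (intro cSUP_upper) (auto simp: bounded_relators_def)

lemma universal_seminorm_le:
  "(\<And>p. p \<in> admissible_seminorms R \<Longrightarrow> p x \<le> K) \<Longrightarrow> universal_seminorm R x \<le> K"
  unfolding universal_seminorm_def using zero_admissible by (intro cSUP_least) auto

lemma universal_seminorm_nonneg: "bounded_relators R \<Longrightarrow> 0 \<le> universal_seminorm R x"
  using le_universal_seminorm[OF _ zero_admissible] by blast

lemma universal_seminorm_relator: "bounded_relators R \<Longrightarrow> r \<in> R \<Longrightarrow> universal_seminorm R r = 0"
  by (intro antisym universal_seminorm_le universal_seminorm_nonneg) (auto simp: admissible_seminorms_def)

theorem cstar_seminorm_universal:
  assumes R: "bounded_relators R" shows "cstar_seminorm (universal_seminorm R)"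
proof
  let ?U = "universal_seminorm R"
  note le = le_universal_seminorm[OF R] and nn = universal_seminorm_nonneg[OF R]
  have sn: "cstar_seminorm p" if "p \<in> admissible_seminorms R" for p
    using that by (simp add: admissible_seminorms_def)
  fix x y :: "'a free_star_alg" and c :: complex
  show "?U (x + y) \<le> ?U x + ?U y"
  proof (rule universal_seminorm_le)
    fix p assume p: "p \<in> admissible_seminorms R"
    show "p (x + y) \<le> ?U x + ?U y"
      using cstar_seminorm.p_add[OF sn[OF p], of x y] le[OF p, of x] le[OF p, of y] by linarith
  qed
  have sc: "?U (free_scale c x) \<le> norm c * ?U x" for c x
    by (rule universal_seminorm_le) (simp add: cstar_seminorm.p_scale[OF sn] le mult_left_mono)
  show "?U (free_scale c x) = norm c * ?U x"
  proof (cases "c = 0")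
    case True
    then show ?thesis using sc[of 0 x] nn[of "free_scale 0 x"] by simp
  next
    case False
    have "free_scale (inverse c) (free_scale c x) = x"
      using False by (simp add: free_scale_eq mult_single flip: mult.assoc)
    then have "?U x \<le> inverse (norm c) * ?U (free_scale c x)"
      using sc[of "inverse c" "free_scale c x"] by (simp add: norm_inverse)
    then have "norm c * ?U x \<le> ?U (free_scale c x)"
      using False by (simp add: field_simps)
    then show ?thesis using sc[of c x] by simp
  qed
  show "?U (x * y) \<le> ?U x * ?U y"
  proof (rule universal_seminorm_le)
    fix p assume p: "p \<in> admissible_seminorms R"
    have "p (x * y) \<le> p x * p y" by (rule cstar_seminorm.p_mult[OF sn[OF p]])
    also have "\<dots> \<le> ?U x * ?U y"
      by (intro mult_mono le p nn cstar_seminorm.p_nonneg[OF sn[OF p]])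
    finally show "p (x * y) \<le> ?U x * ?U y" .
  qed
  show "?U (free_adj x * x) = (?U x)\<^sup>2"
  proof (rule antisym)
    show "?U (free_adj x * x) \<le> (?U x)\<^sup>2"
      by (rule universal_seminorm_le)
        (simp add: cstar_seminorm.p_cstar[OF sn] cstar_seminorm.p_nonneg[OF sn] le power_mono)
    have "?U x \<le> sqrt (?U (free_adj x * x))"
    proof (rule universal_seminorm_le)
      fix p assume p: "p \<in> admissible_seminorms R"
      have "(p x)\<^sup>2 \<le> ?U (free_adj x * x)"
        using le[OF p, of "free_adj x * x"] by (simp add: cstar_seminorm.p_cstar[OF sn[OF p]])
      then show "p x \<le> sqrt (?U (free_adj x * x))" by (rule real_le_rsqrt)
    qed
    then have "(?U x)\<^sup>2 \<le> (sqrt (?U (free_adj x * x)))\<^sup>2" by (intro power_mono nn)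
    then show "(?U x)\<^sup>2 \<le> ?U (free_adj x * x)" by (simp add: nn)
  qed
qed

lemma gen_Word: "Poly_Mapping.single (Word [Gen g]) 1 = gen g"
  "Poly_Mapping.single (Word [Adj g]) 1 = free_adj (gen g)"
  by (simp_all add: gen_def free_adj_single word_adj_def)

lemma single_Word_Cons:
  "Poly_Mapping.single (Word (l # ls)) (1::complex) =
     Poly_Mapping.single (Word [l]) 1 * Poly_Mapping.single (Word ls) 1"
  by (simp add: mult_single plus_star_word_def)

lemma bounded_relators_isometries:
  assumes iso: "\<And>g. free_adj (gen g) * gen g - 1 \<in> R"
  shows "bounded_relators R"
  unfolding bounded_relators_def
proof
  fix x :: "'a free_star_alg"
  have word: "p (Poly_Mapping.single (Word ls) 1) \<le> 1" if p: "p \<in> admissible_seminorms R" for p ls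
  proof -
    interpret cstar_seminorm p using p by (simp add: admissible_seminorms_def)
    have "free_adj 1 = (1 :: 'a free_star_alg)" by (metis free_adj_single single_one word_adj_0 complex_cnj_one)
    then have "p 1 * p 1 = p 1 * 1" using p_cstar[of 1] by (simp add: power2_eq_square)
    then have p1: "p 1 \<le> 1" using mult_cancel_left[of "p 1" "p 1" 1] by linarith
    have pg: "p (gen g) \<le> 1" for g
    proof -
      have "p (free_adj (gen g) * gen g) \<le> p (free_adj (gen g) * gen g - 1) + p 1"
        using p_add[of "free_adj (gen g) * gen g - 1" 1] by simp
      also have "\<dots> \<le> 1" using p iso p1 by (simp add: admissible_seminorms_def)
      finally have "(p (gen g))\<^sup>2 \<le> 1" by (simp add: p_cstar)
      then show ?thesis by (simp add: abs_square_le_1)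
    qed
    have pl: "p (Poly_Mapping.single (Word [l]) 1) \<le> 1" for l
      by (cases l) (simp_all add: gen_Word pg)
    show ?thesis
    proof (induction ls)
      case Nil
      then show ?case using p1 by (simp flip: zero_star_word_def)
    next
      case (Cons l ls)
      have "p (Poly_Mapping.single (Word (l # ls)) 1)
          \<le> p (Poly_Mapping.single (Word [l]) 1) * p (Poly_Mapping.single (Word ls) 1)"
        by (subst single_Word_Cons) (rule p_mult)
      also have "\<dots> \<le> 1" using pl Cons by (intro mult_le_one) auto
      finally show ?case .
    qed
  qed
  show "bdd_above ((\<lambda>p. p x) ` admissible_seminorms R)"
  proof (induction x rule: free_induct)
    case (single w c)
    have "p (Poly_Mapping.single w c) \<le> norm c" if p: "p \<in> admissible_seminorms R" for p
    proof -
      interpret cstar_seminorm p using p by (simp add: admissible_seminorms_def)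
      have "Poly_Mapping.single w c = free_scale c (Poly_Mapping.single (Word (letters w)) 1)"
        by (simp add: free_scale_eq mult_single)
      then show ?thesis using word[OF p, of "letters w"] by (simp add: p_scale mult_left_le)
    qed
    then show ?case by (auto simp: bdd_above_def)
  next
    case (add x y)
    then obtain K L where K: "\<And>p. p \<in> admissible_seminorms R \<Longrightarrow> p x \<le> K"
      and L: "\<And>p. p \<in> admissible_seminorms R \<Longrightarrow> p y \<le> L" by (auto simp: bdd_above_def)
    have "p (x + y) \<le> K + L" if p: "p \<in> admissible_seminorms R" for p
    proof -
      interpret cstar_seminorm p using p by (simp add: admissible_seminorms_def)
      show ?thesis using p_add[of x y] K[OF p] L[OF p] by linarith
    qed
    then show ?case by (auto simp: bdd_above_def)
  qed
qed

definition universal_embed :: "'g free_star_alg set \<Rightarrow> 'g free_star_alg \<Rightarrow> (nat \<Rightarrow> 'g free_star_alg) set"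
  where "universal_embed R x = Cauchy_class (universal_seminorm R) (\<lambda>k. x)"

theorem unital_cstar_algebra_universal:
  "bounded_relators R \<Longrightarrow> unital_cstar_algebra (universal_cstar_algebra R)"
  unfolding universal_cstar_algebra_def
  by (intro cstar_seminorm.unital_cstar_algebra_completion cstar_seminorm_universal)

theorem universal_embed_dense:
  assumes "bounded_relators R" "X \<in> carrier (universal_cstar_algebra R)" "e > 0"
  shows "\<exists>a. cnorm (universal_cstar_algebra R)
                (X \<ominus>\<^bsub>universal_cstar_algebra R\<^esub> universal_embed R a) < e"
  using assms cstar_seminorm.dense_C[OF cstar_seminorm_universal[OF assms(1)]]
  unfolding universal_cstar_algebra_def universal_embed_def by blast

lemma
  assumes R: "bounded_relators R"
  shows universal_embed_closed: "universal_embed R x \<in> carrier (universal_cstar_algebra R)"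
    and universal_embed_0: "universal_embed R 0 = \<zero>\<^bsub>universal_cstar_algebra R\<^esub>"
    and universal_embed_1: "universal_embed R 1 = \<one>\<^bsub>universal_cstar_algebra R\<^esub>"
    and universal_embed_add: "universal_embed R (x + y) =
          universal_embed R x \<oplus>\<^bsub>universal_cstar_algebra R\<^esub> universal_embed R y"
    and universal_embed_mult: "universal_embed R (x * y) =
          universal_embed R x \<otimes>\<^bsub>universal_cstar_algebra R\<^esub> universal_embed R y"
    and universal_embed_scale: "universal_embed R (free_scale c x) =
          cscale (universal_cstar_algebra R) c (universal_embed R x)"
    and universal_embed_adj: "universal_embed R (free_adj x) =
          adj (universal_cstar_algebra R) (universal_embed R x)"
    and universal_embed_relator: "x - y \<in> R \<Longrightarrow> universal_embed R x = universal_embed R y"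
proof -
  interpret cstar_seminorm "universal_seminorm R" using R by (rule cstar_seminorm_universal)
  note defs = universal_cstar_algebra_def universal_embed_def
  show "universal_embed R x \<in> carrier (universal_cstar_algebra R)"
    by (auto simp: defs carrier_C)
  show "universal_embed R 0 = \<zero>\<^bsub>universal_cstar_algebra R\<^esub>"
    "universal_embed R 1 = \<one>\<^bsub>universal_cstar_algebra R\<^esub>"
    "universal_embed R (x + y) = universal_embed R x \<oplus>\<^bsub>universal_cstar_algebra R\<^esub> universal_embed R y"
    "universal_embed R (x * y) = universal_embed R x \<otimes>\<^bsub>universal_cstar_algebra R\<^esub> universal_embed R y"
    "universal_embed R (free_scale c x) = cscale (universal_cstar_algebra R) c (universal_embed R x)"
    "universal_embed R (free_adj x) = adj (universal_cstar_algebra R) (universal_embed R x)"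
    by (simp_all add: defs zero_C one_C add_C mult_C scale_C adj_C)
  show "universal_embed R x = universal_embed R y" if "x - y \<in> R"
    using universal_seminorm_relator[OF R that] by (simp add: defs cls_eq_iff)
qed

lemma universal_embed_sum:
  assumes R: "bounded_relators R" and "finite I"
  shows "universal_embed R (sum x I) = (\<Oplus>\<^bsub>universal_cstar_algebra R\<^esub>i\<in>I. universal_embed R (x i))"
proof -
  interpret unital_cstar_algebra "universal_cstar_algebra R"
    using R by (rule unital_cstar_algebra_universal)
  show ?thesis using assms(2)
    by (induction I rule: finite_induct)
      (simp_all add: universal_embed_0[OF R] universal_embed_add[OF R] universal_embed_closed[OF R] Pi_def)
qed

context unital_cstar_algebra
begin

primrec letter_val :: "('g \<Rightarrow> 'a) \<Rightarrow> 'g letter \<Rightarrow> 'a" where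
  "letter_val f (Gen g) = f g"
| "letter_val f (Adj g) = adj A (f g)"

definition word_val :: "('g \<Rightarrow> 'a) \<Rightarrow> 'g star_word \<Rightarrow> 'a"
  where "word_val f w = foldr (\<lambda>l a. letter_val f l \<otimes> a) (letters w) \<one>"

definition free_val :: "('g \<Rightarrow> 'a) \<Rightarrow> 'g free_star_alg \<Rightarrow> 'a"
  where "free_val f x =
    (\<Oplus>w\<in>Poly_Mapping.keys x. cscale A (Poly_Mapping.lookup x w) (word_val f w))"

context
  fixes f :: "'g \<Rightarrow> 'a"
  assumes f: "\<And>g. f g \<in> carrier A"
begin

lemma letter_val_closed [simp]: "letter_val f l \<in> carrier A"
  by (cases l) (simp_all add: f adj_closed)

lemma foldr_closed: "a \<in> carrier A \<Longrightarrow> foldr (\<lambda>l a. letter_val f l \<otimes> a) ls a \<in> carrier A"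
  by (induction ls) auto

lemma word_val_closed [simp]: "word_val f w \<in> carrier A"
  by (simp add: word_val_def foldr_closed)

lemma foldr_mult: "a \<in> carrier A \<Longrightarrow>
  foldr (\<lambda>l a. letter_val f l \<otimes> a) ls a = foldr (\<lambda>l a. letter_val f l \<otimes> a) ls \<one> \<otimes> a"
  by (induction ls) (simp_all add: m_assoc foldr_closed)

lemma word_val_add: "word_val f (u + v) = word_val f u \<otimes> word_val f v"
  by (simp add: word_val_def plus_star_word_def foldr_mult[symmetric] foldr_closed)

lemma word_val_0 [simp]: "word_val f 0 = \<one>"
  by (simp add: word_val_def zero_star_word_def)

lemma letter_val_adj: "letter_val f (letter_adj l) = adj A (letter_val f l)"
  by (cases l) (simp_all add: f adj_adj)

lemma word_val_adj: "word_val f (word_adj w) = adj A (word_val f w)"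
proof -
  have "foldr (\<lambda>l a. letter_val f l \<otimes> a) (rev (map letter_adj ls)) \<one> =
      adj A (foldr (\<lambda>l a. letter_val f l \<otimes> a) ls \<one>)" for ls
  proof (induction ls)
    case (Cons l ls)
    have "foldr (\<lambda>l a. letter_val f l \<otimes> a) (rev (map letter_adj (l # ls))) \<one> =
        foldr (\<lambda>l a. letter_val f l \<otimes> a) (rev (map letter_adj ls)) (adj A (letter_val f l))"
      by (simp add: letter_val_adj adj_closed)
    also have "\<dots> = adj A (foldr (\<lambda>l a. letter_val f l \<otimes> a) ls \<one>) \<otimes> adj A (letter_val f l)"
      by (subst foldr_mult) (simp_all add: adj_closed Cons)
    finally show ?case by (simp add: adj_mult foldr_closed)
  qed (simp add: adj_one)
  then show ?thesis by (simp add: word_val_def word_adj_def)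
qed

lemma free_val_closed [simp]: "free_val f x \<in> carrier A"
  by (simp add: free_val_def finsum_closed scale_closed)

lemma free_val_superset:
  assumes "finite S" "Poly_Mapping.keys x \<subseteq> S"
  shows "free_val f x = (\<Oplus>w\<in>S. cscale A (Poly_Mapping.lookup x w) (word_val f w))"
  unfolding free_val_def
  by (rule add.finprod_mono_neutral_cong_left)
    (use assms in \<open>auto simp: scale_closed scale_zero_left not_in_keys_iff_lookup_eq_zero\<close>)

lemma free_val_add: "free_val f (x + y) = free_val f x \<oplus> free_val f y"
proof -
  let ?S = "Poly_Mapping.keys x \<union> Poly_Mapping.keys y"
  have "free_val f (x + y) = (\<Oplus>w\<in>?S. cscale A (Poly_Mapping.lookup x w) (word_val f w) \<oplus>
      cscale A (Poly_Mapping.lookup y w) (word_val f w))"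
    using keys_add[of x y]
    by (subst free_val_superset[where S = ?S]) (auto simp: lookup_add scale_add_left)
  also have "\<dots> = free_val f x \<oplus> free_val f y"
    by (subst (1 2) free_val_superset[where S = ?S]) (auto simp: finsum_addf scale_closed)
  finally show ?thesis .
qed

lemma free_val_single: "free_val f (Poly_Mapping.single w c) = cscale A c (word_val f w)"
  by (subst free_val_superset[where S = "{w}"]) (auto simp: scale_closed)

lemma free_val_0: "free_val f 0 = \<zero>"
  by (simp add: free_val_def)

lemma free_val_1: "free_val f 1 = \<one>"
  using free_val_single[of 0 1] by (simp add: scale_one)

lemma free_val_gen: "free_val f (gen g) = f g"
  using f[of g] by (simp add: gen_def free_val_single scale_one word_val_def)

lemma free_val_mult: "free_val f (x * y) = free_val f x \<otimes> free_val f y"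
proof (induction x rule: free_induct)
  case (single w c)
  show ?case
  proof (induction y rule: free_induct)
    case (single v d)
    show ?case
      by (simp add: mult_single free_val_single word_val_add scale_mult_left scale_mult_right
          scale_scale scale_closed mult.commute)
  qed (simp add: distrib_left free_val_add r_distr)
qed (simp add: distrib_right free_val_add l_distr)

lemma free_val_scale: "free_val f (free_scale c x) = cscale A c (free_val f x)"
  by (simp add: free_scale_eq free_val_mult free_val_single scale_mult_left)

lemma free_val_adj: "free_val f (free_adj x) = adj A (free_val f x)"
  by (induction x rule: free_induct)
    (simp_all add: free_adj_single free_val_single word_val_adj adj_scale free_adj_add free_val_add adj_add)

lemma free_val_diff: "free_val f (x - y) = free_val f x \<ominus> free_val f y"
proof -
  have "free_val f (x - y) = free_val f x \<oplus> free_val f (free_scale (-1) y)"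
    by (simp add: free_scale_minus_one flip: free_val_add)
  then show ?thesis by (simp add: free_val_scale a_minus_def a_inv_eq_scale)
qed

lemma free_val_sum: "finite I \<Longrightarrow> free_val f (sum x I) = (\<Oplus>i\<in>I. free_val f (x i))"
  by (induction I rule: finite_induct) (simp_all add: free_val_0 free_val_add Pi_def)

lemma cstar_seminorm_free_val: "cstar_seminorm (\<lambda>x. cnorm A (free_val f x))"
  by standard (simp_all add: free_val_add norm_add free_val_scale norm_scale free_val_mult
      norm_mult_le free_val_adj cstar_identity)

lemma universal_property:
  assumes R: "bounded_relators R" and rel: "\<And>r. r \<in> R \<Longrightarrow> free_val f r = \<zero>"
  shows "\<exists>\<phi>. star_hom (universal_cstar_algebra R) A \<phi> \<and> (\<forall>g. \<phi> (universal_gen R g) = f g)"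
proof -
  let ?U = "universal_seminorm R" and ?C = "universal_cstar_algebra R"
  interpret U: cstar_seminorm ?U using R by (rule cstar_seminorm_universal)
  have le: "cnorm A (free_val f x) \<le> ?U x" for x
    using le_universal_seminorm[OF R, of "\<lambda>x. cnorm A (free_val f x)" x] cstar_seminorm_free_val rel
    by (simp add: admissible_seminorms_def)
  define \<phi> where "\<phi> X = (SOME l. \<exists>x\<in>X. converges (\<lambda>k. free_val f (x k)) l)" for X
  have conv: "converges (\<lambda>k. free_val f (x k)) (\<phi> (U.cls x))" if x: "U.Cau x" for x
  proof -
    have "\<exists>N. \<forall>j\<ge>N. \<forall>k\<ge>N. cnorm A (free_val f (x j) \<ominus> free_val f (x k)) < e" if e: "e > 0" for e
    proof -
      obtain N where N: "\<forall>j\<ge>N. \<forall>k\<ge>N. ?U (x j - x k) < e" using x e unfolding Cauchy_wrt_def by blast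
      have "cnorm A (free_val f (x j) \<ominus> free_val f (x k)) < e" if "j \<ge> N" "k \<ge> N" for j k
        using le[of "x j - x k"] N that by (force simp: free_val_diff)
      then show ?thesis by blast
    qed
    then have "\<exists>l\<in>carrier A. (\<lambda>k. cnorm A (free_val f (x k) \<ominus> l)) \<longlonglongrightarrow> 0"
      by (intro complete) auto
    then obtain l where "l \<in> carrier A" "(\<lambda>k. cnorm A (free_val f (x k) \<ominus> l)) \<longlonglongrightarrow> 0" by blast
    then have l: "converges (\<lambda>k. free_val f (x k)) l" by (auto simp: converges_def)
    then have "\<exists>l. \<exists>y\<in>U.cls x. converges (\<lambda>k. free_val f (y k)) l" using U.mem_cls[OF x] by blast
    then have "\<exists>y\<in>U.cls x. converges (\<lambda>k. free_val f (y k)) (\<phi> (U.cls x))"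
      unfolding \<phi>_def by (rule someI_ex)
    then obtain y where y: "y \<in> U.cls x" "converges (\<lambda>k. free_val f (y k)) (\<phi> (U.cls x))" by blast
    have "converges (\<lambda>k. free_val f (x k - y k)) \<zero>"
    proof (rule converges_le)
      show "(\<lambda>k. ?U (x k - y k)) \<longlonglongrightarrow> 0" using U.mem_clsD[OF y(1)] U.null_sym by blast
    qed (use le in \<open>auto simp: a_minus_def\<close>)
    then have "converges (\<lambda>k. free_val f (x k - y k) \<oplus> free_val f (y k)) (\<zero> \<oplus> \<phi> (U.cls x))"
      using y(2) by (rule converges_add)
    then show ?thesis using y(2) by (simp add: converges_def flip: free_val_add)
  qed
  have phi_eq: "\<phi> (U.cls x) = l" if "U.Cau x" "converges (\<lambda>k. free_val f (x k)) l" for x l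
    using conv that converges_unique by blast
  have const: "\<phi> (U.cls (\<lambda>k. a)) = free_val f a" for a
    by (rule phi_eq) (auto intro: converges_const)
  have "star_hom ?C A \<phi>"
    unfolding star_hom_def universal_cstar_algebra_def
  proof (intro conjI ring_hom_memI ballI allI)
    fix X Y c assume "X \<in> carrier U.C" "Y \<in> carrier U.C"
    then obtain x y where xy: "U.Cau x" "X = U.cls x" "U.Cau y" "Y = U.cls y" by (auto simp: U.carrier_C)
    show "\<phi> (X \<otimes>\<^bsub>U.C\<^esub> Y) = \<phi> X \<otimes> \<phi> Y"
      using xy converges_mult[OF conv conv, of x y]
      by (simp add: U.mult_C phi_eq U.Cau_mult free_val_mult)
    show "\<phi> (X \<oplus>\<^bsub>U.C\<^esub> Y) = \<phi> X \<oplus> \<phi> Y"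
      using xy converges_add[OF conv conv, of x y]
      by (simp add: U.add_C phi_eq U.Cau_add free_val_add)
  next
    fix X c assume "X \<in> carrier U.C"
    then obtain x where x: "U.Cau x" "X = U.cls x" by (auto simp: U.carrier_C)
    show "\<phi> X \<in> carrier A" using conv[OF x(1)] x(2) by (simp add: converges_def)
    show "\<phi> (cscale U.C c X) = cscale A c (\<phi> X)"
      using x converges_scale[OF conv, of x c] by (simp add: U.scale_C phi_eq U.Cau_scale free_val_scale)
    show "\<phi> (adj U.C X) = adj A (\<phi> X)"
      using x converges_adj[OF conv, of x] by (simp add: U.adj_C phi_eq U.Cau_adj free_val_adj)
  next
    show "\<phi> \<one>\<^bsub>U.C\<^esub> = \<one>" by (simp add: U.one_C const free_val_1)
  qed
  moreover have "\<phi> (universal_gen R g) = f g" for g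
    by (simp add: universal_gen_def const free_val_gen)
  ultimately show ?thesis by blast
qed

end

end


section \<open>The algebras $\mathcal{O}_n \otimes_\Theta \mathcal{O}_m$\<close>

text \<open>The integers \<open>n\<close> and \<open>m\<close> are the cardinalities of the index types; the generator
  \<open>s\<^sub>i\<close> is indexed by \<open>Inl i\<close> and \<open>t\<^sub>j\<close> by \<open>Inr j\<close>.\<close>

definition twisted_relators :: "complex ^ 'm ^ 'n \<Rightarrow> ('n + 'm) free_star_alg set"
  where "twisted_relators \<Theta> =
    (let s = (\<lambda>i. gen (Inl i)); t = (\<lambda>j. gen (Inr j)) in
      {free_adj (s i) * s i - 1 | i. True} \<union>
      {free_adj (t j) * t j - 1 | j. True} \<union>
      {(\<Sum>i\<in>UNIV. s i * free_adj (s i)) - 1} \<union>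
      {(\<Sum>j\<in>UNIV. t j * free_adj (t j)) - 1} \<union>
      {s i * t j - free_scale (\<Theta> $ i $ j) (t j * s i) | i j. True})"

definition twisted_tensor :: "complex ^ 'm ^ 'n \<Rightarrow> (nat \<Rightarrow> ('n + 'm) free_star_alg) set cstar_alg"
  where "twisted_tensor \<Theta> = universal_cstar_algebra (twisted_relators \<Theta>)"

definition twisted_family ::
    "('a, 'k) cstar_alg_scheme \<Rightarrow> complex ^ 'm ^ 'n \<Rightarrow> ('n \<Rightarrow> 'a) \<Rightarrow> ('m \<Rightarrow> 'a) \<Rightarrow> bool"
  where "twisted_family A \<Theta> s t \<longleftrightarrow>
    (\<forall>i. s i \<in> carrier A \<and> adj A (s i) \<otimes>\<^bsub>A\<^esub> s i = \<one>\<^bsub>A\<^esub>) \<and>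
    (\<forall>j. t j \<in> carrier A \<and> adj A (t j) \<otimes>\<^bsub>A\<^esub> t j = \<one>\<^bsub>A\<^esub>) \<and>
    (\<Oplus>\<^bsub>A\<^esub>i\<in>UNIV. s i \<otimes>\<^bsub>A\<^esub> adj A (s i)) = \<one>\<^bsub>A\<^esub> \<and>
    (\<Oplus>\<^bsub>A\<^esub>j\<in>UNIV. t j \<otimes>\<^bsub>A\<^esub> adj A (t j)) = \<one>\<^bsub>A\<^esub> \<and>
    (\<forall>i j. s i \<otimes>\<^bsub>A\<^esub> t j = cscale A (\<Theta> $ i $ j) (t j \<otimes>\<^bsub>A\<^esub> s i))"

lemma bounded_twisted_relators: "bounded_relators (twisted_relators \<Theta>)"
proof (rule bounded_relators_isometries)
  fix g show "free_adj (gen g) * gen g - 1 \<in> twisted_relators \<Theta>"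
    by (cases g) (auto simp: twisted_relators_def Let_def)
qed

theorem unital_cstar_algebra_twisted_tensor: "unital_cstar_algebra (twisted_tensor \<Theta>)"
  unfolding twisted_tensor_def by (intro unital_cstar_algebra_universal bounded_twisted_relators)

theorem twisted_family_twisted_tensor:
  fixes \<Theta> :: "complex ^ 'm::finite ^ 'n::finite"
  shows "twisted_family (twisted_tensor \<Theta>) \<Theta>
    (\<lambda>i. universal_gen (twisted_relators \<Theta>) (Inl i)) (\<lambda>j. universal_gen (twisted_relators \<Theta>) (Inr j))"
proof -
  note B = bounded_twisted_relators[of \<Theta>]
  note rules = universal_embed_closed[OF B] universal_embed_1[OF B, symmetric]
    universal_embed_mult[OF B, symmetric] universal_embed_adj[OF B, symmetric]
    universal_embed_scale[OF B, symmetric] universal_embed_sum[OF B finite, symmetric]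
  have g: "universal_gen (twisted_relators \<Theta>) g = universal_embed (twisted_relators \<Theta>) (gen g)" for g
    by (simp add: universal_gen_def universal_embed_def)
  show ?thesis
    unfolding twisted_family_def twisted_tensor_def g
    by (simp only: rules, intro conjI allI TrueI universal_embed_relator[OF B])
      (auto simp: twisted_relators_def Let_def)
qed

theorem twisted_tensor_universal:
  fixes \<Theta> :: "complex ^ 'm::finite ^ 'n::finite" and A :: "('a, 'k) cstar_alg_scheme"
  assumes "unital_cstar_algebra A" and st: "twisted_family A \<Theta> s t"
  shows "\<exists>\<phi>. star_hom (twisted_tensor \<Theta>) A \<phi> \<and>
    (\<forall>i. \<phi> (universal_gen (twisted_relators \<Theta>) (Inl i)) = s i) \<and>
    (\<forall>j. \<phi> (universal_gen (twisted_relators \<Theta>) (Inr j)) = t j)"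
proof -
  interpret unital_cstar_algebra A by fact
  define f where "f = case_sum s t"
  have f: "f g \<in> carrier A" for g
    using st by (cases g) (auto simp: f_def twisted_family_def)
  have fs: "f (Inl i) = s i" "f (Inr j) = t j" for i j by (simp_all add: f_def)
  note vals = free_val_diff[OF f] free_val_mult[OF f] free_val_adj[OF f] free_val_gen[OF f]
    free_val_1[OF f] free_val_scale[OF f] free_val_sum[OF f finite]
  have "free_val f r = \<zero>\<^bsub>A\<^esub>" if "r \<in> twisted_relators \<Theta>" for r
    using that st f[of "Inl _"] f[of "Inr _"]
    by (auto simp: twisted_relators_def Let_def vals fs twisted_family_def a_minus_def r_neg scale_closed)
  from universal_property[OF f bounded_twisted_relators this] obtain \<phi> where
    "star_hom (twisted_tensor \<Theta>) A \<phi>" "\<And>g. \<phi> (universal_gen (twisted_relators \<Theta>) g) = f g"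
    unfolding twisted_tensor_def by blast
  then show ?thesis by (intro exI[of _ \<phi>]) (simp add: fs)
qed

end

theory Submission
  imports Defs "HOL-Library.Function_Algebras"
begin

text \<open>
  Every monomial in the generators and their adjoints has a degree in \<open>\<int>\<^sup>2\<close>, which counts the \<open>s\<^sub>i\<close> minus their
  adjoints and the \<open>t\<^sub>j\<close> minus theirs. The plan is to find, for a nonzero \<open>X\<close>, elements \<open>y\<close> and \<open>y'\<close> such
  that \<open>y X y'\<close> is close to a nonzero scalar; a Neumann series then makes the product exactly one.

  The argument has three parts. First, some homogeneous component of \<open>X\<close> is nonzero. The relations are
  homogeneous, so the torus acts on the algebra by gauge automorphisms and these preserve the universal
  seminorm. Fejer means are convex combinations of gauge automorphisms, so they are contractions, and
  \<open>X\<close> is approximated by combinations of finitely many of its components. In quantitative form, for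
  approximants in the free algebra, this is \<open>seminorm_le_components\<close>.

  Second, a homogeneous component is a matrix of scalars. Columns are spanned by the monomials without
  adjoints of a fixed degree, and inner products of columns are scalars. A component of an element of the free
  algebra maps columns of one large degree to columns of another, and its norm is at most the norm of the
  sesquilinear form it defines on columns (\<open>norm_le_by_entries\<close>). So if the component has norm above \<open>K\<close>,
  then for some columns \<open>u\<close> and \<open>v\<close> of norm one \<open>u\<^sup>* x v\<close> is a scalar of modulus above \<open>K\<close> plus terms of
  nonzero degree.

  Third, these terms are killed by compression with the isometry \<open>s\<^sub>1\<^sup>r s\<^sub>2 t\<^sub>1\<^sup>r t\<^sub>2\<close> for large \<open>r\<close>, because the words
  \<open>s\<^sub>1\<^sup>r s\<^sub>2\<close> and \<open>t\<^sub>1\<^sup>r t\<^sub>2\<close> never overlap with a shift of themselves (\<open>marker_kills\<close>). This is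
  where each family must have two distinct generators. The outcome of the last two parts is \<open>component_attained\<close>.

  One point is hidden in the relations. That \<open>s\<^sub>i\<^sup>* s\<^sub>j = 0\<close> for \<open>i \<noteq> j\<close> is not imposed, but follows from
  \<open>\<Sum> s\<^sub>i s\<^sub>i\<^sup>* = 1\<close> because projections with sum one are orthogonal. This is a fact about positive
  elements, and it is obtained from the extremality of the unit in the unit ball, which has an elementary
  proof by comparison with a random walk (\<open>unit_extreme\<close>).
\<close>

section \<open>Right inverses near the unit\<close>

context unital_cstar_algebra
begin

text \<open>With \<open>y = \<one> - u\<close> of norm below one, the contraction \<open>v \<mapsto> \<one> + y v\<close> has a fixed point, and
  \<open>v = \<one> + y v\<close> says \<open>u v = \<one>\<close>. Iterating the contraction from \<open>\<one>\<close> produces the partial sums of the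
  Neumann series.\<close>

lemma right_inverse_near_one:
  assumes u: "u \<in> carrier A" and small: "cnorm A (u \<ominus> \<one>) < 1"
  shows "\<exists>v\<in>carrier A. u \<otimes> v = \<one>"
proof -
  define y where "y = \<one> \<ominus> u"
  define q where "q = cnorm A y"
  have y: "y \<in> carrier A" using u by (simp add: y_def)
  have "y = \<ominus> (u \<ominus> \<one>)"
    using u by (simp add: y_def a_minus_def minus_add a_comm)
  then have q: "0 \<le> q" "q < 1"
    using small u cnorm_minus[of "u \<ominus> \<one>"] cnorm_nonneg[OF y] by (simp_all add: q_def)
  define w where "w = rec_nat \<one> (\<lambda>_ v. \<one> \<oplus> y \<otimes> v)"
  have w0: "w 0 = \<one>" and wS: "w (Suc k) = \<one> \<oplus> y \<otimes> w k" for k by (simp_all add: w_def)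
  have w: "w k \<in> carrier A" for k by (induction k) (simp_all add: w0 wS y)
  have step: "cnorm A (w (Suc k) \<ominus> w k) \<le> q * q ^ k" for k
  proof (induction k)
    case 0
    have "w (Suc 0) \<ominus> w 0 = y" using y by (simp add: w0 wS a_minus_def a_assoc a_comm[of y] r_neg1 r_neg2)
    then show ?case by (simp add: q_def)
  next
    case (Suc k)
    have "w (Suc (Suc k)) \<ominus> w (Suc k) = (\<one> \<oplus> y \<otimes> w (Suc k)) \<ominus> (\<one> \<oplus> y \<otimes> w k)"
      by (simp only: wS)
    also have "\<dots> = y \<otimes> (w (Suc k) \<ominus> w k)"
      using y w[of k] w[of "Suc k"] by algebra
    finally have "cnorm A (w (Suc (Suc k)) \<ominus> w (Suc k)) \<le> q * cnorm A (w (Suc k) \<ominus> w k)"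
      using norm_mult_le[OF y, of "w (Suc k) \<ominus> w k"] w by (simp add: q_def)
    also have "\<dots> \<le> q * (q * q ^ k)" by (rule mult_left_mono[OF Suc q(1)])
    finally show ?case by simp
  qed
  have far: "cnorm A (w (k + i) \<ominus> w k) \<le> q * q ^ k * (\<Sum>j<i. q ^ j)" for k i
  proof (induction i)
    case 0
    show ?case using w[of k] by (simp add: a_minus_def r_neg)
  next
    case (Suc i)
    have "w (k + Suc i) \<ominus> w k = (w (Suc (k + i)) \<ominus> w (k + i)) \<oplus> (w (k + i) \<ominus> w k)"
      using minus_eq_add_minus[OF w w w] by simp
    then have "cnorm A (w (k + Suc i) \<ominus> w k) \<le> cnorm A (w (Suc (k + i)) \<ominus> w (k + i)) + cnorm A (w (k + i) \<ominus> w k)"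
      using norm_add w by simp
    also have "\<dots> \<le> q * q ^ (k + i) + q * q ^ k * (\<Sum>j<i. q ^ j)"
      by (intro add_mono step Suc)
    finally show ?case by (simp add: algebra_simps power_add)
  qed
  have far': "cnorm A (w (k + i) \<ominus> w k) \<le> q ^ k / (1 - q)" for k i
  proof -
    have "(\<Sum>j<i. q ^ j) = (1 - q ^ i) / (1 - q)" using q by (simp add: sum_gp_strict)
    also have "\<dots> \<le> 1 / (1 - q)" using q by (simp add: divide_right_mono)
    finally have "q * q ^ k * (\<Sum>j<i. q ^ j) \<le> q * q ^ k * (1 / (1 - q))"
      using q by (intro mult_left_mono) auto
    also have "\<dots> \<le> 1 * q ^ k * (1 / (1 - q))" using q by (intro mult_right_mono) auto
    finally show ?thesis using far[of k i] by simp
  qed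
  have "(\<lambda>k. q ^ k / (1 - q)) \<longlonglongrightarrow> 0 / (1 - q)"
    using q by (intro tendsto_divide tendsto_const LIMSEQ_realpow_zero) auto
  then have lim: "(\<lambda>k. q ^ k / (1 - q)) \<longlonglongrightarrow> 0" by simp
  have "\<exists>N. \<forall>j\<ge>N. \<forall>k\<ge>N. cnorm A (w j \<ominus> w k) < e" if e: "e > 0" for e
  proof -
    obtain N where N: "\<And>k. k \<ge> N \<Longrightarrow> q ^ k / (1 - q) < e"
      using order_tendstoD(2)[OF lim e] by (auto simp: eventually_sequentially)
    have *: "cnorm A (w j \<ominus> w k) < e" if "k \<ge> N" "j \<ge> k" for j k
      using far'[of k "j - k"] N[OF that(1)] that(2) by simp
    have "cnorm A (w j \<ominus> w k) = cnorm A (w k \<ominus> w j)" for j k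
    proof -
      have "w j \<ominus> w k = \<ominus> (w k \<ominus> w j)" using w[of j] w[of k] by (simp add: a_minus_def minus_add a_comm)
      then show ?thesis using w cnorm_minus by simp
    qed
    then have "cnorm A (w j \<ominus> w k) < e" if "k \<ge> N" "j \<ge> N" for j k
      using that *[of k j] *[of j k] by (cases "j \<ge> k") auto
    then show ?thesis by blast
  qed
  with complete[of w] w obtain v where v: "v \<in> carrier A" "(\<lambda>k. cnorm A (w k \<ominus> v)) \<longlonglongrightarrow> 0" by blast
  have conv: "converges w v" using v w by (auto simp: converges_def)
  have "converges (\<lambda>k. w (Suc k)) v"
    using conv LIMSEQ_Suc[of "\<lambda>k. cnorm A (w k \<ominus> v)"] by (auto simp: converges_def)
  moreover have "converges (\<lambda>k. w (Suc k)) (\<one> \<oplus> y \<otimes> v)"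
    unfolding wS by (intro converges_add converges_mult converges_const conv y one_closed)
  ultimately have "v = \<one> \<oplus> y \<otimes> v" by (rule converges_unique)
  then have "v \<ominus> y \<otimes> v = \<one>" using v(1) y by (metis a_comm add.inv_solve_right' a_minus_def m_closed one_closed)
  moreover have "u \<otimes> v = v \<ominus> y \<otimes> v" unfolding y_def using u v(1) by algebra
  ultimately show ?thesis using v(1) by auto
qed

end

section \<open>Reweighting the words of the free algebra\<close>

lemma free_scale_1 [simp]: "free_scale 1 x = x"
  by (simp add: free_scale_eq)

lemma free_scale_0 [simp]: "free_scale 0 x = 0"
  by (simp add: free_scale_eq)

lemma free_scale_scale: "free_scale c (free_scale d x) = free_scale (c * d) x"
  by (simp add: free_scale_eq mult_single flip: mult.assoc)

lemma free_scale_mult_left: "free_scale c x * y = free_scale c (x * y)"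
  by (simp add: free_scale_eq mult.assoc)

lemma free_scale_add: "free_scale c (x + y) = free_scale c x + free_scale c y"
  by (simp add: free_scale_eq distrib_left)

lemma free_scale_add_left: "free_scale (c + d) x = free_scale c x + free_scale d x"
  by (simp add: free_scale_eq single_add distrib_right)

lemma lookup_free_scale: "Poly_Mapping.lookup (free_scale c x) w = c * Poly_Mapping.lookup x w"
  by (simp add: free_scale_def Poly_Mapping.map.rep_eq when_def)

lemma free_adj_1 [simp]: "free_adj 1 = 1"
  by (metis free_adj_single single_one word_adj_0 complex_cnj_one)

lemma free_eq_sum_monomials:
  "x = (\<Sum>w\<in>Poly_Mapping.keys x. free_scale (Poly_Mapping.lookup x w) (Poly_Mapping.single w 1))"
  by (intro poly_mapping_eqI)
    (auto simp: lookup_sum lookup_free_scale lookup_single when_def if_distrib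
      not_in_keys_iff_lookup_eq_zero cong: if_cong)

text \<open>Gauge automorphisms, homogeneous components and Fejer means all multiply the coefficient of each word by
  a number that depends on the word alone; they differ only in that number.\<close>

definition reweight :: "('g star_word \<Rightarrow> complex) \<Rightarrow> 'g free_star_alg \<Rightarrow> 'g free_star_alg"
  where "reweight \<phi> x =
    (\<Sum>w\<in>Poly_Mapping.keys x. Poly_Mapping.single w (\<phi> w * Poly_Mapping.lookup x w))"

lemma lookup_reweight [simp]:
  "Poly_Mapping.lookup (reweight \<phi> x) w = \<phi> w * Poly_Mapping.lookup x w"
  by (auto simp: reweight_def lookup_sum lookup_single when_def not_in_keys_iff_lookup_eq_zero)

lemma word_lengths_bounded:
  obtains M where "\<And>w. w \<in> Poly_Mapping.keys x \<Longrightarrow> length (letters w) \<le> M"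
  using finite_imageI[OF finite_keys[of x], of "\<lambda>w. length (letters w)"]
  by (metis finite_nat_set_iff_bounded_le imageI)

lemma reweight_add: "reweight \<phi> (x + y) = reweight \<phi> x + reweight \<phi> y"
  by (intro poly_mapping_eqI) (simp add: lookup_add algebra_simps)

lemma reweight_diff: "reweight \<phi> (x - y) = reweight \<phi> x - reweight \<phi> y"
  by (intro poly_mapping_eqI) (simp add: lookup_minus algebra_simps)

lemma reweight_scale: "reweight \<phi> (free_scale c x) = free_scale c (reweight \<phi> x)"
  by (intro poly_mapping_eqI) (simp add: lookup_free_scale)

lemma reweight_single:
  "reweight \<phi> (Poly_Mapping.single w c) = Poly_Mapping.single w (\<phi> w * c)"
  by (intro poly_mapping_eqI) (simp add: lookup_single when_def)

lemma reweight_reweight: "reweight \<phi> (reweight \<psi> x) = reweight (\<lambda>w. \<phi> w * \<psi> w) x"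
  by (intro poly_mapping_eqI) simp

lemma reweight_mult:
  assumes "\<And>u v. \<phi> (u + v) = \<phi> u * \<phi> v"
  shows "reweight \<phi> (x * y) = reweight \<phi> x * reweight \<phi> y"
proof (induction x rule: free_induct)
  case (single w c)
  show ?case
    by (induction y rule: free_induct)
      (simp_all add: mult_single reweight_single assms distrib_left reweight_add ac_simps)
qed (simp add: distrib_right reweight_add)

lemma reweight_adj:
  assumes "\<And>w. \<phi> (word_adj w) = cnj (\<phi> w)"
  shows "reweight \<phi> (free_adj x) = free_adj (reweight \<phi> x)"
  by (intro poly_mapping_eqI) (simp add: lookup_free_adj assms)

section \<open>Equality modulo null elements\<close>

context cstar_seminorm
begin

text \<open>Elements of seminorm zero form an ideal, and \<open>\<simeq>\<close> is equality in the quotient, hence in the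
  completion. Computing with representatives keeps all the algebra inside one ring, and only the last step
  passes to the completion.\<close>

definition eqv (infix "\<simeq>" 50) where "x \<simeq> y \<longleftrightarrow> p (x - y) = 0"

lemma eqv_refl [simp]: "x \<simeq> x" by (simp add: eqv_def)

lemma eqv_sym: "x \<simeq> y \<Longrightarrow> y \<simeq> x" by (simp add: eqv_def p_minus_commute)

lemma eqv_trans [trans]: "x \<simeq> y \<Longrightarrow> y \<simeq> z \<Longrightarrow> x \<simeq> z"
  using p_triangle[of x z y] p_nonneg[of "x - z"] by (simp add: eqv_def)

lemma eqv_norm: "x \<simeq> y \<Longrightarrow> p x = p y"
  using p_abs_diff[of x y] by (simp add: eqv_def)

lemma eqv_0_iff: "x \<simeq> 0 \<longleftrightarrow> p x = 0" by (simp add: eqv_def)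

lemma eqv_add: assumes "x \<simeq> x'" "y \<simeq> y'" shows "x + y \<simeq> x' + y'"
proof -
  have "p ((x - x') + (y - y')) \<le> 0" using p_add[of "x - x'" "y - y'"] assms by (simp add: eqv_def)
  then have "p ((x - x') + (y - y')) = 0" using p_nonneg order_antisym by blast
  then show ?thesis by (simp add: eqv_def algebra_simps)
qed

lemma eqv_mult: assumes "x \<simeq> x'" "y \<simeq> y'" shows "x * y \<simeq> x' * y'"
  using p_mult_diff[of x y x' y'] p_nonneg[of "x * y - x' * y'"] assms
  by (simp add: eqv_def del: p_nonneg)

lemma eqv_scale: "x \<simeq> y \<Longrightarrow> free_scale c x \<simeq> free_scale c y"
  by (simp add: eqv_def free_scale_diff p_scale)

lemma eqv_adj: "x \<simeq> y \<Longrightarrow> free_adj x \<simeq> free_adj y"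
  by (simp add: eqv_def flip: free_adj_diff)

lemma eqv_sum: "(\<And>i. i \<in> I \<Longrightarrow> f i \<simeq> g i) \<Longrightarrow> sum f I \<simeq> sum g I"
  by (induction I rule: infinite_finite_induct) (auto intro: eqv_add)

lemma p_sum: "p (sum f I) \<le> (\<Sum>i\<in>I. p (f i))"
proof (induction I rule: infinite_finite_induct)
  case (insert i I)
  then show ?case using p_add[of "f i" "sum f I"] by simp
qed simp_all

text \<open>The C*-identity, iterated. A bound on the powers of a self-adjoint element that is off by a constant
  factor therefore still bounds the element itself without the factor.\<close>

lemma p_power_self_adjoint:
  assumes "free_adj x = x" shows "p (x ^ 2 ^ j) = p x ^ 2 ^ j"
proof (induction j)
  case (Suc j)
  have adj: "free_adj (x ^ n) = x ^ n" for n
    by (induction n) (simp_all add: free_adj_mult assms power_commutes)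
  have "p (x ^ 2 ^ Suc j) = p (free_adj (x ^ 2 ^ j) * x ^ 2 ^ j)"
    by (simp add: adj power_add[symmetric] mult_2)
  also have "\<dots> = p x ^ 2 ^ Suc j" by (simp only: p_cstar Suc power_mult[symmetric] power_Suc2)
  finally show ?case .
qed simp

lemma p_reweight_le:
  "p (reweight \<phi> x) \<le> (\<Sum>w\<in>Poly_Mapping.keys x.
      norm (\<phi> w) * (norm (Poly_Mapping.lookup x w) * p (Poly_Mapping.single w 1)))"
proof -
  have s: "Poly_Mapping.single w c = free_scale c (Poly_Mapping.single w 1)" for w c
    by (simp add: free_scale_eq mult_single)
  show ?thesis
    unfolding reweight_def
    by (rule order_trans[OF p_sum], subst s)
      (simp add: p_scale norm_mult mult.assoc)
qed

end

section \<open>Degrees and the gauge action\<close>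

definition unit_degree :: "'c \<Rightarrow> 'c \<Rightarrow> int"
  where "unit_degree c = (\<lambda>d. if d = c then 1 else 0)"

primrec letter_degree :: "('g \<Rightarrow> 'c) \<Rightarrow> 'g letter \<Rightarrow> 'c \<Rightarrow> int" where
  "letter_degree colour (Gen g) = unit_degree (colour g)"
| "letter_degree colour (Adj g) = - unit_degree (colour g)"

definition word_degree :: "('g \<Rightarrow> 'c) \<Rightarrow> 'g star_word \<Rightarrow> 'c \<Rightarrow> int"
  where "word_degree colour w = sum_list (map (letter_degree colour) (letters w))"

lemma word_degree_0 [simp]: "word_degree colour 0 = 0"
  by (simp add: word_degree_def zero_star_word_def)

lemma word_degree_add: "word_degree colour (u + v) = word_degree colour u + word_degree colour v"
  by (simp add: word_degree_def plus_star_word_def)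

lemma word_degree_adj: "word_degree colour (word_adj w) = - word_degree colour w"
proof -
  have "letter_degree colour (letter_adj l) = - letter_degree colour l" for l
    by (cases l) simp_all
  then have "sum_list (map (letter_degree colour) (rev (map letter_adj ls))) =
      - sum_list (map (letter_degree colour) ls)" for ls
    by (induction ls) simp_all
  then show ?thesis by (simp add: word_degree_def word_adj_def)
qed

lemma abs_word_degree_le: "\<bar>word_degree colour w c\<bar> \<le> int (length (letters w))"
proof -
  have "\<bar>sum_list (map (letter_degree colour) ls) c\<bar> \<le> int (length ls)" for ls
  proof (induction ls)
    case (Cons l ls)
    then show ?case by (cases l) (auto simp: unit_degree_def)
  qed simp
  then show ?thesis by (simp add: word_degree_def)
qed

definition gauge :: "('g \<Rightarrow> 'c) \<Rightarrow> 'c \<Rightarrow> complex \<Rightarrow> 'g free_star_alg \<Rightarrow> 'g free_star_alg"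
  where "gauge colour c z = reweight (\<lambda>w. z powi word_degree colour w c)"

lemma gauge_mult: "z \<noteq> 0 \<Longrightarrow> gauge colour c z (x * y) = gauge colour c z x * gauge colour c z y"
  unfolding gauge_def by (rule reweight_mult) (simp add: word_degree_add power_int_add)

lemma gauge_adj:
  assumes "norm z = 1" shows "gauge colour c z (free_adj x) = free_adj (gauge colour c z x)"
proof -
  have "inverse z = cnj z" using assms by (metis inverse_unique complex_norm_square of_real_1 power_one)
  then show ?thesis
    unfolding gauge_def
    by (intro reweight_adj) (simp add: word_degree_adj power_int_minus flip: power_int_inverse)
qed

lemma gauge_add: "gauge colour c z (x + y) = gauge colour c z x + gauge colour c z y"
  by (simp add: gauge_def reweight_add)

lemma gauge_diff: "gauge colour c z (x - y) = gauge colour c z x - gauge colour c z y"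
  by (simp add: gauge_def reweight_diff)

lemma gauge_scale: "gauge colour c z (free_scale s x) = free_scale s (gauge colour c z x)"
  by (simp add: gauge_def reweight_scale)

lemma gauge_0: "gauge colour c z 0 = 0"
  using gauge_scale[of colour c z 0 0] by simp

lemma gauge_1: "gauge colour c z 1 = 1"
  using reweight_single[of "\<lambda>w. z powi word_degree colour w c" 0 1] by (simp add: gauge_def)

lemma gauge_sum: "gauge colour c z (sum f I) = (\<Sum>i\<in>I. gauge colour c z (f i))"
  by (induction I rule: infinite_finite_induct) (simp_all add: gauge_0 gauge_add)

lemma gauge_gen:
  "gauge colour c z (gen g) = free_scale (z powi unit_degree (colour g) c) (gen g)"
  by (simp add: gauge_def gen_def reweight_single word_degree_def free_scale_eq mult_single)

text \<open>The part of \<open>x\<close> that is homogeneous of degree \<open>d\<close>. For \<open>d = 0\<close> this is the conditional expectation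
  onto the fixed points of the gauge action.\<close>

definition component :: "('g \<Rightarrow> 'c) \<Rightarrow> ('c \<Rightarrow> int) \<Rightarrow> 'g free_star_alg \<Rightarrow> 'g free_star_alg"
  where "component colour d = reweight (\<lambda>w. of_bool (word_degree colour w = d))"


section \<open>Fejer means\<close>

text \<open>The Fourier coefficients \<open>max 0 (1 - \<bar>m\<bar> / N)\<close> of the Fejer kernel.\<close>

definition fejer :: "nat \<Rightarrow> int \<Rightarrow> real"
  where "fejer N m = real (N - nat \<bar>m\<bar>) / real N"

lemma sum_roots_of_unity_powi:
  assumes "L > 0"
  shows "(\<Sum>l<L. cis (2 * pi * real l / real L) powi m) = (if int L dvd m then of_nat L else 0)"
proof -
  define t where "t = 2 * pi * of_int m / real L"
  have t: "cis (2 * pi * real l / real L) powi m = cis t ^ l" for l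
    proof -
    have "of_int m * (2 * pi * real l / real L) = real l * t" by (simp add: t_def)
    then show ?thesis by (simp only: cis_power_int Complex.DeMoivre)
  qed
  show ?thesis
  proof (cases "int L dvd m")
    case True
    then obtain k where "m = int L * k" by blast
    then have "t = 2 * pi * of_int k" using assms by (simp add: t_def)
    then have "cis t = 1" by (simp add: cis_multiple_2pi)
    then show ?thesis using True by (simp add: t)
  next
    case False
    have "cis t \<noteq> 1"
    proof
      assume "cis t = 1"
      then have "cos t = 1" by (metis cis.simps(1) one_complex.simps(1))
      then obtain k :: int where "t = of_int k * (2 * pi)" by (auto simp: cos_one_2pi_int)
      then have "of_int m = (of_int (int L * k) :: real)"
        using assms by (simp add: t_def field_simps)
      then have "m = int L * k" by (simp only: of_int_eq_iff)
      with False show False by simp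
    qed
    moreover have "cis t ^ L = 1"
    proof -
      have "real L * t = 2 * pi * of_int m" using assms by (simp add: t_def)
      then show ?thesis by (simp add: Complex.DeMoivre cis_multiple_2pi)
    qed
    ultimately show ?thesis using False by (simp add: t sum_gp_strict)
  qed
qed

text \<open>Squaring \<open>\<Sum>i<N. z ^ i\<close> produces \<open>z\<close> to the power \<open>m\<close> once for every pair of
  exponents with difference \<open>m\<close>; this count is why the Fejer kernel is a square of a modulus.\<close>

lemma card_pairs_with_difference:
  "card {(i, j). i < N \<and> j < N \<and> int i - int j = m} = N - nat \<bar>m\<bar>"
proof -
  have "bij_betw (\<lambda>k. (k + nat m, k + nat (- m))) {..<N - nat \<bar>m\<bar>}
      {(i, j). i < N \<and> j < N \<and> int i - int j = m}"
    by (rule bij_betw_byWitness[where f' = "\<lambda>(i, j). min i j"]) auto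
  then show ?thesis by (simp add: bij_betw_same_card[symmetric])
qed

lemma fejer_eq_sum: "fejer N m = (\<Sum>i<N. \<Sum>j<N. of_bool (int i - int j = m)) / real N"
proof -
  let ?B = "{(i, j). i < N \<and> j < N \<and> int i - int j = m}"
  have "(\<Sum>i<N. \<Sum>j<N. of_bool (int i - int j = m)) =
      (\<Sum>ij\<in>{..<N} \<times> {..<N}. of_bool (ij \<in> ?B) :: real)"
    unfolding sum.cartesian_product by (intro sum.cong) auto
  also have "\<dots> = (\<Sum>ij\<in>?B. 1)"
    by (rule sum.mono_neutral_cong_right) auto
  also have "\<dots> = real (N - nat \<bar>m\<bar>)"
    using card_pairs_with_difference[of N m] by simp
  finally show ?thesis by (simp add: fejer_def)
qed

text \<open>The Fejer kernel \<open>\<bar>\<Sum>i<N. z ^ i\<bar>\<^sup>2 / N\<close> is nonnegative on the unit circle, and its Fourier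
  coefficients can be recovered exactly from finitely many roots of unity. So a Fejer mean is a convex
  combination of finitely many gauge automorphisms, and no integration is needed.\<close>

lemma fejer_as_average:
  assumes N: "N > 0" and L: "\<bar>m\<bar> + int N \<le> int L"
  defines "z \<equiv> \<lambda>l. cis (2 * pi * real l / real L)"
  shows "(\<Sum>l<L. of_real ((norm (\<Sum>i<N. z l ^ i))\<^sup>2 / (real N * real L)) * cnj (z l) powi m) =
    of_real (fejer N m)"
proof -
  have L0: "L > 0" using N L by linarith
  have z: "z l \<noteq> 0" "cnj (z l) = inverse (z l)" for l by (simp_all add: z_def cis_cnj cis_inverse)
  have mono: "z l ^ i * inverse (z l) ^ j * inverse (z l) powi m = z l powi (int i - int j - m)" for l i j
  proof -
    have "inverse (z l) ^ j = z l powi (- int j)" "inverse (z l) powi m = z l powi (- m)"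
      by (simp_all add: power_int_minus power_int_inverse power_inverse)
    moreover have "z l ^ i = z l powi int i" by simp
    ultimately show ?thesis using z(1)[of l] by (simp only: power_int_add[symmetric] simp_thms) simp
  qed
  have "(\<Sum>l<L. of_real ((norm (\<Sum>i<N. z l ^ i))\<^sup>2 / (real N * real L)) * cnj (z l) powi m) =
      (\<Sum>l<L. (\<Sum>i<N. \<Sum>j<N. z l powi (int i - int j - m))) / (of_nat N * of_nat L)"
  proof -
    have "of_real ((norm (\<Sum>i<N. z l ^ i))\<^sup>2) * cnj (z l) powi m =
        (\<Sum>i<N. \<Sum>j<N. z l powi (int i - int j - m))" for l
    proof -
      have "of_real ((norm (\<Sum>i<N. z l ^ i))\<^sup>2) = (\<Sum>i<N. z l ^ i) * (\<Sum>j<N. inverse (z l) ^ j)"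
        by (simp add: complex_norm_square z cnj_sum del: of_real_power)
      also have "\<dots> = (\<Sum>i<N. \<Sum>j<N. z l ^ i * inverse (z l) ^ j)" by (rule sum_product)
      finally show ?thesis
        by (simp only: sum_distrib_right z(2) mono)
    qed
    then show ?thesis by (simp add: sum_divide_distrib divide_simps)
  qed
  also have "(\<Sum>l<L. (\<Sum>i<N. \<Sum>j<N. z l powi (int i - int j - m))) =
      (\<Sum>i<N. \<Sum>j<N. \<Sum>l<L. z l powi (int i - int j - m))"
    by (subst sum.swap, intro sum.cong refl sum.swap)
  also have "\<dots> = (\<Sum>i<N. \<Sum>j<N. of_nat L * of_bool (int i - int j = m))"
  proof (intro sum.cong refl)
    fix i j assume "i \<in> {..<N}" "j \<in> {..<N}"
    (* \<open>L\<close> exceeds all differences that occur, so reduction modulo \<open>L\<close> identifies no two of them. *)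
    then have "\<bar>int i - int j - m\<bar> < int L" using L by auto
    then have "int L dvd int i - int j - m \<longleftrightarrow> int i - int j = m"
      using dvd_imp_le_int[of "int i - int j - m" "int L"] by auto
    then show "(\<Sum>l<L. z l powi (int i - int j - m)) = of_nat L * of_bool (int i - int j = m)"
      unfolding z_def sum_roots_of_unity_powi[OF L0] by simp
  qed
  also have "\<dots> / (of_nat N * of_nat L) = of_real (fejer N m)"
    using L0 by (simp add: fejer_eq_sum flip: sum_distrib_left)
  finally show ?thesis .
qed

lemma fejer_eq_0: "\<bar>m\<bar> \<ge> int N \<Longrightarrow> fejer N m = 0"
  by (simp add: fejer_def nat_le_iff)

lemma fejer_bounds: "0 \<le> fejer N m" "fejer N m \<le> 1"
  by (cases "N = 0"; simp add: fejer_def divide_le_eq_1)+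

lemma fejer_tendsto: "(\<lambda>N. fejer N m) \<longlonglongrightarrow> 1"
proof -
  have "(\<lambda>N. 1 - of_int \<bar>m\<bar> / real N) \<longlonglongrightarrow> 1 - 0"
    by (intro tendsto_intros tendsto_divide_0[OF tendsto_const] filterlim_real_sequentially
      filterlim_at_top_imp_at_infinity)
  moreover have "\<forall>\<^sub>F N in sequentially. 1 - of_int \<bar>m\<bar> / real N = fejer N m"
    using eventually_ge_at_top[of "nat \<bar>m\<bar> + 1"]
    by eventually_elim (simp add: fejer_def of_nat_diff field_simps)
  ultimately show ?thesis using Lim_transform_eventually by force
qed

locale gauge_invariant_seminorm = cstar_seminorm p
  for p :: "'g free_star_alg \<Rightarrow> real" +
  fixes colour :: "'g \<Rightarrow> 'c"
  assumes p_gauge: "norm z = 1 \<Longrightarrow> p (gauge colour c z x) \<le> p x"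
begin

definition fejer_mean :: "'c \<Rightarrow> nat \<Rightarrow> 'g free_star_alg \<Rightarrow> 'g free_star_alg"
  where "fejer_mean c N = reweight (\<lambda>w. of_real (fejer N (word_degree colour w c)))"

text \<open>A convex combination of contractions is a contraction.\<close>

lemma fejer_mean_le:
  assumes N: "N > 0" shows "p (fejer_mean c N x) \<le> p x"
proof -
  obtain M where M: "\<And>w. w \<in> Poly_Mapping.keys x \<Longrightarrow> length (letters w) \<le> M"
    using word_lengths_bounded[of x] by blast
  (* Enough roots of unity to separate every degree occurring in \<open>x\<close>. *)
  define L where "L = M + N"
  define z where "z l = cis (2 * pi * real l / real L)" for l
  define a where "a l = (norm (\<Sum>i<N. z l ^ i))\<^sup>2 / (real N * real L)" for l
  have avg: "(\<Sum>l<L. of_real (a l) * cnj (z l) powi m) = of_real (fejer N m)"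
    if "\<bar>m\<bar> \<le> int M" for m
    unfolding a_def z_def by (rule fejer_as_average[OF N]) (use that in \<open>simp add: L_def\<close>)
  have "fejer_mean c N x = (\<Sum>l<L. free_scale (of_real (a l)) (gauge colour c (cnj (z l)) x))"
  proof (rule poly_mapping_eqI)
    fix w
    show "Poly_Mapping.lookup (fejer_mean c N x) w =
      Poly_Mapping.lookup (\<Sum>l<L. free_scale (of_real (a l)) (gauge colour c (cnj (z l)) x)) w"
    proof (cases "w \<in> Poly_Mapping.keys x")
      case True
      have "\<bar>word_degree colour w c\<bar> \<le> int M"
        using abs_word_degree_le[of colour w c] M[OF True] by linarith
      from avg[OF this] show ?thesis
        by (simp add: fejer_mean_def gauge_def lookup_sum lookup_free_scale sum_distrib_right
          mult.assoc[symmetric] flip: sum_distrib_right)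
    next
      case False
      then show ?thesis
        by (simp add: fejer_mean_def gauge_def lookup_sum lookup_free_scale not_in_keys_iff_lookup_eq_zero)
    qed
  qed
  then have "p (fejer_mean c N x) \<le> (\<Sum>l<L. p (free_scale (of_real (a l)) (gauge colour c (cnj (z l)) x)))"
    by (simp add: p_sum)
  also have "\<dots> \<le> (\<Sum>l<L. a l * p x)"
  proof (rule sum_mono)
    fix l
    have "a l \<ge> 0" "norm (cnj (z l)) = 1" by (simp_all add: a_def z_def)
    then show "p (free_scale (of_real (a l)) (gauge colour c (cnj (z l)) x)) \<le> a l * p x"
      using p_gauge[of "cnj (z l)" c x] by (simp add: p_scale mult_left_mono)
  qed
  also have "\<dots> = p x"
  proof -
    have "of_real (\<Sum>l<L. a l) = (of_real (fejer N 0) :: complex)" using avg[of 0] by simp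
    then have "(\<Sum>l<L. a l) = fejer N 0" by (simp only: of_real_eq_iff)
    then show ?thesis using N by (simp add: fejer_def flip: sum_distrib_right)
  qed
  finally show ?thesis .
qed

lemma fejer_mean_diff: "fejer_mean c N (x - y) = fejer_mean c N x - fejer_mean c N y"
  by (simp add: fejer_mean_def reweight_diff)

lemma fejer_mean_tendsto: "(\<lambda>N. p (x - fejer_mean c N x)) \<longlonglongrightarrow> 0"
proof -
  let ?f = "\<lambda>N w. 1 - fejer N (word_degree colour w c)"
  have "x - fejer_mean c N x = reweight (\<lambda>w. of_real (?f N w)) x" for N
    by (intro poly_mapping_eqI) (simp add: fejer_mean_def lookup_minus algebra_simps)
  then have le: "p (x - fejer_mean c N x) \<le> (\<Sum>w\<in>Poly_Mapping.keys x. \<bar>?f N w\<bar> *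
      (norm (Poly_Mapping.lookup x w) * p (Poly_Mapping.single w 1)))" for N
    using p_reweight_le[of "\<lambda>w. of_real (?f N w)" x] by (simp only: norm_of_real)
  have "(\<lambda>N. \<Sum>w\<in>Poly_Mapping.keys x. \<bar>?f N w\<bar> *
      (norm (Poly_Mapping.lookup x w) * p (Poly_Mapping.single w 1))) \<longlonglongrightarrow>
      (\<Sum>w\<in>Poly_Mapping.keys x. \<bar>1 - 1\<bar> *
      (norm (Poly_Mapping.lookup x w) * p (Poly_Mapping.single w 1)))"
    by (intro tendsto_intros fejer_tendsto)
  then have "(\<lambda>N. \<Sum>w\<in>Poly_Mapping.keys x. \<bar>?f N w\<bar> *
      (norm (Poly_Mapping.lookup x w) * p (Poly_Mapping.single w 1))) \<longlonglongrightarrow> 0" by simp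
  then show ?thesis using le by (rule null_le')
qed

text \<open>If all components of \<open>y\<close> in a fixed finite set of degrees are small and \<open>y\<close> is close to \<open>x\<close>, then \<open>x\<close>
  is small. The finite set depends on \<open>x\<close> and \<open>e\<close> but not on \<open>y\<close>: this uniformity lets \<open>y\<close> be chosen
  afterwards as an arbitrarily good approximation, and it is how the faithfulness of the conditional
  expectation enters. The reason is that the Fejer mean \<open>S\<close>, of high enough order in both colours, nearly
  fixes \<open>x\<close>, is a contraction, and only sees finitely many components of \<open>y\<close>.\<close>

lemma seminorm_le_components:
  assumes two: "(UNIV :: 'c set) = {c, d}" and "e > 0"
  shows "\<exists>D. finite D \<and> (\<forall>y. p x \<le> (\<Sum>k\<in>D. p (component colour k y)) + p (x - y) + e)"
proof -
  have "\<forall>\<^sub>F N in sequentially. p (x - fejer_mean c' N x) < e / 2" for c'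
    using order_tendstoD(2)[OF fejer_mean_tendsto[of x c'], of "e / 2"] \<open>e > 0\<close> by simp
  from this[of c] this[of d] eventually_gt_at_top[of 0]
  have "\<forall>\<^sub>F N in sequentially. N > 0 \<and> p (x - fejer_mean c N x) < e / 2 \<and> p (x - fejer_mean d N x) < e / 2"
    by eventually_elim auto
  then obtain N where N: "N > 0" "p (x - fejer_mean c N x) < e / 2" "p (x - fejer_mean d N x) < e / 2"
    unfolding eventually_sequentially by blast
  define S where "S x = fejer_mean c N (fejer_mean d N x)" for x
  have S_le: "p (S y) \<le> p y" for y
    unfolding S_def using fejer_mean_le[OF N(1)] order_trans by blast
  define D where "D = {k. \<forall>c'\<in>(UNIV :: 'c set). k c' \<in> {- int N..int N}}"
  have "finite (UNIV :: 'c set)" by (simp add: two)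
  then have "finite (PiE (UNIV :: 'c set) (\<lambda>_. {- int N..int N}))" by (intro finite_PiE) auto
  moreover have "D = PiE (UNIV :: 'c set) (\<lambda>_. {- int N..int N})" by (auto simp: D_def PiE_def)
  ultimately have D: "finite D" by simp
  have "p x \<le> (\<Sum>k\<in>D. p (component colour k y)) + p (x - y) + e" for y
  proof -
    let ?f = "\<lambda>k. fejer N (k c) * fejer N (k d)"
    have "S y = (\<Sum>k\<in>D. free_scale (of_real (?f k)) (component colour k y))"
    proof (rule poly_mapping_eqI)
      fix w
      let ?k = "word_degree colour w"
      have "?k \<notin> D \<Longrightarrow> ?f ?k = 0"
        unfolding D_def two using fejer_eq_0[of N "?k c"] fejer_eq_0[of N "?k d"] by auto
      then show "Poly_Mapping.lookup (S y) w =
          Poly_Mapping.lookup (\<Sum>k\<in>D. free_scale (of_real (?f k)) (component colour k y)) w"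
        using D by (auto simp: S_def fejer_mean_def component_def reweight_reweight lookup_sum
          lookup_free_scale of_bool_def if_distrib if_distribR cong: if_cong)
    qed
    then have "p (S y) \<le> (\<Sum>k\<in>D. p (free_scale (of_real (?f k)) (component colour k y)))"
      by (simp add: p_sum)
    also have "\<dots> \<le> (\<Sum>k\<in>D. p (component colour k y))"
    proof (rule sum_mono)
      fix k
      have "\<bar>?f k\<bar> \<le> 1" by (simp add: abs_mult fejer_bounds mult_le_one)
      then show "p (free_scale (of_real (?f k)) (component colour k y)) \<le> p (component colour k y)"
        unfolding p_scale norm_of_real by (intro mult_left_le_one_le) auto
    qed
    finally have "p (S y) \<le> (\<Sum>k\<in>D. p (component colour k y))" .
    moreover have "p (S x - S y) \<le> p (x - y)"
      using S_le[of "x - y"] by (simp add: S_def fejer_mean_diff)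
    moreover have "p (x - S x) \<le> e"
    proof -
      have "p (fejer_mean c N x - S x) \<le> p (x - fejer_mean d N x)"
        unfolding S_def fejer_mean_diff[symmetric] by (rule fejer_mean_le[OF N(1)])
      then show ?thesis using p_triangle[of x "S x" "fejer_mean c N x"] N by linarith
    qed
    moreover have "p x \<le> p (x - S x) + p (S x - S y) + p (S y)"
      using p_add[of "x - S x" "S x"] p_add[of "S x - S y" "S y"] by simp
    ultimately show ?thesis by linarith
  qed
  with D show ?thesis by blast
qed

end

section \<open>Positivity without spectral theory\<close>

context cstar_seminorm
begin

text \<open>Put \<open>x = (1 + h) / 2\<close> and \<open>y = (1 - h) / 2\<close>, so that \<open>x + y = 1\<close> and \<open>x - y = h\<close>. Then
  \<open>(m + 1) h + a = x (m h + a + 1) + y (m h + a - 1)\<close>, which is one step of a simple random walk; the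
  coefficients \<open>x\<close> and \<open>y\<close> have norm at most \<open>1/2\<close>. So the norm is at most the mean of
  \<open>\<bar>a + S\<^sub>m\<bar>\<close> for the walk \<open>S\<^sub>m\<close>, and its root mean square is \<open>sqrt (m + a\<^sup>2)\<close>.\<close>

lemma random_walk_bound:
  assumes one: "p 1 = 1" and h: "p (1 + h) \<le> 1" "p (1 - h) \<le> 1"
  shows "p (free_scale (of_nat m) h + free_scale (of_real a) 1) \<le> sqrt (real m + a\<^sup>2)"
proof (induction m arbitrary: a)
  case 0
  show ?case by (simp add: p_scale one)
next
  case (Suc m)
  define u where "u b = free_scale (of_nat m) h + free_scale (of_real b) 1" for b
  have sum: "free_scale (of_nat (Suc m)) h + free_scale (of_real a) 1 =
      free_scale (1/2) ((1 + h) * u (a + 1)) + free_scale (1/2) ((1 - h) * u (a - 1))"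
  proof -
    have "(1 + h) * u (a + 1) + (1 - h) * u (a - 1) = (u (a + 1) + u (a - 1)) + h * (u (a + 1) - u (a - 1))"
      by (simp add: algebra_simps)
    also have "u (a + 1) + u (a - 1) = free_scale 2 (free_scale (of_nat m) h + free_scale (of_real a) 1)"
      by (intro poly_mapping_eqI) (simp add: u_def lookup_add lookup_free_scale algebra_simps)
    also have "u (a + 1) - u (a - 1) = free_scale 2 1"
      by (intro poly_mapping_eqI) (simp add: u_def lookup_add lookup_minus lookup_free_scale algebra_simps)
    finally show ?thesis
      by (simp add: free_scale_mult_right free_scale_add[symmetric] free_scale_scale)
        (intro poly_mapping_eqI, simp add: lookup_add lookup_free_scale algebra_simps)
  qed
  have half: "p (free_scale (1/2) (x * u b)) \<le> sqrt (real m + b\<^sup>2) / 2" if "p x \<le> 1" for x b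
  proof -
    have "p (x * u b) \<le> 1 * sqrt (real m + b\<^sup>2)"
      using p_mult[of x "u b"] Suc[of b] that unfolding u_def[symmetric]
      by (meson mult_mono order_trans p_nonneg zero_le_one real_sqrt_ge_zero add_nonneg_nonneg of_nat_0_le_iff zero_le_power2)
    then show ?thesis by (simp add: p_scale)
  qed
  have "p (free_scale (of_nat (Suc m)) h + free_scale (of_real a) 1) \<le>
      sqrt (real m + (a + 1)\<^sup>2) / 2 + sqrt (real m + (a - 1)\<^sup>2) / 2"
    unfolding sum using p_add half[OF h(1)] half[OF h(2)] by (meson add_mono order_trans)
  also have "\<dots> \<le> sqrt (real (Suc m) + a\<^sup>2)"
  proof (rule real_le_rsqrt)
    define s t where "s = sqrt (real m + (a + 1)\<^sup>2)" and "t = sqrt (real m + (a - 1)\<^sup>2)"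
    (* Mean versus root mean square. *)
    have "(s / 2 + t / 2)\<^sup>2 \<le> (s\<^sup>2 + t\<^sup>2) / 2"
      using sum_squares_ge_zero[of "s - t" 0] by (simp add: power2_eq_square field_simps)
    also have "s\<^sup>2 + t\<^sup>2 = 2 * (real (Suc m) + a\<^sup>2)"
      by (simp add: s_def t_def) (simp add: power2_eq_square algebra_simps)
    finally show "(s / 2 + t / 2)\<^sup>2 \<le> real (Suc m) + a\<^sup>2" by simp
  qed
  finally show ?case .
qed

text \<open>The unit is an extreme point of the unit ball: by the random walk bound with \<open>a = 0\<close>, \<open>m h\<close> has
  norm at most \<open>sqrt m\<close> for every \<open>m\<close>.\<close>

lemma unit_extreme:
  assumes one: "p 1 = 1" and h: "p (1 + h) \<le> 1" "p (1 - h) \<le> 1"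
  shows "h \<simeq> 0"
proof (rule ccontr)
  assume "\<not> h \<simeq> 0"
  then have pos: "p h > 0" using p_nonneg[of h] by (simp add: eqv_0_iff del: p_nonneg)
  obtain m :: nat where m: "real m > 1 / (p h)\<^sup>2" using reals_Archimedean2 by blast
  have m0: "real m > 0" using m pos by (meson divide_pos_pos less_trans zero_less_one zero_less_power)
  have "real m * p h \<le> sqrt (real m)"
    using random_walk_bound[OF assms, of m 0] by (simp add: p_scale)
  then have "(real m * p h)\<^sup>2 \<le> (sqrt (real m))\<^sup>2" using pos by (intro power_mono) auto
  then have "(real m * p h)\<^sup>2 \<le> real m" by simp
  then have "real m * (real m * (p h)\<^sup>2) \<le> real m * 1"
    by (simp add: power2_eq_square mult_ac)
  then have "real m * (p h)\<^sup>2 \<le> 1" using m0 by (simp only: mult_le_cancel_left_pos)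
  with m pos show False by (simp add: divide_less_eq)
qed

text \<open>The elements \<open>b\<close> with \<open>p (1 - b) \<le> 1\<close> play the role of positive elements. The cone that they generate
  contains no line: if their sum vanishes, then \<open>- b j\<close> is the sum of the others, so a small multiple \<open>h\<close> of
  \<open>b j\<close> satisfies both bounds of the preceding lemma.\<close>

lemma sum_positive_eq_0:
  fixes b :: "'i \<Rightarrow> 'g free_star_alg"
  assumes one: "p 1 = 1" and I: "finite I" and b: "\<And>i. i \<in> I \<Longrightarrow> p (1 - b i) \<le> 1"
    and zero: "sum b I \<simeq> 0" and j: "j \<in> I"
  shows "b j \<simeq> 0"
proof -
  define M where "M = real (card I)"
  have M: "M \<ge> 1" using I j by (simp add: M_def Suc_le_eq card_gt_0_iff) blast
  define h where "h = free_scale (of_real (1 / M)) (b j)"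
  have "h \<simeq> 0"
  proof (rule unit_extreme[OF one])
    let ?r = "1 + (\<Sum>i\<in>I - {j}. 1 - b i)"
    have "?r \<simeq> free_scale (of_real M) (1 + h)"
    proof -
      have c: "(\<Sum>i\<in>I - {j}. 1) = (free_scale (of_real (M - 1)) 1 :: 'g free_star_alg)"
      proof -
        have "(\<Sum>i\<in>J. 1) = (free_scale (of_nat (card J)) 1 :: 'g free_star_alg)" for J :: "'i set"
          by (induction J rule: infinite_finite_induct) (simp_all add: free_scale_add_left)
        moreover have "complex_of_nat (card (I - {j})) = of_real (M - 1)"
          using j M by (simp add: M_def of_nat_diff)
        ultimately show ?thesis by metis
      qed
      have "?r = (1 + free_scale (of_real (M - 1)) 1 + b j) - sum b I"
        unfolding sum_subtractf c using I j by (simp add: sum.remove[of I j b])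
      also have "1 + free_scale (of_real (M - 1)) 1 + b j = free_scale (of_real M) (1 + h)"
        using M by (intro poly_mapping_eqI)
          (simp add: h_def lookup_add lookup_free_scale algebra_simps)
      also have "\<dots> - sum b I \<simeq> \<dots> - 0"
        using zero by (simp add: eqv_def)
      finally show ?thesis by simp
    qed
    moreover have "p ?r \<le> M"
    proof -
      have "p ?r \<le> p 1 + (\<Sum>i\<in>I - {j}. p (1 - b i))"
        by (rule order_trans[OF p_add add_left_mono[OF p_sum]])
      also have "\<dots> \<le> 1 + (\<Sum>i\<in>I - {j}. 1)" by (intro add_mono sum_mono) (auto simp: one b)
      also have "\<dots> = M" using j M by (simp add: M_def of_nat_diff)
      finally show ?thesis .
    qed
    ultimately have "M * p (1 + h) \<le> M * 1" using M eqv_norm p_scale[of "of_real M" "1 + h"] by fastforce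
    then show "p (1 + h) \<le> 1" using M by (simp only: mult_le_cancel_left_pos)
    have "1 - h = free_scale (of_real (1 - 1 / M)) 1 + free_scale (of_real (1 / M)) (1 - b j)"
      by (intro poly_mapping_eqI) (simp add: h_def lookup_add lookup_minus lookup_free_scale algebra_simps)
    then have "p (1 - h) \<le> (1 - 1 / M) + 1 / M * p (1 - b j)"
      using p_add[of "free_scale (of_real (1 - 1 / M)) 1" "free_scale (of_real (1 / M)) (1 - b j)"] M
      by (simp add: p_scale one del: of_real_diff of_real_divide)
    also have "\<dots> \<le> (1 - 1 / M) + 1 / M * 1" using b[OF j] M by (intro add_left_mono mult_left_mono) auto
    finally show "p (1 - h) \<le> 1" by simp
  qed
  then have "p h = 0" by (simp add: eqv_0_iff)
  then show ?thesis using M by (simp add: h_def p_scale eqv_0_iff)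
qed

text \<open>The complement of a projection is a projection, and the C*-identity gives a projection norm
  zero or one.\<close>

lemma projection_complement_le:
  assumes one: "p 1 = 1" and e: "free_adj e = e" "e * e \<simeq> e"
  shows "p (1 - e) \<le> 1"
proof -
  have "(1 - e) * (1 - e) - (1 - e) = e * e - e" by (simp add: algebra_simps)
  then have "(1 - e) * (1 - e) \<simeq> 1 - e" using e by (simp add: eqv_def)
  moreover have "free_adj (1 - e) = 1 - e" by (simp add: free_adj_diff e)
  ultimately have "p (1 - e) = (p (1 - e))\<^sup>2" using p_cstar[of "1 - e"] eqv_norm by metis
  then have "p (1 - e) * (p (1 - e) - 1) = 0" by (simp add: power2_eq_square algebra_simps)
  then show ?thesis by auto
qed

end

section \<open>Cuntz families commuting up to phases\<close>

context cstar_seminorm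
begin

definition phase_commute where "phase_commute x y \<longleftrightarrow> (\<exists>k. x * y \<simeq> free_scale k (y * x))"

lemma phase_commute_mult:
  assumes "phase_commute x z" "phase_commute y z" shows "phase_commute (x * y) z"
proof -
  obtain k l where k: "x * z \<simeq> free_scale k (z * x)" and l: "y * z \<simeq> free_scale l (z * y)"
    using assms by (auto simp: phase_commute_def)
  have "x * y * z = x * (y * z)" by (simp add: mult.assoc)
  also have "\<dots> \<simeq> x * free_scale l (z * y)" by (rule eqv_mult[OF eqv_refl l])
  also have "\<dots> = free_scale l (x * z * y)" by (simp add: free_scale_mult_right mult.assoc)
  also have "\<dots> \<simeq> free_scale l (free_scale k (z * x) * y)" by (intro eqv_scale eqv_mult k eqv_refl)
  also have "\<dots> = free_scale (l * k) (z * (x * y))"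
    by (simp add: free_scale_mult_left free_scale_scale mult.assoc)
  finally show ?thesis by (auto simp: phase_commute_def)
qed

lemma phase_commute_adj: "phase_commute x y \<Longrightarrow> phase_commute (free_adj y) (free_adj x)"
  unfolding phase_commute_def using eqv_adj by (force simp: free_adj_mult free_adj_scale)

text \<open>The scalar does not depend on \<open>v\<close>, so two factors can be swapped at the head of any product.\<close>

lemma phase_commute_left:
  assumes "phase_commute x y" obtains k where "\<And>v. x * (y * v) \<simeq> free_scale k (y * (x * v))"
proof -
  obtain k where k: "x * y \<simeq> free_scale k (y * x)" using assms by (auto simp: phase_commute_def)
  have "x * (y * v) \<simeq> free_scale k (y * (x * v))" for v
    using eqv_mult[OF k eqv_refl[of v]] by (simp add: free_scale_mult_left mult.assoc)
  then show ?thesis using that by blast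
qed

end

text \<open>Generators of one colour are isometries whose range projections add up to one, and generators of
  different colours commute up to scalars. Treating the two families of generators as two colours of one
  family makes every statement about them symmetric.\<close>

locale commuting_cuntz_families = cstar_seminorm p
  for p :: "'g::finite free_star_alg \<Rightarrow> real" +
  fixes colour :: "'g \<Rightarrow> 'c::finite"
  assumes p_one: "p 1 = 1"
    and isometry: "free_adj (gen g) * gen g \<simeq> 1"
    and ranges_sum: "(\<Sum>g | colour g = c. gen g * free_adj (gen g)) \<simeq> 1"
    and gens_phase_commute: "colour g \<noteq> colour h \<Longrightarrow> phase_commute (gen g) (gen h)"
begin

lemma p_gen: "p (gen g) = 1"
proof -
  have "(p (gen g))\<^sup>2 = 1" using eqv_norm[OF isometry[of g]] by (simp add: p_cstar p_one)
  then show ?thesis using p_nonneg[of "gen g"] by (simp add: power2_eq_1_iff del: p_nonneg)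
qed

text \<open>Let \<open>g\<close> be fixed. Sandwiching the sum of all range projections of its colour between \<open>gen g\<close> and
  its adjoint gives one, and the term of \<open>g\<close> itself is already one. The remaining terms are positive with sum
  zero, so each of them vanishes.\<close>

lemma orthogonal:
  assumes "colour h = colour g" "h \<noteq> g" shows "free_adj (gen h) * gen g \<simeq> 0"
proof -
  define I where "I = {h. colour h = colour g} - {g}"
  define b where "b h = free_adj (gen g) * (gen h * free_adj (gen h)) * gen g" for h
  have "p (1 - b h) \<le> 1" for h
  proof -
    let ?e = "gen h * free_adj (gen h)"
    have "?e * ?e = gen h * (free_adj (gen h) * gen h) * free_adj (gen h)" by (simp add: mult.assoc)
    also have "\<dots> \<simeq> gen h * 1 * free_adj (gen h)" by (intro eqv_mult eqv_refl isometry)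
    finally have "?e * ?e \<simeq> ?e" by simp
    then have e: "p (1 - ?e) \<le> 1"
      by (intro projection_complement_le p_one) (simp add: free_adj_mult)
    have "free_adj (gen g) * (1 - ?e) * gen g = free_adj (gen g) * gen g - b h"
      by (simp add: b_def algebra_simps)
    also have "\<dots> \<simeq> 1 - b h" using isometry[of g] by (simp add: eqv_def)
    finally have "p (1 - b h) = p (free_adj (gen g) * (1 - ?e) * gen g)" by (rule eqv_norm[symmetric])
    also have "\<dots> \<le> p (free_adj (gen g)) * p (1 - ?e) * p (gen g)"
      by (rule order_trans[OF p_mult mult_right_mono[OF p_mult p_nonneg]])
    finally show ?thesis using e by (simp add: p_gen)
  qed
  moreover have "sum b I \<simeq> 0"
  proof -
    have bg: "b g \<simeq> 1"
      using eqv_mult[OF isometry[of g] isometry[of g]] by (simp add: b_def mult.assoc)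
    have "b g + sum b I = sum b {h. colour h = colour g}"
      unfolding I_def by (rule sum.remove[symmetric]) simp_all
    also have "\<dots> = free_adj (gen g) * (\<Sum>h | colour h = colour g. gen h * free_adj (gen h)) * gen g"
      by (simp add: b_def sum_distrib_left sum_distrib_right)
    also have "\<dots> \<simeq> free_adj (gen g) * 1 * gen g" by (intro eqv_mult eqv_refl ranges_sum)
    also have "\<dots> \<simeq> 1" by (simp add: isometry)
    finally have "b g + sum b I + (- b g) \<simeq> 1 + (- 1)"
      using bg by (intro eqv_add) (auto simp: eqv_def p_minus_commute)
    then show ?thesis by simp
  qed
  ultimately have "b h \<simeq> 0"
    using sum_positive_eq_0[OF p_one, of I b h] assms by (simp add: I_def)
  moreover have "b h = free_adj (free_adj (gen h) * gen g) * (free_adj (gen h) * gen g)"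
    by (simp add: b_def free_adj_mult mult.assoc)
  ultimately show ?thesis by (simp add: eqv_0_iff p_cstar)
qed

lemma same_colour:
  assumes "colour h = colour g"
  shows "free_adj (gen g) * (gen h * v) \<simeq> free_scale (of_bool (g = h)) v"
proof (cases "g = h")
  case True
  then show ?thesis using eqv_mult[OF isometry[of g] eqv_refl[of v]] by (simp add: mult.assoc)
next
  case False
  then show ?thesis using eqv_mult[OF orthogonal[of g h] eqv_refl[of v]] assms by (simp add: mult.assoc)
qed

text \<open>Insert the sum of the range projections of the colour of \<open>g\<close> to the right of \<open>gen h\<close>, and
  move each of these generators past \<open>gen h\<close>; orthogonality leaves the term of \<open>g\<close> alone.\<close>

lemma adj_gen_phase_commute:
  assumes "colour g \<noteq> colour h" shows "phase_commute (free_adj (gen g)) (gen h)"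
proof -
  let ?I = "{f. colour f = colour g}"
  have "\<forall>f\<in>?I. \<exists>k. gen h * gen f \<simeq> free_scale k (gen f * gen h)"
    using gens_phase_commute[of h] assms by (auto simp: phase_commute_def)
  from bchoice[OF this] obtain k
    where k: "\<And>f. f \<in> ?I \<Longrightarrow> gen h * gen f \<simeq> free_scale (k f) (gen f * gen h)" by blast
  let ?s = "free_adj (gen g)"
  have "?s * gen h * 1 \<simeq> ?s * gen h * (\<Sum>f\<in>?I. gen f * free_adj (gen f))"
    by (intro eqv_mult eqv_refl eqv_sym[OF ranges_sum])
  also have "\<dots> = (\<Sum>f\<in>?I. ?s * (gen h * gen f) * free_adj (gen f))"
    by (simp add: sum_distrib_left mult.assoc)
  also have "\<dots> \<simeq> (\<Sum>f\<in>?I. ?s * free_scale (k f) (gen f * gen h) * free_adj (gen f))"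
    by (intro eqv_sum eqv_mult eqv_refl k)
  also have "\<dots> = (\<Sum>f\<in>?I. free_scale (k f) (?s * (gen f * (gen h * free_adj (gen f)))))"
    by (simp add: free_scale_mult_left free_scale_mult_right mult.assoc)
  also have "\<dots> \<simeq> (\<Sum>f\<in>?I. free_scale (k f) (free_scale (of_bool (g = f)) (gen h * free_adj (gen f))))"
    by (intro eqv_sum eqv_scale same_colour) simp
  also have "\<dots> = (\<Sum>f\<in>?I. if g = f then free_scale (k f) (gen h * free_adj (gen f)) else 0)"
    by (intro sum.cong) (auto simp: free_scale_scale)
  also have "\<dots> = free_scale (k g) (gen h * free_adj (gen g))" by simp
  finally show ?thesis by (auto simp: phase_commute_def)
qed

text \<open>The linear span, up to null elements, of the words of degree \<open>k\<close> in which no adjoint of a generator with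
  colour in \<open>B\<close> occurs. For \<open>B = UNIV\<close> these are the column spaces on which homogeneous elements
  act as scalar matrices. For a single colour they record how far a word raises the degree in that colour,
  whatever it does in the others.\<close>

inductive adjoint_free :: "'c set \<Rightarrow> ('c \<Rightarrow> int) \<Rightarrow> 'g free_star_alg \<Rightarrow> bool" for B where
  one: "adjoint_free B 0 1"
| gen: "adjoint_free B k v \<Longrightarrow> adjoint_free B (k + unit_degree (colour g)) (gen g * v)"
| adj: "colour g \<notin> B \<Longrightarrow> adjoint_free B k v \<Longrightarrow>
    adjoint_free B (k - unit_degree (colour g)) (free_adj (gen g) * v)"
| zero: "adjoint_free B k 0"
| add: "adjoint_free B k v \<Longrightarrow> adjoint_free B k w \<Longrightarrow> adjoint_free B k (v + w)"
| scale: "adjoint_free B k v \<Longrightarrow> adjoint_free B k (free_scale c v)"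
| equiv: "adjoint_free B k v \<Longrightarrow> v \<simeq> w \<Longrightarrow> adjoint_free B k w"

text \<open>The rule \<open>adjoint_free.equiv\<close> applies to every goal, so it is kept out of automatic search.\<close>

lemmas af_intros = adjoint_free.one adjoint_free.gen adjoint_free.adj adjoint_free.zero
  adjoint_free.add adjoint_free.scale

lemma adjoint_free_degree_eq:
  "adjoint_free B k v \<Longrightarrow> (\<And>c. k c = k' c) \<Longrightarrow> adjoint_free B k' v"
  by (metis ext)

text \<open>Only adjoints lower a degree.\<close>

lemma adjoint_free_negative:
  assumes "adjoint_free B k v" "c \<in> B" "k c < 0" shows "v \<simeq> 0"
  using assms
proof (induction rule: adjoint_free.induct)
  case (gen k v g)
  then have "v \<simeq> 0" by (simp add: unit_degree_def split: if_splits)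
  then show ?case using eqv_mult[OF eqv_refl, of v 0 "gen g"] by simp
next
  case (adj g k v)
  then have "v \<simeq> 0" by (auto simp: unit_degree_def split: if_splits)
  then show ?case using eqv_mult[OF eqv_refl, of v 0 "free_adj (gen g)"] by simp
next
  case (add k v w)
  then show ?case using eqv_add[of v 0 w 0] by simp
next
  case (scale k v c)
  then show ?case using eqv_scale[of v 0 c] by (simp add: free_scale_eq)
next
  case (equiv k v w)
  then show ?case using eqv_sym eqv_trans by blast
qed simp_all

text \<open>The adjoint passes every letter of another colour up to a scalar until it meets a generator
  of its own colour, which the degree condition guarantees to exist, and there it cancels or kills.\<close>

lemma adjoint_free_strip:
  assumes "adjoint_free B k v" "colour g \<in> B" "k (colour g) \<ge> 1"
  shows "adjoint_free B (k - unit_degree (colour g)) (free_adj (gen g) * v)"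
  using assms
proof (induction rule: adjoint_free.induct)
  case (gen k v h)
  show ?case
  proof (cases "colour h = colour g")
    case True
    have "adjoint_free B k (free_adj (gen g) * (gen h * v))"
      using adjoint_free.equiv[OF adjoint_free.scale[OF gen(1)] eqv_sym[OF same_colour[OF True]]] .
    then show ?thesis by (simp add: True)
  next
    case False
    obtain c where c: "\<And>v. free_adj (gen g) * (gen h * v) \<simeq> free_scale c (gen h * (free_adj (gen g) * v))"
      using phase_commute_left[OF adj_gen_phase_commute[of g h]] False by metis
    have "k (colour g) \<ge> 1" using gen.prems False by (simp add: unit_degree_def)
    then have "adjoint_free B (k - unit_degree (colour g)) (free_adj (gen g) * v)"
      by (rule gen.IH[OF gen.prems(1)])
    from adjoint_free.equiv[OF adjoint_free.scale[OF adjoint_free.gen[OF this]] eqv_sym[OF c]]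
    show ?thesis by (rule adjoint_free_degree_eq) simp
  qed
next
  case (adj h k v)
  then have ne: "colour h \<noteq> colour g" by auto
  obtain c where c: "\<And>v. free_adj (gen g) * (free_adj (gen h) * v) \<simeq>
      free_scale c (free_adj (gen h) * (free_adj (gen g) * v))"
    using phase_commute_left[OF phase_commute_adj[OF gens_phase_commute[OF ne]]] by metis
  have "k (colour g) \<ge> 1" using adj.prems ne by (simp add: unit_degree_def)
  then have "adjoint_free B (k - unit_degree (colour g)) (free_adj (gen g) * v)"
    by (rule adj.IH[OF adj.prems(1)])
  from adjoint_free.equiv[OF adjoint_free.scale[OF adjoint_free.adj[OF adj.hyps(1) this]] eqv_sym[OF c]]
  show ?case by (rule adjoint_free_degree_eq) simp
next
  case (equiv k v w)
  then show ?case by (intro adjoint_free.equiv[OF equiv.IH eqv_mult[OF eqv_refl equiv.hyps(2)]])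
qed (auto simp: distrib_left free_scale_mult_right intro: af_intros)

lemma adjoint_free_pairing:
  assumes "adjoint_free UNIV l u" "adjoint_free B k v" "\<And>c. c \<in> B \<Longrightarrow> l c \<le> k c"
  shows "adjoint_free B (k - l) (free_adj u * v)"
  using assms
proof (induction arbitrary: k v rule: adjoint_free.induct)
  case (gen l u g)
  have eq: "free_adj (gen g * u) * v = free_adj u * (free_adj (gen g) * v)"
    "k - (l + unit_degree (colour g)) = k - unit_degree (colour g) - l"
    by (simp add: free_adj_mult mult.assoc, rule ext, simp)
  have le: "l c \<le> (k - unit_degree (colour g)) c" if "c \<in> B" for c
    using gen.prems(2)[OF that] by (simp add: unit_degree_def)
  (* The third case is degenerate: then \<open>u\<close> has a negative degree and is null. *)
  consider "colour g \<notin> B" | "colour g \<in> B" "k (colour g) \<ge> 1" | "colour g \<in> B" "k (colour g) < 1" by linarith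
  then show ?case
  proof cases
    case 1
    then show ?thesis unfolding eq by (intro gen.IH le adjoint_free.adj gen.prems)
  next
    case 2
    then show ?thesis unfolding eq by (intro gen.IH le adjoint_free_strip gen.prems)
  next
    case 3
    then have "l (colour g) < 0" using le[of "colour g"] by (simp add: unit_degree_def)
    then have "u \<simeq> 0" using adjoint_free_negative[OF gen.hyps(1)] by auto
    then have "free_adj u \<simeq> 0" using eqv_adj[of u 0] by simp
    from eqv_mult[OF this eqv_refl] have "free_adj (gen g * u) * v \<simeq> 0" unfolding eq by simp
    then show ?thesis by (rule adjoint_free.equiv[OF adjoint_free.zero eqv_sym])
  qed
next
  case (equiv l u w)
  then show ?case by (intro adjoint_free.equiv[OF equiv.IH eqv_mult[OF eqv_adj[OF equiv.hyps(2)] eqv_refl]])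
next
  case one
  then show ?case by (auto intro: adjoint_free_degree_eq)
next
  case (adj g k v)
  then show ?case by simp
qed (simp_all add: free_adj_add free_adj_scale distrib_right free_scale_mult_left
    adjoint_free.zero adjoint_free.add adjoint_free.scale)

text \<open>Inner products of columns are numbers: a word without adjoints has degree zero only when it is
  empty.\<close>

lemma adjoint_free_scalar:
  assumes "adjoint_free UNIV 0 v" shows "\<exists>c. v \<simeq> free_scale c 1"
proof -
  have "\<exists>c. v \<simeq> free_scale c 1" if "adjoint_free UNIV k v" "k = 0" for k
    using that
  proof (induction rule: adjoint_free.induct)
    case one
    show ?case by (rule exI[of _ 1]) simp
  next
    case (gen k v g)
    have "k (colour g) < 0" using fun_cong[OF gen.prems, of "colour g"] by (simp add: unit_degree_def)
    then have "v \<simeq> 0" using adjoint_free_negative[OF gen.hyps(1)] by auto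
    then have "gen g * v \<simeq> free_scale 0 1" using eqv_mult[OF eqv_refl, of v 0 "gen g"] by simp
    then show ?case by blast
  next
    case (zero k)
    show ?case by (rule exI[of _ 0]) simp
  next
    case (add k v w)
    then obtain c d where "v \<simeq> free_scale c 1" "w \<simeq> free_scale d 1" by blast
    then have "v + w \<simeq> free_scale c 1 + free_scale d 1" by (rule eqv_add)
    also have "\<dots> = free_scale (c + d) 1" by (simp add: free_scale_eq single_add)
    finally show ?case by blast
  next
    case (scale k v d)
    then obtain c where "v \<simeq> free_scale c 1" by blast
    then have "free_scale d v \<simeq> free_scale (d * c) 1" by (metis eqv_scale free_scale_scale)
    then show ?case by blast
  next
    case (equiv k v w)
    then show ?case using eqv_sym eqv_trans by blast
  qed simp
  with assms show ?thesis by blast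
qed

lemma adjoint_free_UNIV: "adjoint_free UNIV k v \<Longrightarrow> adjoint_free B k v"
  by (induction rule: adjoint_free.induct) (blast intro: af_intros adjoint_free.equiv)+

lemma adjoint_free_mult_gen:
  "adjoint_free B k v \<Longrightarrow> adjoint_free B (k + unit_degree (colour g)) (v * gen g)"
proof (induction rule: adjoint_free.induct)
  case one
  show ?case using adjoint_free.gen[OF adjoint_free.one, of B g] by simp
next
  case (gen k v h)
  show ?case using adjoint_free_degree_eq[OF adjoint_free.gen[OF gen.IH, of h]] by (simp add: mult.assoc)
next
  case (adj h k v)
  show ?case using adjoint_free_degree_eq[OF adjoint_free.adj[OF adj.hyps(1) adj.IH]] by (simp add: mult.assoc)
next
  case (equiv k v w)
  then show ?case by (intro adjoint_free.equiv[OF equiv.IH eqv_mult[OF equiv.hyps(2) eqv_refl]])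
qed (auto simp: distrib_right free_scale_mult_left intro: af_intros)

text \<open>Each letter of the word changes a degree by at most one, so the assumed bound keeps all
  intermediate degrees positive and every adjoint in the word finds a generator to strip.\<close>

lemma adjoint_free_word:
  assumes "adjoint_free B k v" "\<And>c. c \<in> B \<Longrightarrow> int (length (letters w)) \<le> k c"
  shows "adjoint_free B (k + word_degree colour w) (Poly_Mapping.single w 1 * v)"
proof -
  have "adjoint_free B (k + sum_list (map (letter_degree colour) ls)) (Poly_Mapping.single (Word ls) 1 * v)"
    if "\<And>c. c \<in> B \<Longrightarrow> int (length ls) \<le> k c" for ls
    using that
  proof (induction ls)
    case Nil
    show ?case using assms(1) by (simp flip: zero_star_word_def)
  next
    case (Cons l ls)
    let ?v = "Poly_Mapping.single (Word ls) 1 * v" and ?d = "sum_list (map (letter_degree colour) ls)"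
    have IH: "adjoint_free B (k + ?d) ?v" using Cons by fastforce
    have w: "Poly_Mapping.single (Word (l # ls)) 1 * v = Poly_Mapping.single (Word [l]) 1 * ?v"
      by (subst single_Word_Cons) (simp add: mult.assoc)
    show ?case
    proof (cases l)
      case (Gen g)
      have "adjoint_free B (k + ?d + unit_degree (colour g)) (gen g * ?v)"
        by (rule adjoint_free.gen[OF IH])
      then show ?thesis unfolding w by (simp only: Gen gen_Word) (erule adjoint_free_degree_eq, simp)
    next
      case (Adj g)
      have "adjoint_free B (k + ?d - unit_degree (colour g)) (free_adj (gen g) * ?v)"
      proof (cases "colour g \<in> B")
        case True
        have "\<bar>?d (colour g)\<bar> \<le> int (length ls)"
          using abs_word_degree_le[of colour "Word ls" "colour g"] by (simp add: word_degree_def)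
        then have "(k + ?d) (colour g) \<ge> 1" using Cons.prems[OF True] by simp
        then show ?thesis by (rule adjoint_free_strip[OF IH True])
      qed (rule adjoint_free.adj[OF _ IH])
      then show ?thesis unfolding w by (simp only: Adj gen_Word) (erule adjoint_free_degree_eq, simp)
    qed
  qed
  from this[of "letters w"] assms(2) show ?thesis by (simp add: word_degree_def)
qed

lemma adjoint_free_sum: "(\<And>i. i \<in> I \<Longrightarrow> adjoint_free B k (f i)) \<Longrightarrow> adjoint_free B k (sum f I)"
  by (induction I rule: infinite_finite_induct) (auto intro: af_intros)

lemma adjoint_free_component:
  assumes "adjoint_free B k v" "\<And>c. c \<in> B \<Longrightarrow> int K \<le> k c"
    and K: "\<And>w. w \<in> Poly_Mapping.keys x \<Longrightarrow> length (letters w) \<le> K"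
  shows "adjoint_free B (k + d) (component colour d x * v)"
proof -
  let ?y = "component colour d x"
  have *: "adjoint_free B (k + d) (free_scale c (Poly_Mapping.single w 1) * v)"
    if "w \<in> Poly_Mapping.keys ?y" for c w
  proof -
    have w: "word_degree colour w = d" "w \<in> Poly_Mapping.keys x"
      using that by (simp_all add: component_def in_keys_iff of_bool_def split: if_splits)
    have "adjoint_free B (k + word_degree colour w) (Poly_Mapping.single w 1 * v)"
      using assms(2) K[OF w(2)] by (intro adjoint_free_word assms(1)) fastforce
    then show ?thesis by (simp add: w free_scale_mult_left adjoint_free.scale)
  qed
  show ?thesis
    by (subst free_eq_sum_monomials[of ?y], subst sum_distrib_right) (intro adjoint_free_sum *)
qed

end

section \<open>Norms bounded by matrix entries\<close>

lemma le_if_iterated_powers_le: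
  fixes a b :: real
  assumes "a \<ge> 0" "b \<ge> 0" and le: "\<And>j. a ^ 2 ^ j \<le> M * b ^ 2 ^ j"
  shows "a \<le> b"
proof (rule ccontr)
  assume "\<not> a \<le> b"
  then have ab: "a > b" by simp
  show False
  proof (cases "b = 0")
    case True
    then show False using le[of 0] ab by simp
  next
    case False
    with assms ab have b: "b > 0" "a / b > 1" by simp_all
    obtain n where n: "M < (a / b) ^ n" using real_arch_pow[OF b(2)] by blast
    have "(a / b) ^ n \<le> (a / b) ^ 2 ^ n" using b by (intro power_increasing) (auto intro: less_imp_le)
    also have "\<dots> \<le> M" using le[of n] b by (simp add: power_divide divide_le_eq)
    finally show False using n by simp
  qed
qed

context commuting_cuntz_families
begin

text \<open>Finitely many words \<open>v\<close> of degree \<open>k\<close>, with the colours in some fixed order, are isometries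
  whose range projections add up to one, so \<open>x\<close> is the sum of the terms \<open>x v v\<^sup>*\<close>. The constant \<open>M\<close> is
  the number of these words, and the induction on the total degree avoids listing them.\<close>

lemma norm_le_on_columns:
  assumes "\<And>c. 0 \<le> k c"
  shows "\<exists>M. \<forall>x K. 0 \<le> K \<longrightarrow> (\<forall>v. adjoint_free UNIV k v \<longrightarrow> p (x * v) \<le> K * p v) \<longrightarrow> p x \<le> M * K"
  using assms
proof (induction "nat (\<Sum>c\<in>UNIV. k c)" arbitrary: k)
  case 0
  then have "(\<Sum>c\<in>UNIV. k c) = 0" by (simp add: sum_nonneg order_antisym)
  then have "k c = 0" for c using 0 by (simp add: sum_nonneg_eq_0_iff)
  then have "adjoint_free UNIV k 1" by (intro adjoint_free_degree_eq[OF adjoint_free.one]) simp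
  then show ?case by (intro exI[of _ 1]) (force simp: p_one)
next
  case (Suc n)
  have "\<exists>c. k c \<ge> 1"
  proof (rule ccontr)
    assume none: "\<nexists>c. k c \<ge> 1"
    have "k c \<le> 0" for c
    proof -
      have "\<not> k c \<ge> 1" using none by blast
      then show ?thesis by linarith
    qed
    then have "(\<Sum>c\<in>UNIV. k c) \<le> 0" by (intro sum_nonpos)
    with Suc show False by simp
  qed
  then obtain c where c: "k c \<ge> 1" by blast
  define l where "l = k - unit_degree c"
  have "(\<Sum>d\<in>UNIV. l d) = (\<Sum>d\<in>UNIV. k d) - (\<Sum>d\<in>UNIV. unit_degree c d)"
    by (simp add: l_def sum_subtractf)
  also have "(\<Sum>d\<in>UNIV. unit_degree c d) = 1" by (simp add: unit_degree_def)
  finally have "n = nat (\<Sum>d\<in>UNIV. l d)" using Suc by simp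
  moreover have "0 \<le> l d" for d using c Suc.prems[of d] by (simp add: l_def unit_degree_def)
  ultimately obtain M where M: "\<And>x K. 0 \<le> K \<Longrightarrow>
      (\<And>v. adjoint_free UNIV l v \<Longrightarrow> p (x * v) \<le> K * p v) \<Longrightarrow> p x \<le> M * K"
    using Suc.hyps(1)[of l] by blast
  have "p x \<le> real (card {g. colour g = c}) * M * K"
    if K: "0 \<le> K" and x: "\<And>v. adjoint_free UNIV k v \<Longrightarrow> p (x * v) \<le> K * p v" for x K
  proof -
    have g: "p (x * gen g) \<le> M * K" if "colour g = c" for g
    proof (rule M[OF K])
      fix v assume "adjoint_free UNIV l v"
      then have "adjoint_free UNIV k (gen g * v)"
        by (rule adjoint_free_degree_eq[OF adjoint_free.gen[where g = g]]) (simp add: that l_def)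
      then have "p (x * (gen g * v)) \<le> K * p (gen g * v)" by (rule x)
      also have "\<dots> \<le> K * p v"
        using p_mult[of "gen g" v] K by (intro mult_left_mono) (simp_all add: p_gen)
      finally show "p (x * gen g * v) \<le> K * p v" by (simp add: mult.assoc)
    qed
    have "x * 1 \<simeq> x * (\<Sum>g | colour g = c. gen g * free_adj (gen g))"
      by (intro eqv_mult eqv_refl eqv_sym[OF ranges_sum])
    then have "p x = p (\<Sum>g | colour g = c. x * gen g * free_adj (gen g))"
      using eqv_norm by (fastforce simp: sum_distrib_left mult.assoc)
    also have "\<dots> \<le> (\<Sum>g | colour g = c. p (x * gen g * free_adj (gen g)))" by (rule p_sum)
    also have "\<dots> \<le> (\<Sum>g | colour g = c. M * K)"
    proof (rule sum_mono)
      fix g assume "g \<in> {g. colour g = c}"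
      then show "p (x * gen g * free_adj (gen g)) \<le> M * K"
        using p_mult[of "x * gen g" "free_adj (gen g)"] g[of g] by (simp add: p_gen)
    qed
    finally show ?thesis by simp
  qed
  then show ?case by blast
qed

text \<open>An element that maps columns of degree \<open>k\<close> to columns of degree \<open>l\<close> is a matrix of scalars, and its
  norm is at most the norm of the corresponding sesquilinear form. Evaluating the form at \<open>u = H v\<close> bounds
  \<open>H\<close> on columns, hence bounds the powers of \<open>H\<^sup>* H\<close> on columns by powers of \<open>K\<^sup>2\<close>. Passing from columns to
  the whole algebra costs a factor \<open>M\<close> that is the same for all powers, and taking roots of ever higher
  order removes it.\<close>

lemma norm_le_by_entries:
  assumes k: "\<And>c. 0 \<le> k c" and K: "0 \<le> K"
    and H: "\<And>v. adjoint_free UNIV k v \<Longrightarrow> adjoint_free UNIV l (H * v)"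
    and Ha: "\<And>u. adjoint_free UNIV l u \<Longrightarrow> adjoint_free UNIV k (free_adj H * u)"
    and entry: "\<And>u v z. adjoint_free UNIV l u \<Longrightarrow> adjoint_free UNIV k v \<Longrightarrow>
      free_adj u * (H * v) \<simeq> free_scale z 1 \<Longrightarrow> norm z \<le> K * p u * p v"
  shows "p H \<le> K"
proof -
  have Hv: "p (H * v) \<le> K * p v" if v: "adjoint_free UNIV k v" for v
  proof (cases "p (H * v) = 0")
    case True
    then show ?thesis using K by simp
  next
    case False
    then have pos: "p (H * v) > 0" using p_nonneg[of "H * v"] by (simp add: less_le del: p_nonneg)
    have "adjoint_free UNIV (l - l) (free_adj (H * v) * (H * v))"
      by (intro adjoint_free_pairing H v order_refl)
    then have "adjoint_free UNIV 0 (free_adj (H * v) * (H * v))"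
      by (rule adjoint_free_degree_eq) simp
    then obtain z where z: "free_adj (H * v) * (H * v) \<simeq> free_scale z 1"
      using adjoint_free_scalar by blast
    have "p (H * v) * p (H * v) = norm z"
      using eqv_norm[OF z] by (simp add: p_cstar p_scale p_one power2_eq_square)
    also have "\<dots> \<le> K * p (H * v) * p v" by (rule entry[OF H[OF v] v z])
    finally have "p (H * v) * p (H * v) \<le> p (H * v) * (K * p v)" by (simp add: mult_ac)
    then show ?thesis using pos by (simp only: mult_le_cancel_left_pos)
  qed
  define G where "G = free_adj H * H"
  have G_self: "free_adj G = G" by (simp add: G_def free_adj_mult)
  have Gk: "adjoint_free UNIV k (G * v)" if "adjoint_free UNIV k v" for v
    using Ha[OF H[OF that]] by (simp add: G_def mult.assoc)
  have Gv: "p (G * v) \<le> K\<^sup>2 * p v" if v: "adjoint_free UNIV k v" for v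
  proof (cases "p (G * v) = 0")
    case True
    then show ?thesis by simp
  next
    case False
    then have pos: "p (G * v) > 0" using p_nonneg[of "G * v"] by (simp add: less_le del: p_nonneg)
    have "p (G * v) * p (G * v) = p (free_adj (G * v) * (G * v))" by (simp add: p_cstar power2_eq_square)
    also have "free_adj (G * v) * (G * v) = free_adj (H * (G * v)) * (H * v)"
      by (simp add: G_def free_adj_mult mult.assoc)
    also have "p \<dots> \<le> p (H * (G * v)) * p (H * v)" using p_mult[of "free_adj (H * (G * v))"] by simp
    also have "\<dots> \<le> (K * p (G * v)) * (K * p v)"
      using K by (intro mult_mono Hv Gk v) auto
    finally have "p (G * v) * p (G * v) \<le> p (G * v) * (K\<^sup>2 * p v)" by (simp add: power2_eq_square mult_ac)
    then show ?thesis using pos by (simp only: mult_le_cancel_left_pos)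
  qed
  have Gm: "adjoint_free UNIV k (G ^ m * v) \<and> p (G ^ m * v) \<le> (K\<^sup>2) ^ m * p v"
    if v: "adjoint_free UNIV k v" for m v
  proof (induction m)
    case (Suc m)
    have "p (G * (G ^ m * v)) \<le> K\<^sup>2 * p (G ^ m * v)" using Suc by (intro Gv) simp
    also have "\<dots> \<le> K\<^sup>2 * ((K\<^sup>2) ^ m * p v)" using Suc by (intro mult_left_mono) auto
    finally have "p (G ^ Suc m * v) \<le> (K\<^sup>2) ^ Suc m * p v" by (simp only: power_Suc mult.assoc)
    moreover have "adjoint_free UNIV k (G ^ Suc m * v)"
      using Gk[of "G ^ m * v"] Suc by (simp only: power_Suc mult.assoc)
    ultimately show ?case by blast
  qed (use v in simp)
  have "\<exists>M. \<forall>x K. 0 \<le> K \<longrightarrow> (\<forall>v. adjoint_free UNIV k v \<longrightarrow> p (x * v) \<le> K * p v) \<longrightarrow> p x \<le> M * K"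
    by (rule norm_le_on_columns) (rule k)
  then obtain M where all: "\<forall>x K. 0 \<le> K \<longrightarrow> (\<forall>v. adjoint_free UNIV k v \<longrightarrow> p (x * v) \<le> K * p v) \<longrightarrow> p x \<le> M * K"
    by (rule exE)
  have "p (G ^ m) \<le> M * (K\<^sup>2) ^ m" for m
  proof (rule all[rule_format])
    show "p (G ^ m * v) \<le> (K\<^sup>2) ^ m * p v" if "adjoint_free UNIV k v" for v
      using Gm[OF that, of m] by (rule conjunct2)
  qed simp
  then have "p (G ^ 2 ^ j) \<le> M * (K\<^sup>2) ^ 2 ^ j" for j by blast
  then have "p G ^ 2 ^ j \<le> M * (K\<^sup>2) ^ 2 ^ j" for j
    unfolding p_power_self_adjoint[OF G_self] .
  then have "p G \<le> K\<^sup>2" by (rule le_if_iterated_powers_le[rotated 2]) simp_all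
  then have "(p H)\<^sup>2 \<le> K\<^sup>2" by (simp add: G_def p_cstar)
  then show ?thesis using K by (rule power2_le_imp_le)
qed

end

section \<open>Isometries that kill nonzero degrees\<close>

context commuting_cuntz_families
begin

text \<open>A run of \<open>g\<close> closed by a different generator \<open>h\<close> of the same colour. Such a word is aperiodic:
  wherever it overlaps with a proper shift of itself, some \<open>h\<close> stands opposite to a \<open>g\<close>.\<close>

definition marker :: "'g \<Rightarrow> 'g \<Rightarrow> nat \<Rightarrow> 'g free_star_alg"
  where "marker g h r = gen g ^ r * gen h"

lemma marker_simps:
  "marker g h 0 = gen h" "marker g h (Suc r) = gen g * marker g h r"
  by (simp_all add: marker_def mult.assoc)

lemma marker_isometry: "free_adj (marker g h r) * marker g h r \<simeq> 1"
proof (induction r)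
  case 0
  show ?case by (simp add: marker_simps isometry)
next
  case (Suc r)
  have "free_adj (marker g h (Suc r)) * marker g h (Suc r) =
      free_adj (marker g h r) * (free_adj (gen g) * (gen g * marker g h r))"
    by (simp add: marker_simps free_adj_mult mult.assoc)
  also have "\<dots> \<simeq> free_adj (marker g h r) * free_scale (of_bool (g = g)) (marker g h r)"
    by (intro eqv_mult eqv_refl same_colour) simp
  also have "\<dots> = free_adj (marker g h r) * marker g h r" by simp
  also note Suc
  finally show ?case .
qed

lemma marker_orthogonal:
  assumes "colour g = colour h" "g \<noteq> h" "r \<noteq> r'"
  shows "free_adj (marker g h r) * marker g h r' \<simeq> 0"
  using assms(3)
proof (induction r arbitrary: r')
  case 0
  then obtain s where s: "r' = Suc s" by (cases r') auto
  show ?case using same_colour[of g h "marker g h s"] assms by (simp add: s marker_simps)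
next
  case (Suc r)
  show ?case
  proof (cases r')
    case 0
    have "free_adj (gen h) * (gen g * marker g h r) \<simeq> 0"
      using same_colour[of g h "marker g h r"] assms by simp
    from eqv_adj[OF this] show ?thesis by (simp add: 0 marker_simps free_adj_mult mult.assoc)
  next
    case (Suc s)
    have "free_adj (marker g h (Suc r)) * marker g h r' =
        free_adj (marker g h r) * (free_adj (gen g) * (gen g * marker g h s))"
      by (simp add: Suc marker_simps free_adj_mult mult.assoc)
    also have "\<dots> \<simeq> free_adj (marker g h r) * free_scale (of_bool (g = g)) (marker g h s)"
      by (intro eqv_mult eqv_refl same_colour) simp
    also have "\<dots> = free_adj (marker g h r) * marker g h s" by simp
    also have "\<dots> \<simeq> 0" using Suc.prems Suc by (intro Suc.IH) auto
    finally show ?thesis .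
  qed
qed

lemma marker_phase_commute:
  assumes "colour f \<noteq> colour g" "colour g = colour h"
  shows "phase_commute (free_adj (marker g h r)) (gen f)"
    and "phase_commute (free_adj (marker g h r)) (free_adj (gen f))"
proof -
  have "phase_commute (free_adj (gen h')) (gen f)" "phase_commute (free_adj (gen h')) (free_adj (gen f))"
    if "colour h' = colour g" for h'
    using that assms by (auto intro!: adj_gen_phase_commute phase_commute_adj gens_phase_commute)
  with assms show "phase_commute (free_adj (marker g h r)) (gen f)"
    "phase_commute (free_adj (marker g h r)) (free_adj (gen f))"
    by (induction r) (simp_all add: marker_simps free_adj_mult phase_commute_mult)
qed

text \<open>For \<open>r' = r\<close> the condition says that \<open>v\<close> has nonzero degree in \<open>c\<close>, and the lemma says that
  compression by the marker kills it. The induction strips the generators of colour \<open>c\<close> from \<open>v\<close> against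
  the run on the left, which gets shorter while the run on the right does not; what remains are two runs of
  different lengths.\<close>

lemma marker_kills:
  assumes "adjoint_free {c} k v" and gh: "colour g = c" "colour h = c" "g \<noteq> h"
    and "k c \<le> int r" "k c + int r' \<noteq> int r"
  shows "free_adj (marker g h r) * (v * marker g h r') \<simeq> 0"
  using assms(1,5,6)
proof (induction arbitrary: r rule: adjoint_free.induct)
  case one
  then show ?case using marker_orthogonal[of g h r r'] gh by simp
next
  case (gen k v f)
  show ?case
  proof (cases "colour f = c")
    case True
    then have deg: "k c + 1 \<le> int r" "k c + 1 + int r' \<noteq> int r"
      using gen.prems by (simp_all add: unit_degree_def)
    show ?thesis
    proof (cases "k c < 0")
      case neg: True
      then have "v \<simeq> 0" using adjoint_free_negative[OF gen.hyps(1)] by simp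
      from eqv_mult[OF eqv_refl eqv_mult[OF eqv_mult[OF eqv_refl this] eqv_refl]] show ?thesis by simp
    next
      case False
      then obtain s where s: "r = Suc s" using deg by (cases r) auto
      have "free_adj (marker g h r) * (gen f * v * marker g h r') =
          free_adj (marker g h s) * (free_adj (gen g) * (gen f * (v * marker g h r')))"
        by (simp add: s marker_simps free_adj_mult mult.assoc)
      also have "\<dots> \<simeq> free_adj (marker g h s) * free_scale (of_bool (g = f)) (v * marker g h r')"
        using True gh by (intro eqv_mult eqv_refl same_colour) simp
      also have "\<dots> = free_scale (of_bool (g = f)) (free_adj (marker g h s) * (v * marker g h r'))"
        by (simp add: free_scale_mult_right)
      also have "\<dots> \<simeq> free_scale (of_bool (g = f)) 0"
        using deg s by (intro eqv_scale gen.IH) auto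
      finally show ?thesis by (simp add: free_scale_eq)
    qed
  next
    case False
    obtain z where "\<And>w. free_adj (marker g h r) * (gen f * w) \<simeq>
        free_scale z (gen f * (free_adj (marker g h r) * w))"
      using phase_commute_left[OF marker_phase_commute(1)[of f g h r]] False gh by metis
    then have "free_adj (marker g h r) * (gen f * v * marker g h r') \<simeq>
        free_scale z (gen f * (free_adj (marker g h r) * (v * marker g h r')))"
      by (simp add: mult.assoc)
    also have "\<dots> \<simeq> free_scale z (gen f * 0)"
      using gen.prems False by (intro eqv_scale eqv_mult eqv_refl gen.IH) (auto simp: unit_degree_def)
    finally show ?thesis by (simp add: free_scale_eq)
  qed
next
  case (adj f k v)
  then have ne: "colour f \<noteq> c" by simp
  obtain z where "\<And>w. free_adj (marker g h r) * (free_adj (gen f) * w) \<simeq>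
      free_scale z (free_adj (gen f) * (free_adj (marker g h r) * w))"
    using phase_commute_left[OF marker_phase_commute(2)[of f g h r]] ne gh by metis
  then have "free_adj (marker g h r) * (free_adj (gen f) * v * marker g h r') \<simeq>
      free_scale z (free_adj (gen f) * (free_adj (marker g h r) * (v * marker g h r')))"
    by (simp add: mult.assoc)
  also have "\<dots> \<simeq> free_scale z (free_adj (gen f) * 0)"
    using adj.prems ne by (intro eqv_scale eqv_mult eqv_refl adj.IH) (auto simp: unit_degree_def)
  finally show ?case by (simp add: free_scale_eq)
next
  case (zero k)
  show ?case by simp
next
  case (add k v w)
  from eqv_add[OF add.IH(1)[OF add.prems] add.IH(2)[OF add.prems]]
  show ?case by (simp add: distrib_left distrib_right)
next
  case (scale k v z)
  from eqv_scale[OF scale.IH[OF scale.prems], of z]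
  show ?case by (simp add: free_scale_mult_left free_scale_mult_right free_scale_eq[of _ 0])
next
  case (equiv k v w)
  have "free_adj (marker g h r) * (w * marker g h r') \<simeq> free_adj (marker g h r) * (v * marker g h r')"
    by (intro eqv_mult eqv_refl eqv_sym[OF equiv.hyps(2)])
  also have "\<dots> \<simeq> 0" by (rule equiv.IH[OF equiv.prems])
  finally show ?case .
qed

text \<open>Compression by a marker of one colour leaves the degree in the other colour alone, so the markers of
  both colours can be used one after the other.\<close>

lemma adjoint_free_conjugate_marker:
  assumes "adjoint_free B k v" "colour g \<notin> B" "colour h \<notin> B"
  shows "adjoint_free B k (free_adj (marker g h r) * (v * marker g h r))"
proof -
  have *: "adjoint_free B k (free_adj (gen f) * (v * gen f))"
    if "adjoint_free B k v" "colour f \<notin> B" for f v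
    by (rule adjoint_free_degree_eq[OF adjoint_free.adj[OF that(2) adjoint_free_mult_gen[OF that(1)]]])
      simp
  show ?thesis using assms(1)
  proof (induction r arbitrary: v)
    case 0
    then show ?case using * assms by (simp add: marker_simps)
  next
    case (Suc r)
    from Suc.IH[OF *[OF Suc.prems assms(2)]] show ?case
      by (simp add: marker_simps free_adj_mult mult.assoc)
  qed
qed

end

locale two_cuntz_families = commuting_cuntz_families p colour
  for p :: "'g::finite free_star_alg \<Rightarrow> real" and colour :: "'g \<Rightarrow> 'c::finite" +
  fixes c d :: 'c and a a' b b' :: 'g
  assumes colours: "UNIV = {c, d}" "c \<noteq> d"
    and gens_c: "colour a = c" "colour a' = c" "a \<noteq> a'"
    and gens_d: "colour b = d" "colour b' = d" "b \<noteq> b'"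
begin

definition double_marker :: "nat \<Rightarrow> 'g free_star_alg"
  where "double_marker r = marker a a' r * marker b b' r"

lemma double_marker_isometry: "free_adj (double_marker r) * double_marker r \<simeq> 1"
proof -
  have "free_adj (double_marker r) * double_marker r =
      free_adj (marker b b' r) * (free_adj (marker a a' r) * marker a a' r) * marker b b' r"
    by (simp add: double_marker_def free_adj_mult mult.assoc)
  also have "\<dots> \<simeq> free_adj (marker b b' r) * 1 * marker b b' r"
    by (intro eqv_mult eqv_refl marker_isometry)
  also have "\<dots> \<simeq> 1" by (simp add: marker_isometry)
  finally show ?thesis .
qed

lemma double_marker_kills:
  assumes v: "adjoint_free {e} k v" and k: "1 \<le> k e" "k e \<le> int r"
  shows "free_adj (double_marker r) * (v * double_marker r) \<simeq> 0"
proof -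
  let ?a = "marker a a' r" and ?b = "marker b b' r"
  have eq: "free_adj (double_marker r) * (v * double_marker r) =
      free_adj ?b * ((free_adj ?a * (v * ?a)) * ?b)"
    by (simp add: double_marker_def free_adj_mult mult.assoc)
  consider "e = c" | "e = d" using colours(1) by auto
  then show ?thesis
  proof cases
    case 1
    then have "free_adj ?a * (v * ?a) \<simeq> 0"
      using v k gens_c by (intro marker_kills) auto
    from eqv_mult[OF eqv_refl eqv_mult[OF this eqv_refl]] show ?thesis unfolding eq by simp
  next
    case 2
    have "adjoint_free {d} k (free_adj ?a * (v * ?a))"
      using v 2 gens_c colours(2) by (intro adjoint_free_conjugate_marker) auto
    then show ?thesis unfolding eq
      using k 2 gens_d by (intro marker_kills) auto
  qed
qed

lemma p_double_marker: "p (double_marker r) = 1"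
proof -
  have "(p (double_marker r))\<^sup>2 = 1"
    using eqv_norm[OF double_marker_isometry[of r]] by (simp add: p_cstar p_one)
  then show ?thesis using p_nonneg[of "double_marker r"] by (simp add: power2_eq_1_iff del: p_nonneg)
qed

text \<open>Up to an arbitrarily small loss, the norm of a homogeneous component of \<open>x\<close> is visible as a scalar
  multiple of the unit of the form \<open>y x y'\<close> with contractions \<open>y\<close> and \<open>y'\<close>. A matrix entry
  \<open>u\<^sup>* H v\<close> of the component \<open>H\<close> exceeds \<open>K\<close> in modulus relative to the norms of \<open>u\<close> and \<open>v\<close>, since otherwise
  \<open>H\<close> would have norm at most \<open>K\<close>. The other components contribute terms of nonzero degree to \<open>u\<^sup>* x v\<close>,
  and a double marker kills all of these while fixing the scalar.\<close>

lemma component_attained: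
  assumes K: "0 \<le> K" "K < p (component colour k x)"
  shows "\<exists>y y' z. p y \<le> 1 \<and> p y' \<le> 1 \<and> y * x * y' \<simeq> free_scale z 1 \<and> K < norm z"
proof -
  let ?H = "component colour k x"
  obtain L where L: "\<And>w. w \<in> Poly_Mapping.keys x \<Longrightarrow> length (letters w) \<le> L"
    using word_lengths_bounded[of x] by blast
  (* Columns of degree \<open>m\<close> are long enough for every word of \<open>x\<close> to act on them, and so are columns
     of degree \<open>l\<close> for every word of the adjoint of \<open>x\<close>. *)
  define m where "m e = int L + \<bar>k e\<bar>" for e
  define l where "l = m + k"
  have m: "int L \<le> m e" "0 \<le> m e" and l: "int L \<le> l e" for e
    by (simp_all add: m_def l_def)
  have adj_H: "free_adj ?H = component colour (- k) (free_adj x)"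
    by (intro poly_mapping_eqI)
      (auto simp: component_def lookup_free_adj word_degree_adj of_bool_def minus_equation_iff)
  have L': "length (letters w) \<le> L" if "w \<in> Poly_Mapping.keys (free_adj x)" for w
    using L[of "word_adj w"] that by (simp add: in_keys_iff lookup_free_adj word_adj_def)
  have "\<exists>u v z. adjoint_free UNIV l u \<and> adjoint_free UNIV m v \<and>
      free_adj u * (?H * v) \<simeq> free_scale z 1 \<and> K * p u * p v < norm z"
  proof (rule ccontr)
    assume no: "\<not> ?thesis"
    have "p ?H \<le> K"
    proof (rule norm_le_by_entries[where k = m and l = l])
      fix v assume "adjoint_free UNIV m v"
      then show "adjoint_free UNIV l (?H * v)"
        unfolding l_def using m L by (intro adjoint_free_component) auto
    next
      fix u assume "adjoint_free UNIV l u"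
      then have "adjoint_free UNIV (l + - k) (free_adj ?H * u)"
        unfolding adj_H using l L' by (intro adjoint_free_component) auto
      then show "adjoint_free UNIV m (free_adj ?H * u)"
        by (rule adjoint_free_degree_eq) (simp add: l_def)
    next
      fix u v z
      assume "adjoint_free UNIV l u" "adjoint_free UNIV m v" "free_adj u * (?H * v) \<simeq> free_scale z 1"
      then show "norm z \<le> K * p u * p v" using no not_less by blast
    qed (use m K in auto)
    with K show False by simp
  qed
  then obtain u v z where u: "adjoint_free UNIV l u" and v: "adjoint_free UNIV m v"
    and z: "free_adj u * (?H * v) \<simeq> free_scale z 1" and large: "K * p u * p v < norm z" by blast
  have "norm z \<le> p u * (p ?H * p v)"
  proof -
    have "norm z = p (free_adj u * (?H * v))" using eqv_norm[OF z] by (simp add: p_scale p_one)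
    also have "\<dots> \<le> p (free_adj u) * (p ?H * p v)"
      by (rule order_trans[OF p_mult mult_left_mono[OF p_mult p_nonneg]])
    finally show ?thesis by simp
  qed
  moreover have "0 \<le> K * p u * p v" using K by simp
  ultimately have "p u * (p ?H * p v) > 0" using large by linarith
  then have "p u \<noteq> 0" "p v \<noteq> 0" by auto
  then have pos: "p u > 0" "p v > 0" using p_nonneg by (simp_all add: less_le)
  (* The run must be at least as long as any degree that can survive in \<open>u\<^sup>* w v\<close>, where \<open>w\<close> is a
     word of \<open>x\<close>. *)
  define r where "r = nat (int L + \<bar>k c\<bar> + \<bar>k d\<bar>)"
  let ?W = "double_marker r"
  have kill: "free_adj ?W * (free_adj u * (Poly_Mapping.single w 1 * v) * ?W) \<simeq> 0"
    if w: "w \<in> Poly_Mapping.keys x" and ne: "word_degree colour w \<noteq> k" for w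
  proof -
    let ?w = "Poly_Mapping.single w 1" and ?n = "word_degree colour w"
    (* In the colour \<open>e\<close> either \<open>u\<^sup>* w v\<close> or its adjoint has positive degree; the marker kills
       that one, and with it the other. *)
    obtain e where e: "?n e \<noteq> k e" using ne by blast
    have "\<bar>k e\<bar> \<le> \<bar>k c\<bar> + \<bar>k d\<bar>" using colours(1) by (metis UNIV_I abs_ge_zero add.commute empty_iff insert_iff le_add_same_cancel2)
    moreover have "\<bar>?n e\<bar> \<le> int L" using abs_word_degree_le[of colour w e] L[OF w] by linarith
    ultimately have r: "\<bar>?n e - k e\<bar> \<le> int r" by (simp add: r_def)
    show ?thesis
    proof (cases "k e < ?n e")
      case True
      have "adjoint_free {e} (m + ?n) (?w * v)"
        using L[OF w] m by (intro adjoint_free_word adjoint_free_UNIV[OF v]) (meson of_nat_mono order_trans)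
      then have "adjoint_free {e} (m + ?n - l) (free_adj u * (?w * v))"
        using True by (intro adjoint_free_pairing[OF u]) (auto simp: l_def)
      then show ?thesis
        by (rule double_marker_kills) (use True r in \<open>auto simp: l_def\<close>)
    next
      case False
      have adj: "free_adj (free_adj u * (?w * v)) = free_adj v * (Poly_Mapping.single (word_adj w) 1 * u)"
        by (simp add: free_adj_mult free_adj_single mult.assoc)
      have "length (letters (word_adj w)) = length (letters w)" by (simp add: word_adj_def)
      then have "adjoint_free {e} (l + word_degree colour (word_adj w)) (Poly_Mapping.single (word_adj w) 1 * u)"
        using L[OF w] l by (intro adjoint_free_word adjoint_free_UNIV[OF u]) (metis of_nat_mono order_trans)
      then have "adjoint_free {e} (l + word_degree colour (word_adj w) - m) (free_adj (free_adj u * (?w * v)))"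
        unfolding adj using False by (intro adjoint_free_pairing[OF v]) (auto simp: l_def word_degree_adj)
      then have "free_adj ?W * (free_adj (free_adj u * (?w * v)) * ?W) \<simeq> 0"
        by (rule double_marker_kills) (use False e r in \<open>auto simp: l_def word_degree_adj\<close>)
      from eqv_adj[OF this] show ?thesis by (simp add: free_adj_mult mult.assoc)
    qed
  qed
  define f where "f y = free_adj ?W * (free_adj u * (y * v) * ?W)" for y
  have f_add: "f (y + y') = f y + f y'" for y y' by (simp add: f_def distrib_left distrib_right)
  have f_scale: "f (free_scale s y) = free_scale s (f y)" for s y
    by (simp add: f_def free_scale_mult_left free_scale_mult_right)
  have f_sum: "f (sum g I) = (\<Sum>i\<in>I. f (g i))" for g and I :: "'g star_word set"
    by (induction I rule: infinite_finite_induct) (simp_all add: f_add, simp_all add: f_def)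
  have rest: "f (x - ?H) \<simeq> 0"
  proof -
    let ?s = "\<lambda>w. free_scale (Poly_Mapping.lookup (x - ?H) w) (Poly_Mapping.single w 1)"
    have "f (x - ?H) = (\<Sum>w\<in>Poly_Mapping.keys (x - ?H). f (?s w))"
      by (subst free_eq_sum_monomials[of "x - ?H"]) (rule f_sum)
    also have "\<dots> \<simeq> (\<Sum>w\<in>Poly_Mapping.keys (x - ?H). 0)"
    proof (rule eqv_sum)
      fix w assume "w \<in> Poly_Mapping.keys (x - ?H)"
      then have "w \<in> Poly_Mapping.keys x" "word_degree colour w \<noteq> k"
        by (auto simp: in_keys_iff lookup_minus component_def)
      from eqv_scale[OF kill[OF this], of "Poly_Mapping.lookup (x - ?H) w"]
      show "f (?s w) \<simeq> 0" unfolding f_scale by (simp add: f_def free_scale_eq[of _ 0])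
    qed
    finally show ?thesis by simp
  qed
  have main: "f ?H \<simeq> free_scale z 1"
  proof -
    have "f ?H \<simeq> free_adj ?W * (free_scale z 1 * ?W)"
      unfolding f_def by (intro eqv_mult eqv_refl z)
    also have "\<dots> = free_scale z (free_adj ?W * ?W)"
      by (simp add: free_scale_mult_left free_scale_mult_right)
    also have "\<dots> \<simeq> free_scale z 1" by (intro eqv_scale double_marker_isometry)
    finally show ?thesis .
  qed
  have fx: "f x \<simeq> free_scale z 1"
    using eqv_add[OF main rest] f_add[of ?H "x - ?H"] by simp
  define y where "y = free_scale (of_real (1 / p u)) (free_adj ?W * free_adj u)"
  define y' where "y' = free_scale (of_real (1 / p v)) (v * ?W)"
  define z' where "z' = of_real (1 / p u) * of_real (1 / p v) * z"
  have "p y \<le> 1"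
    using p_mult[of "free_adj ?W" "free_adj u"] pos by (simp add: y_def p_scale p_double_marker norm_divide)
  moreover have "p y' \<le> 1"
    using p_mult[of v ?W] pos by (simp add: y'_def p_scale p_double_marker norm_divide)
  moreover have "y * x * y' \<simeq> free_scale z' 1"
  proof -
    have "y * x * y' = free_scale (of_real (1 / p u) * of_real (1 / p v)) (f x)"
      unfolding y_def y'_def f_def
      by (simp only: free_scale_mult_left free_scale_mult_right free_scale_scale mult.assoc mult.commute)
    also have "\<dots> \<simeq> free_scale (of_real (1 / p u) * of_real (1 / p v)) (free_scale z 1)"
      by (rule eqv_scale[OF fx])
    finally show ?thesis by (simp only: free_scale_scale z'_def)
  qed
  moreover have "K < norm z'"
    using large pos by (simp add: z'_def norm_mult norm_divide field_simps)
  ultimately show ?thesis by blast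
qed

end

section \<open>Pure infiniteness\<close>

locale gauge_invariant_cuntz_families =
  two_cuntz_families p colour c d a a' b b' + gauge_invariant_seminorm p colour
  for p :: "'g::finite free_star_alg \<Rightarrow> real" and colour :: "'g \<Rightarrow> 'c::finite"
    and c d a a' b b'
begin

text \<open>The approximation of \<open>X\<close> is done twice. The crude approximant \<open>x0\<close> fixes a finite set of
  degrees, in one of which every sufficiently good approximant has a component above \<open>\<epsilon>\<close>. For the better
  approximant \<open>x\<close>, at distance less than \<open>\<epsilon>\<close> from \<open>X\<close>, some \<open>y x y'\<close> is a scalar of modulus above \<open>\<epsilon>\<close>.
  Then \<open>y X y'\<close> is closer to that scalar than its modulus, hence has a right inverse.\<close>

theorem purely_infinite_completion: "purely_infinite (cstar_completion p)"
proof -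
  interpret A: unital_cstar_algebra "cstar_completion p" by (rule unital_cstar_algebra_completion)
  define e where "e x = cls (\<lambda>_. x)" for x
  have e: "e x \<in> carrier C" for x by (auto simp: e_def carrier_C)
  have norm_e: "cnorm C (e x) = p x" for x by (simp add: e_def)
  have e_diff: "e x \<ominus>\<^bsub>C\<^esub> e y = e (x - y)" for x y by (simp add: e_def minus_C)
  have e_mult: "e x \<otimes>\<^bsub>C\<^esub> e y = e (x * y)" for x y by (simp add: e_def mult_C)
  have e_eqv: "x \<simeq> y \<Longrightarrow> e x = e y" for x y by (simp add: e_def cls_eq_iff eqv_def)
  have e_scalar: "e (free_scale z 1) = cscale C z \<one>\<^bsub>C\<^esub>" for z
    by (simp add: e_def scale_C one_C)
  have "\<exists>y\<in>carrier C. \<exists>y'\<in>carrier C. y \<otimes>\<^bsub>C\<^esub> X \<otimes>\<^bsub>C\<^esub> y' = \<one>\<^bsub>C\<^esub>"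
    if X: "X \<in> carrier C" and nonzero: "X \<noteq> \<zero>\<^bsub>C\<^esub>" for X
  proof -
    define \<eta> where "\<eta> = cnorm C X"
    have \<eta>: "\<eta> > 0" using A.cnorm_nonneg[OF X] A.norm_eq_0[OF X] nonzero by (simp add: \<eta>_def less_le)
    obtain x0 where x0: "cnorm C (X \<ominus>\<^bsub>C\<^esub> e x0) < \<eta> / 4"
      using dense_C[OF X, of "\<eta> / 4"] \<eta> by (auto simp: e_def)
    obtain D where D: "finite D"
      "\<And>y. p x0 \<le> (\<Sum>k\<in>D. p (component colour k y)) + p (x0 - y) + \<eta> / 4"
      using seminorm_le_components[OF colours(1), of "\<eta> / 4" x0] \<eta> by auto
    define \<epsilon> where "\<epsilon> = \<eta> / (8 * (real (card D) + 1))"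
    have \<epsilon>: "\<epsilon> > 0" "\<epsilon> \<le> \<eta> / 8" "real (card D) * \<epsilon> \<le> \<eta> / 8"
      using \<eta> by (simp_all add: \<epsilon>_def field_simps)
    obtain x where x: "cnorm C (X \<ominus>\<^bsub>C\<^esub> e x) < \<epsilon>"
      using dense_C[OF X \<epsilon>(1)] by (auto simp: e_def)
    have "\<exists>k\<in>D. \<epsilon> < p (component colour k x)"
    proof (rule ccontr)
      assume "\<not> ?thesis"
      then have "(\<Sum>k\<in>D. p (component colour k x)) \<le> (\<Sum>k\<in>D. \<epsilon>)"
        by (intro sum_mono) (auto simp: not_less)
      then have "(\<Sum>k\<in>D. p (component colour k x)) \<le> \<eta> / 8" using \<epsilon>(3) by simp
      moreover have "p (x0 - x) < \<eta> / 4 + \<eta> / 8"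
      proof -
        have "p (x0 - x) = cnorm C (e x0 \<ominus>\<^bsub>C\<^esub> e x)" by (simp add: e_diff norm_e)
        also have "\<dots> \<le> cnorm C (e x0 \<ominus>\<^bsub>C\<^esub> X) + cnorm C (X \<ominus>\<^bsub>C\<^esub> e x)"
          by (intro norm_minus_triangle_C e X)
        also have "cnorm C (e x0 \<ominus>\<^bsub>C\<^esub> X) = cnorm C (X \<ominus>\<^bsub>C\<^esub> e x0)" by (rule norm_minus_commute_C[OF e X])
        finally show ?thesis using x0 x \<epsilon>(2) by linarith
      qed
      moreover have "\<eta> \<le> cnorm C (X \<ominus>\<^bsub>C\<^esub> e x0) + p x0"
      proof -
        have "X = (X \<ominus>\<^bsub>C\<^esub> e x0) \<oplus>\<^bsub>C\<^esub> e x0"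
          using X e[of x0] by (simp add: a_minus_def A.a_assoc A.l_neg)
        then show ?thesis
          using A.norm_add[of "X \<ominus>\<^bsub>C\<^esub> e x0" "e x0"] X e[of x0] by (simp add: \<eta>_def norm_e)
      qed
      ultimately show False using D(2)[of x] x0 by linarith
    qed
    then obtain k where "\<epsilon> < p (component colour k x)" by blast
    then obtain y y' z where y: "p y \<le> 1" "p y' \<le> 1" and z: "y * x * y' \<simeq> free_scale z 1" "\<epsilon> < norm z"
      using component_attained[of \<epsilon> k x] \<epsilon>(1) by auto
    have z0: "z \<noteq> 0" using z(2) \<epsilon>(1) by auto
    define Y where "Y = e y \<otimes>\<^bsub>C\<^esub> X \<otimes>\<^bsub>C\<^esub> e y'"
    have Y: "Y \<in> carrier C" using X e by (simp add: Y_def)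
    have near: "cnorm C (Y \<ominus>\<^bsub>C\<^esub> cscale C z \<one>\<^bsub>C\<^esub>) < norm z"
    proof -
      have "cscale C z \<one>\<^bsub>C\<^esub> = e y \<otimes>\<^bsub>C\<^esub> e x \<otimes>\<^bsub>C\<^esub> e y'"
        by (simp add: e_mult e_eqv[OF z(1)] flip: e_scalar)
      then have "Y \<ominus>\<^bsub>C\<^esub> cscale C z \<one>\<^bsub>C\<^esub> = e y \<otimes>\<^bsub>C\<^esub> (X \<ominus>\<^bsub>C\<^esub> e x) \<otimes>\<^bsub>C\<^esub> e y'"
        unfolding Y_def using X e[of x] e[of y] e[of y']
        by (simp add: a_minus_def A.l_distr A.r_distr A.l_minus A.r_minus)
      also have "cnorm C \<dots> \<le> cnorm C (e y \<otimes>\<^bsub>C\<^esub> (X \<ominus>\<^bsub>C\<^esub> e x)) * cnorm C (e y')"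
        using X e by (intro A.norm_mult_le) simp_all
      also have "\<dots> \<le> (cnorm C (e y) * cnorm C (X \<ominus>\<^bsub>C\<^esub> e x)) * cnorm C (e y')"
        using X e by (intro mult_right_mono A.norm_mult_le A.cnorm_nonneg) simp_all
      also have "\<dots> \<le> (1 * cnorm C (X \<ominus>\<^bsub>C\<^esub> e x)) * 1"
        using X e y by (intro mult_mono mult_nonneg_nonneg A.cnorm_nonneg) (simp_all add: norm_e)
      finally show ?thesis using x z(2) by simp
    qed
    define U where "U = cscale C (1 / z) Y"
    have U: "U \<in> carrier C" using Y by (simp add: U_def A.scale_closed)
    have "U \<ominus>\<^bsub>C\<^esub> \<one>\<^bsub>C\<^esub> = cscale C (1 / z) (Y \<ominus>\<^bsub>C\<^esub> cscale C z \<one>\<^bsub>C\<^esub>)"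
      using Y z0 by (simp add: U_def a_minus_def A.a_inv_eq_scale A.scale_add_right A.scale_closed
        A.scale_scale)
    then have "cnorm C (U \<ominus>\<^bsub>C\<^esub> \<one>\<^bsub>C\<^esub>) < 1"
      using near Y z0 by (simp add: A.norm_scale A.scale_closed norm_divide divide_less_eq)
    then obtain V where V: "V \<in> carrier C" "U \<otimes>\<^bsub>C\<^esub> V = \<one>\<^bsub>C\<^esub>"
      using A.right_inverse_near_one[OF U] by blast
    have "cscale C (1 / z) (e y) \<otimes>\<^bsub>C\<^esub> X \<otimes>\<^bsub>C\<^esub> (e y' \<otimes>\<^bsub>C\<^esub> V) = U \<otimes>\<^bsub>C\<^esub> V"
      using X e[of y] e[of y'] V(1)
      by (simp add: U_def Y_def A.scale_mult_left A.m_assoc A.scale_closed)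
    with V X e show ?thesis by (metis A.m_closed A.scale_closed)
  qed
  then show ?thesis unfolding purely_infinite_def using A.unital_cstar_algebra_axioms by blast
qed

end

text \<open>Composing the universal seminorm with a gauge automorphism gives another admissible seminorm, because
  the automorphism only multiplies relators by scalars; and the universal seminorm is the largest one.\<close>

lemma gauge_invariant_universal_seminorm:
  assumes R: "bounded_relators R"
    and homogeneous: "\<And>c z r. norm z = 1 \<Longrightarrow> r \<in> R \<Longrightarrow> \<exists>s. gauge colour c z r = free_scale s r"
  shows "gauge_invariant_seminorm (universal_seminorm R) colour"
proof -
  interpret cstar_seminorm "universal_seminorm R" using R by (rule cstar_seminorm_universal)
  show ?thesis
  proof
    fix c :: 'b and z :: complex and x assume z: "norm z = 1"
    then have z0: "z \<noteq> 0" by auto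
    let ?q = "\<lambda>x. universal_seminorm R (gauge colour c z x)"
    have "cstar_seminorm ?q"
      using z z0 by unfold_locales
        (simp_all add: gauge_mult gauge_adj gauge_add gauge_scale p_mult p_cstar p_scale p_add)
    moreover have "?q r = 0" if "r \<in> R" for r
      using homogeneous[OF z that, of c] universal_seminorm_relator[OF R that] by (auto simp: p_scale)
    ultimately have "?q \<in> admissible_seminorms R" by (simp add: admissible_seminorms_def)
    then show "?q x \<le> universal_seminorm R x" by (rule le_universal_seminorm[OF R])
  qed
qed

lemma twisted_relators_homogeneous:
  fixes \<Theta> :: "complex ^ 'm::finite ^ 'n::finite"
  assumes z: "norm z = 1" and r: "r \<in> twisted_relators \<Theta>"
  shows "\<exists>s. gauge isl c z r = free_scale s r"
proof -
  have z0: "z \<noteq> 0" using z by auto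
  define s where "s g = z powi unit_degree (isl g) c" for g :: "'n + 'm"
  have gen: "gauge isl c z (gen g) = free_scale (s g) (gen g)" for g :: "'n + 'm"
    by (simp only: gauge_gen s_def)
  have "cnj (s g) * s g = 1" for g
  proof -
    have "norm (s g) = 1" using z by (simp add: s_def norm_power_int)
    then show ?thesis using complex_norm_square[of "s g"] by (simp add: mult.commute)
  qed
  then have unit: "cnj (s g) * s g = 1" "s g * cnj (s g) = 1" for g by (simp_all add: mult.commute)
  have invariant: "gauge isl c z (free_adj (gen g) * gen g) = free_adj (gen g) * gen g"
    "gauge isl c z (gen g * free_adj (gen g)) = gen g * free_adj (gen g)" for g :: "'n + 'm"
    by (simp_all add: gauge_mult[OF z0] gauge_adj[OF z] gen free_adj_scale free_scale_mult_left
      free_scale_mult_right free_scale_scale unit)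
  show ?thesis
    using r unfolding twisted_relators_def Let_def
  proof (elim UnE CollectE exE conjE insertE emptyE)
    fix i j assume "r = gen (Inl i) * gen (Inr j) - free_scale (\<Theta> $ i $ j) (gen (Inr j) * gen (Inl i))"
    then have "gauge isl c z r = free_scale (s (Inl i) * s (Inr j)) r"
      by (simp add: gauge_diff gauge_scale gauge_mult[OF z0] gen free_scale_mult_left
        free_scale_mult_right free_scale_scale mult_ac)
        (simp add: free_scale_eq right_diff_distrib mult_single flip: mult.assoc)
    then show ?thesis by blast
  qed (rule exI[of _ 1], simp add: gauge_diff gauge_1 gauge_sum invariant)+
qed

lemma ex_distinct_elements:
  assumes "CARD('a::finite) \<ge> 2" shows "\<exists>x y :: 'a. x \<noteq> y"
proof (rule ccontr)
  assume "\<not> ?thesis"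
  then have "(UNIV :: 'a set) \<subseteq> {undefined}" by blast
  then have "CARD('a) \<le> card {undefined :: 'a}" by (intro card_mono) auto
  with assms show False by simp
qed

text \<open>If the unit has seminorm zero, the algebra is zero and there is nothing to invert. Otherwise the unit has
  norm one, as the C*-identity requires, and the two Cuntz families satisfy the hypotheses above. The colours
  are \<open>True\<close> for the \<open>s\<^sub>i\<close> and \<open>False\<close> for the \<open>t\<^sub>j\<close>.\<close>

theorem proposition4p7:
  fixes \<Theta> :: "complex ^ 'm::finite ^ 'n::finite"
  assumes "CARD('n) \<ge> 2" and "CARD('m) \<ge> 2"
    and "\<And>i j. norm (\<Theta> $ i $ j) = 1"
  shows "purely_infinite (twisted_tensor \<Theta>)"
proof -
  let ?R = "twisted_relators \<Theta>"
  let ?p = "universal_seminorm ?R"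
  note R = bounded_twisted_relators[of \<Theta>]
  interpret gauge_invariant_seminorm ?p "isl :: 'n + 'm \<Rightarrow> bool"
    by (rule gauge_invariant_universal_seminorm[OF R twisted_relators_homogeneous])
  have twisted: "twisted_tensor \<Theta> = cstar_completion ?p"
    by (simp add: twisted_tensor_def universal_cstar_algebra_def)
  have rel: "eqv x y" if "x - y \<in> ?R" for x y
    using universal_seminorm_relator[OF R that] by (simp add: eqv_def)
  show ?thesis
  proof (cases "?p 1 = 0")
    case True
    have "?p x = 0" for x using p_mult[of x 1] p_nonneg[of x] True by (simp del: p_nonneg)
    then have "X = \<zero>\<^bsub>cstar_completion ?p\<^esub>" if "X \<in> carrier (cstar_completion ?p)" for X
    proof -
      obtain x where "X = Cauchy_class ?p x" using \<open>X \<in> carrier (cstar_completion ?p)\<close> by (auto simp: carrier_C)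
      also have "\<dots> = \<zero>\<^bsub>cstar_completion ?p\<^esub>"
        unfolding zero_C by (rule cls_eqI) (simp add: \<open>\<And>x. ?p x = 0\<close>)
      finally show ?thesis .
    qed
    then show ?thesis
      unfolding twisted purely_infinite_def using unital_cstar_algebra_completion by blast
  next
    case False
    have "?p 1 * ?p 1 = ?p 1" using p_cstar[of 1] by (simp add: power2_eq_square)
    then have p_one: "?p 1 = 1" using False by simp
    obtain i i' :: 'n where ni: "i \<noteq> i'" using ex_distinct_elements[OF assms(1)] by blast
    obtain j j' :: 'm where nj: "j \<noteq> j'" using ex_distinct_elements[OF assms(2)] by blast
    interpret gauge_invariant_cuntz_families ?p isl True False "Inl i" "Inl i'" "Inr j" "Inr j'"
    proof
      fix g show "eqv (free_adj (gen g) * gen g) 1"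
        by (rule rel) (cases g; auto simp: twisted_relators_def Let_def)
    next
      fix c
      have "{g :: 'n + 'm. isl g = True} = Inl ` UNIV" "{g :: 'n + 'm. isl g = False} = Inr ` UNIV"
        by (auto simp: image_iff isl_def) (metis sum.exhaust)
      then have "(\<Sum>g | isl g = c. gen g * free_adj (gen g)) =
          (if c then (\<Sum>i\<in>UNIV. gen (Inl i :: 'n + 'm) * free_adj (gen (Inl i)))
           else (\<Sum>j\<in>UNIV. gen (Inr j :: 'n + 'm) * free_adj (gen (Inr j))))"
        by (cases c) (simp_all add: sum.reindex)
      then show "eqv (\<Sum>g | isl g = c. gen g * free_adj (gen g)) 1"
        by (intro rel) (auto simp: twisted_relators_def Let_def)
    next
      have lr: "eqv (gen (Inl i) * gen (Inr j)) (free_scale (\<Theta> $ i $ j) (gen (Inr j) * gen (Inl i)))" for i j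
        by (rule rel) (auto simp: twisted_relators_def Let_def)
      have rl: "eqv (gen (Inr j) * gen (Inl i)) (free_scale (inverse (\<Theta> $ i $ j)) (gen (Inl i) * gen (Inr j)))" for i j
      proof -
        have "\<Theta> $ i $ j \<noteq> 0" using assms(3)[of i j] by auto
        then show ?thesis
          using eqv_sym[OF eqv_scale[OF lr[of i j], of "inverse (\<Theta> $ i $ j)"]] by (simp add: free_scale_scale)
      qed
      fix g h :: "'n + 'm" assume "isl g \<noteq> isl h"
      then show "phase_commute (gen g) (gen h)"
        unfolding phase_commute_def by (cases g; cases h; simp; blast intro: lr rl)
    qed (use p_one ni nj in auto)
    show ?thesis unfolding twisted by (rule purely_infinite_completion)
  qed
qed

end
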